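(* Let $\mathcal D=(V,E,F)$ be a simply connected quad-graph and let $f:V\to\mathbb R^3\subset\mathbb{RP}^3$ be a generic affine A-net for which cusps are excluded (in the sense specified in the context). Then $f$ can be extended to a hyperbolic net if and only if all strips of $f$ are equi-twisted. In this case there exists a 1-parameter family of hyperbolic nets extending $f$, and each such net is determined by the choice of one initial hyperboloid patch bounded by one arbitrary skew quadrilateral of the A-net. That is: for every face $Q\in F$ and every hyperboloid patch bounded by the skew quadrilateral of $Q$ (these patches form a 1-parameter family), there is exactly one hyperbolic net extending $f$ whose patch at $Q$ is the given one.
   Context: A quad-graph $\mathcal D=(V,E,F)$ is a strongly regular polytopal cell decomposition of a surface (possibly with boundary) all of whose faces are quadrilaterals. (Strongly regular: the closed cells are embedded and any two closed cells intersect in a single closed cell or not at all.) It is simply connected if the surface is. The vertex star of $v\in V$ consists of $v$ and all adjacent vertices. A discrete A-net is a map $f:V\to\mathbb{RP}^3$ such that for each $v\in V$ the image of the vertex star of $v$ lies in a plane $P(v)$. For an edge $e=(v,w)$, $\ell_e$ denotes the line through $f(v),f(w)$. The A-net is generic if the lines $\ell_e,\ell_{e'}$ of distinct edges with a common vertex are distinct, and the lines of two edges without a common vertex are skew (disjoint). An affine A-net is an A-net with values in an affine chart $\mathbb R^3\subset\mathbb{RP}^3$, equipped for each edge $(v,w)$ of $\mathcal D$ with the finite segment joining $f(v)$ and $f(w)$ (also called an edge). For a generic affine A-net each face $Q$ of $\mathcal D$ gives a skew (non-planar) quadrilateral in $\mathbb R^3$ with finite edges, also denoted $Q$. Twist: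 let $(a,b,c,d)$ be a skew quadrilateral in $\mathbb R^3$ with finite edges $ab,bc,cd,da$, and let $\hat x=(x,1)\in\mathbb R^4$ for $x\in\mathbb R^3$. The twist (positive or negative) of the pair of opposite edges $ab$ and $dc$ is the sign of $\det(\hat a,\hat b,\hat d,\hat c)$. The two pairs of opposite edges of a skew quadrilateral have opposite twists. Strips: a strip is a sequence $Q_1,\dots,Q_n$ of faces such that consecutive faces share an edge and in each $Q_i$ the edges $l_i=Q_{i-1}\cap Q_i$ and $r_i=Q_i\cap Q_{i+1}$ are opposite (with $l_1$ the edge of $Q_1$ opposite to $r_1$, and $r_n$ the edge of $Q_n$ opposite to $l_n$). The strip is equi-twisted if the pairs of opposite edges $(l_i,r_i)$ of the skew quadrilaterals $Q_i$ have the same twist for all $i$. A hyperboloid is a (nondegenerate) doubly ruled quadric in $\mathbb{RP}^3$. A hyperboloid patch is a surface patch obtained by restricting a global asymptotic line parametrization $S^1\times S^1\to\mathcal H$ of a hyperboloid $\mathcal H$ (parameter lines are the lines of the two reguli) to a closed rectangle, i.e. to a product of two closed proper nondegenerate arcs; it is bounded by segments of four lines of $\mathcal H$, two from each regulus. It is bounded by a skew quadrilateral $Q$ if these four segments are the edges of $Q$. A hyperbolic net extending a generic affine A-net $f$ is an assignment of a hyperboloid patch to each face of $\mathcal D$ such that (i) each patch is bounded by the skew quadrilateral of its face, and (ii) the surface composed of the patches is a piecewise smooth $C^1$-surface. Here the $C^1$-property means: any two patches whose faces share an edge have the same tangent plane at every point of that common edge and do not form a cusp there, i.e. at each point of the common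 edge the two patches extend to opposite sides of the edge line within the common tangent plane. Exclusion of cusps: there is no edge $(v,w)$ shared by two faces $Q,Q'$ such that both of the following hold: the neighbors $\neq w$ of $v$ in $Q$ and in $Q'$ are mapped by $f$ to the same side of the line $\ell_{(v,w)}$ in the plane $P(v)\cap\mathbb R^3$; and the neighbors $\neq v$ of $w$ in $Q$ and in $Q'$ are mapped by $f$ to the same side of $\ell_{(v,w)}$ in $P(w)\cap\mathbb R^3$. *)

theory Defs
  imports "HOL-Analysis.Analysis"
begin

section \<open>Quad-graphs\<close>

text \<open>Topological surfaces, possibly with boundary. They are carried by a subset of an arbitrary
  topological space, because \<^const>\<open>simply_connected\<close> is a predicate on such subsets.\<close>

definition topological_surface :: "'a::topological_space set \<Rightarrow> bool" where
  "topological_surface S \<longleftrightarrow>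
     S \<noteq> {} \<and> Hausdorff_space (top_of_set S) \<and> second_countable (top_of_set S) \<and>
     (\<forall>x\<in>S. \<exists>U W. x \<in> U \<and> openin (top_of_set S) U \<and>
        openin (top_of_set {z::complex. Im z \<ge> 0}) W \<and> U homeomorphic W)"

text \<open>Edges and faces are the closed cells, as sets of points of the surface.\<close>

record 'a cell_decomposition =
  surface :: "'a set"
  verts :: "'a set"
  edges :: "'a set set"
  faces :: "'a set set"

definition is_edge_cell :: "('a::topological_space) cell_decomposition \<Rightarrow> 'a set \<Rightarrow> bool" where
  "is_edge_cell D e \<longleftrightarrow>
     (\<exists>\<gamma>. arc \<gamma> \<and> path_image \<gamma> = e \<and> e \<inter> verts D = {pathstart \<gamma>, pathfinish \<gamma>})"

abbreviation unit_square :: "(real \<times> real) set" where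
  "unit_square \<equiv> {0..1} \<times> {0..1}"

definition edges_of :: "'a cell_decomposition \<Rightarrow> 'a set \<Rightarrow> 'a set set" where
  "edges_of D Q = {e \<in> edges D. e \<subseteq> Q}"

text \<open>A quadrilateral is the image of a closed square whose four corners are exactly the vertices,
  and whose four sides are exactly the edges, contained in it.\<close>

definition is_quad_cell :: "('a::topological_space) cell_decomposition \<Rightarrow> 'a set \<Rightarrow> bool" where
  "is_quad_cell D Q \<longleftrightarrow>
     (\<exists>h k. homeomorphism unit_square Q h k \<and>
        Q \<inter> verts D = h ` ({0, 1} \<times> {0, 1}) \<and>
        edges_of D Q = {h ` ({0..1} \<times> {0}), h ` ({0..1} \<times> {1}),
                        h ` ({0} \<times> {0..1}), h ` ({1} \<times> {0..1})})"

definition closed_cells :: "'a cell_decomposition \<Rightarrow> 'a set set" where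
  "closed_cells D = (\<lambda>v. {v}) ` verts D \<union> edges D \<union> faces D"

definition open_cells :: "'a cell_decomposition \<Rightarrow> 'a set set" where
  "open_cells D = (\<lambda>v. {v}) ` verts D \<union> (\<lambda>e. e - verts D) ` edges D
                  \<union> (\<lambda>Q. Q - \<Union>(edges_of D Q)) ` faces D"

text \<open>The last conjunct is strong regularity. Local finiteness expresses that the surface carries
  the topology determined by its cells; it matters for infinite decompositions only.\<close>

definition quad_graph :: "('a::topological_space) cell_decomposition \<Rightarrow> bool" where
  "quad_graph D \<longleftrightarrow>
     topological_surface (surface D) \<and>
     (\<forall>e\<in>edges D. is_edge_cell D e) \<and>
     (\<forall>Q\<in>faces D. is_quad_cell D Q) \<and>
     partition_on (surface D) (open_cells D) \<and>
     locally_finite_in (top_of_set (surface D)) (closed_cells D) \<and>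
     (\<forall>A\<in>closed_cells D. \<forall>B\<in>closed_cells D. A \<inter> B = {} \<or> A \<inter> B \<in> closed_cells D)"

definition simply_connected_quad_graph :: "('a::topological_space) cell_decomposition \<Rightarrow> bool" where
  "simply_connected_quad_graph D \<longleftrightarrow> quad_graph D \<and> simply_connected (surface D)"

definition adjacent :: "'a cell_decomposition \<Rightarrow> 'a \<Rightarrow> 'a \<Rightarrow> bool" where
  "adjacent D v w \<longleftrightarrow> v \<noteq> w \<and> (\<exists>e\<in>edges D. e \<inter> verts D = {v, w})"

definition vertex_star :: "'a cell_decomposition \<Rightarrow> 'a \<Rightarrow> 'a set" where
  "vertex_star D v = insert v {w. adjacent D v w}"

text \<open>\<open>a, b, c, d\<close> are the vertices of the face \<open>Q\<close> in cyclic order.\<close>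

definition face_cycle :: "'a cell_decomposition \<Rightarrow> 'a set \<Rightarrow> 'a \<Rightarrow> 'a \<Rightarrow> 'a \<Rightarrow> 'a \<Rightarrow> bool" where
  "face_cycle D Q a b c d \<longleftrightarrow>
     Q \<in> faces D \<and> distinct [a, b, c, d] \<and> Q \<inter> verts D = {a, b, c, d} \<and>
     (\<lambda>e. e \<inter> verts D) ` edges_of D Q = {{a, b}, {b, c}, {c, d}, {d, a}}"


section \<open>Real projective three-space\<close>

text \<open>Points of projective space are the one-dimensional subspaces of \<open>\<real>\<^sup>4\<close>; lines and planes are
  sets of points.\<close>

type_synonym ppoint = "(real^4) set"

definition RP3 :: "ppoint set" where
  "RP3 = {p. subspace p \<and> dim p = 1}"

definition RP3_topology :: "ppoint topology" where
  "RP3_topology = topology (\<lambda>U. U \<subseteq> RP3 \<and> open {x. x \<noteq> 0 \<and> span {x} \<in> U})"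

lemma openin_RP3_topology:
  "openin RP3_topology U \<longleftrightarrow> U \<subseteq> RP3 \<and> open {x. x \<noteq> 0 \<and> span {x} \<in> U}"
proof -
  let ?P = "\<lambda>U. U \<subseteq> RP3 \<and> open {x::real^4. x \<noteq> 0 \<and> span {x} \<in> U}"
  have "?P (A \<inter> B)" if "?P A" "?P B" for A B
  proof -
    have "{x::real^4. x \<noteq> 0 \<and> span {x} \<in> A \<inter> B}
        = {x. x \<noteq> 0 \<and> span {x} \<in> A} \<inter> {x. x \<noteq> 0 \<and> span {x} \<in> B}" by blast
    then show ?thesis using that by auto
  qed
  moreover have "?P (\<Union>\<K>)" if "\<forall>K\<in>\<K>. ?P K" for \<K>
  proof -
    have "{x::real^4. x \<noteq> 0 \<and> span {x} \<in> \<Union>\<K>} = (\<Union>K\<in>\<K>. {x. x \<noteq> 0 \<and> span {x} \<in> K})" by blast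
    then show ?thesis using that by auto
  qed
  ultimately have "istopology ?P"
    unfolding istopology_def by blast
  then show ?thesis
    by (simp add: RP3_topology_def topology_inverse')
qed

definition proj_subspace :: "(real^4) set \<Rightarrow> ppoint set" where
  "proj_subspace W = {p \<in> RP3. p \<subseteq> W}"

definition proj_line :: "ppoint set \<Rightarrow> bool" where
  "proj_line L \<longleftrightarrow> (\<exists>W. subspace W \<and> dim W = 2 \<and> L = proj_subspace W)"

definition proj_plane :: "ppoint set \<Rightarrow> bool" where
  "proj_plane P \<longleftrightarrow> (\<exists>W. subspace W \<and> dim W = 3 \<and> P = proj_subspace W)"

definition hom :: "real^3 \<Rightarrow> real^4" where
  "hom x = vector [x$1, x$2, x$3, 1]"

definition affine_pt :: "real^3 \<Rightarrow> ppoint" where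
  "affine_pt x = span {hom x}"


section \<open>A-nets\<close>

definition discrete_A_net :: "'a cell_decomposition \<Rightarrow> ('a \<Rightarrow> ppoint) \<Rightarrow> bool" where
  "discrete_A_net D f \<longleftrightarrow>
     f ` verts D \<subseteq> RP3 \<and> (\<forall>v\<in>verts D. \<exists>P. proj_plane P \<and> f ` vertex_star D v \<subseteq> P)"

definition edge_line :: "'a cell_decomposition \<Rightarrow> ('a \<Rightarrow> ppoint) \<Rightarrow> 'a set \<Rightarrow> ppoint set" where
  "edge_line D f e = proj_subspace (span (\<Union>(f ` (e \<inter> verts D))))"

text \<open>The first conjunct says that the end points of an edge have distinct images, so that they do
  span a line.\<close>

definition generic_A_net :: "'a cell_decomposition \<Rightarrow> ('a \<Rightarrow> ppoint) \<Rightarrow> bool" where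
  "generic_A_net D f \<longleftrightarrow>
     discrete_A_net D f \<and>
     (\<forall>e\<in>edges D. proj_line (edge_line D f e)) \<and>
     (\<forall>e\<in>edges D. \<forall>e'\<in>edges D. e \<noteq> e' \<longrightarrow>
        (if e \<inter> e' \<inter> verts D \<noteq> {} then edge_line D f e \<noteq> edge_line D f e'
         else edge_line D f e \<inter> edge_line D f e' = {}))"

definition generic_affine_A_net :: "'a cell_decomposition \<Rightarrow> ('a \<Rightarrow> real^3) \<Rightarrow> bool" where
  "generic_affine_A_net D f \<longleftrightarrow> generic_A_net D (affine_pt \<circ> f)"

definition edge_segment :: "'a cell_decomposition \<Rightarrow> ('a \<Rightarrow> real^3) \<Rightarrow> 'a set \<Rightarrow> (real^3) set" where
  "edge_segment D f e = convex hull (f ` (e \<inter> verts D))"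

text \<open>Only meaningful for \<open>x\<close>, \<open>y\<close> in a common plane through the line \<open>pq\<close>; for an A-net this
  is the plane of the vertex star.\<close>

definition same_side :: "real^3 \<Rightarrow> real^3 \<Rightarrow> real^3 \<Rightarrow> real^3 \<Rightarrow> bool" where
  "same_side p q x y \<longleftrightarrow> closed_segment x y \<inter> affine hull {p, q} = {}"

definition cusps_excluded :: "'a cell_decomposition \<Rightarrow> ('a \<Rightarrow> real^3) \<Rightarrow> bool" where
  "cusps_excluded D f \<longleftrightarrow>
     \<not> (\<exists>Q Q' v w v\<^sub>1 w\<^sub>1 v\<^sub>2 w\<^sub>2. Q \<noteq> Q' \<and>
          face_cycle D Q v w w\<^sub>1 v\<^sub>1 \<and> face_cycle D Q' v w w\<^sub>2 v\<^sub>2 \<and>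
          same_side (f v) (f w) (f v\<^sub>1) (f v\<^sub>2) \<and> same_side (f v) (f w) (f w\<^sub>1) (f w\<^sub>2))"


section \<open>Twist and strips\<close>

text \<open>Twist of the pair of opposite edges \<open>ab\<close>, \<open>dc\<close> of the skew quadrilateral \<open>(a, b, c, d)\<close>;
  it takes the values \<open>1\<close> and \<open>- 1\<close>.\<close>

definition twist :: "real^3 \<Rightarrow> real^3 \<Rightarrow> real^3 \<Rightarrow> real^3 \<Rightarrow> real" where
  "twist a b c d = sgn (det (vector [hom a, hom b, hom d, hom c] :: real^4^4))"

definition opposite_edges :: "'a cell_decomposition \<Rightarrow> 'a set \<Rightarrow> 'a set \<Rightarrow> 'a set \<Rightarrow> bool" where
  "opposite_edges D Q e e' \<longleftrightarrow>
     Q \<in> faces D \<and> e \<in> edges_of D Q \<and> e' \<in> edges_of D Q \<and>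
     (\<exists>a b c d. face_cycle D Q a b c d \<and> e \<inter> verts D = {a, b} \<and> e' \<inter> verts D = {d, c})"

text \<open>A strip is given by its faces \<open>Qs\<close> and the edges \<open>es\<close> crossed by it: the face \<open>Qs ! i\<close> has the
  left edge \<open>es ! i\<close> and the right edge \<open>es ! Suc i\<close>.\<close>

definition strip :: "'a cell_decomposition \<Rightarrow> 'a set list \<Rightarrow> 'a set list \<Rightarrow> bool" where
  "strip D Qs es \<longleftrightarrow>
     Qs \<noteq> [] \<and> length es = Suc (length Qs) \<and>
     (\<forall>i<length Qs. opposite_edges D (Qs ! i) (es ! i) (es ! Suc i)) \<and>
     (\<forall>i. Suc i < length Qs \<longrightarrow> Qs ! i \<inter> Qs ! Suc i = es ! Suc i)"

text \<open>The twist of a pair of opposite edges does not depend on the labelling of the vertices, among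
  those compatible with the pair.\<close>

definition equi_twisted ::
    "'a cell_decomposition \<Rightarrow> ('a \<Rightarrow> real^3) \<Rightarrow> 'a set list \<Rightarrow> 'a set list \<Rightarrow> bool" where
  "equi_twisted D f Qs es \<longleftrightarrow>
     (\<exists>s. \<forall>i<length Qs. \<forall>a b c d.
        face_cycle D (Qs ! i) a b c d \<and> es ! i \<inter> verts D = {a, b} \<and> es ! Suc i \<inter> verts D = {d, c}
        \<longrightarrow> twist (f a) (f b) (f c) (f d) = s)"


section \<open>Hyperboloid patches\<close>

definition nondegenerate_quadric :: "ppoint set \<Rightarrow> bool" where
  "nondegenerate_quadric H \<longleftrightarrow>
     (\<exists>A::real^4^4. transpose A = A \<and> det A \<noteq> 0 \<and>
        H = {span {x} | x. x \<noteq> 0 \<and> x \<bullet> (A *v x) = 0})"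

definition doubly_ruled :: "ppoint set \<Rightarrow> bool" where
  "doubly_ruled H \<longleftrightarrow>
     (\<forall>p\<in>H. \<exists>L L'. L \<noteq> L' \<and> proj_line L \<and> proj_line L' \<and> p \<in> L \<and> p \<in> L' \<and> L \<subseteq> H \<and> L' \<subseteq> H)"

definition hyperboloid :: "ppoint set \<Rightarrow> bool" where
  "hyperboloid H \<longleftrightarrow> H \<noteq> {} \<and> nondegenerate_quadric H \<and> doubly_ruled H"

abbreviation circle :: "complex set" where
  "circle \<equiv> sphere 0 1"

definition asymptotic_parametrization :: "ppoint set \<Rightarrow> (complex \<times> complex \<Rightarrow> ppoint) \<Rightarrow> bool" where
  "asymptotic_parametrization H \<phi> \<longleftrightarrow>
     homeomorphic_map (prod_topology (top_of_set circle) (top_of_set circle))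
       (subtopology RP3_topology H) \<phi> \<and>
     (\<forall>t\<in>circle. proj_line (\<phi> ` (circle \<times> {t})) \<and> proj_line (\<phi> ` ({t} \<times> circle)))"

text \<open>The arcs are \<open>cis ` {\<alpha>..\<beta>}\<close> and \<open>cis ` {\<gamma>..\<delta>}\<close>; \<open>\<B>\<close> is the set of the four boundary
  segments of the patch \<open>P\<close>.\<close>

definition hyperboloid_patch_with_boundary :: "ppoint set \<Rightarrow> ppoint set set \<Rightarrow> bool" where
  "hyperboloid_patch_with_boundary P \<B> \<longleftrightarrow>
     (\<exists>H \<phi> \<alpha> \<beta> \<gamma> \<delta>. hyperboloid H \<and> asymptotic_parametrization H \<phi> \<and>
        \<alpha> < \<beta> \<and> \<beta> < \<alpha> + 2 * pi \<and> \<gamma> < \<delta> \<and> \<delta> < \<gamma> + 2 * pi \<and>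
        P = \<phi> ` (cis ` {\<alpha>..\<beta>} \<times> cis ` {\<gamma>..\<delta>}) \<and>
        \<B> = {\<phi> ` (cis ` {\<alpha>..\<beta>} \<times> {cis \<gamma>}), \<phi> ` (cis ` {\<alpha>..\<beta>} \<times> {cis \<delta>}),
             \<phi> ` ({cis \<alpha>} \<times> cis ` {\<gamma>..\<delta>}), \<phi> ` ({cis \<beta>} \<times> cis ` {\<gamma>..\<delta>})})"

definition face_patches ::
    "'a cell_decomposition \<Rightarrow> ('a \<Rightarrow> real^3) \<Rightarrow> 'a set \<Rightarrow> ppoint set set" where
  "face_patches D f Q =
     {P. hyperboloid_patch_with_boundary P ((\<lambda>e. affine_pt ` edge_segment D f e) ` edges_of D Q)}"


section \<open>Hyperbolic nets\<close>

definition tangent_vectors :: "(real^3) set \<Rightarrow> real^3 \<Rightarrow> (real^3) set" where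
  "tangent_vectors M p =
     {u. \<exists>\<gamma>::real \<Rightarrow> real^3. \<gamma> 0 = p \<and> \<gamma> ` {0..1} \<subseteq> M \<and>
           (\<gamma> has_vector_derivative u) (at 0 within {0..1})}"

text \<open>Direction space of the tangent plane at \<open>p\<close>. At a boundary point of a patch the tangent vectors
  themselves only form a half-plane or a sector.\<close>

definition tangent_space :: "(real^3) set \<Rightarrow> real^3 \<Rightarrow> (real^3) set" where
  "tangent_space M p = span (tangent_vectors M p)"

text \<open>The patches extend to opposite sides at \<open>p\<close>: inside the common tangent plane, the line in
  direction \<open>l\<close> separates their tangent vectors. Since \<open>n\<close> is a nonzero tangential vector orthogonal
  to \<open>l\<close>, both patches also have tangent vectors strictly on their side.\<close>

definition C1_joint :: "(real^3) set \<Rightarrow> (real^3) set \<Rightarrow> real^3 \<Rightarrow> real^3 \<Rightarrow> bool" where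
  "C1_joint M M' l p \<longleftrightarrow>
     tangent_space M p = tangent_space M' p \<and>
     (\<exists>n\<in>tangent_space M p. n \<noteq> 0 \<and> n \<bullet> l = 0 \<and>
        (\<forall>u\<in>tangent_vectors M p. n \<bullet> u \<ge> 0) \<and> (\<forall>u\<in>tangent_vectors M' p. n \<bullet> u \<le> 0))"

text \<open>Nets are extensional functions on the set of faces, so that they are equal when they assign
  the same patches. The preimage under \<^const>\<open>affine_pt\<close> is the affine part of a patch.\<close>

definition hyperbolic_nets ::
    "'a cell_decomposition \<Rightarrow> ('a \<Rightarrow> real^3) \<Rightarrow> ('a set \<Rightarrow> ppoint set) set" where
  "hyperbolic_nets D f =
     {N \<in> (\<Pi>\<^sub>E Q\<in>faces D. face_patches D f Q).
        \<forall>Q\<in>faces D. \<forall>Q'\<in>faces D. \<forall>e\<in>edges_of D Q \<inter> edges_of D Q'. \<forall>v w.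
          Q \<noteq> Q' \<and> e \<inter> verts D = {v, w} \<and> v \<noteq> w \<longrightarrow>
          (\<forall>p\<in>edge_segment D f e.
             C1_joint (affine_pt -` N Q) (affine_pt -` N Q') (f w - f v) p)}"

text \<open>A family of patches, given by finite surface pieces that depend continuously on the
  parameter.\<close>

definition continuous_patch_family :: "(real \<Rightarrow> ppoint set) \<Rightarrow> bool" where
  "continuous_patch_family P \<longleftrightarrow>
     (\<exists>g :: real \<times> real \<times> real \<Rightarrow> real^3. continuous_on (UNIV \<times> unit_square) g \<and>
        (\<forall>t. P t = affine_pt ` (\<lambda>x. g (t, x)) ` unit_square))"

end

(*
In barycentric coordinates (x0, x1, x2, x3) of a skew quadrilateral a b c d, the quadrics containing
its four edge lines are x0 x2 = k x1 x3; the hyperboloid patches bounded by it are the pieces x0,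
..., x3 >= 0 with k > 0. At the common edge of two faces, the tangent planes of both patches contain
the edge and vary as a linear fractional function along it; given the twist, being C1 along the
whole edge reduces to equality of the Gaussian curvatures at one of its ends. A hyperbolic net is
therefore a positive function (the absolute value of the Gaussian curvature) on the vertices. Within
one face the curvature at a vertex determines the one at every other vertex: in logarithmic scale it
is an affine map of slope -1 along edges and 1 along diagonals, and it depends only on the edge, not
on the face containing it, because the product of the curvatures at both ends of an edge does. These
maps are the transition functions of a locally constant sheaf on the surface, which has global
sections with prescribed value at one vertex because the surface is simply connected.
*)

theory Submission
  imports Defs
begin

section \<open>Locally constant sheaves on a simply connected space\<close>

text \<open>The number carried by a vertex is \<open>k * curv\<close>, the square root of |K|: near
  \<open>a\<close> the patch is a + u (b - a) + v (d - a) + k u v (c - a) to second order. Modulo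
  the edge direction, the rulings of two adjacent patches at parameter \<tau> are (k \<tau>, 1 -
  \<tau>) and (k' z' \<tau>, z (1 - \<tau>)), where z and z' are the transverse components of the
  neighbours in the second face. Smoothness means z, z' < 0 and k z = k' z'. Equal twist says z z' >
  0, the exclusion of cusps then leaves both negative, and k z = k' z' is equality of
  \<open>k * curv\<close>. From one face to the other the constant \<open>curv\<close> changes by
  z'/z at one end of the edge and by z/z' at the other, so its product over both ends belongs to the
  edge. Two obstacles lie outside this computation. A patch comes from an arbitrary parametrization
  of a quadric, so its normal form has to be recovered from incidences of lines. The surface is a
  subset of an arbitrary topological space, so its two-dimensionality has to be extracted from
  charts before faces can be linked across edges.\<close>

lemma homotopic_loops_to_constE:
  assumes "homotopic_loops S \<gamma> (\<lambda>t. x)"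
  obtains h :: "real \<times> real \<Rightarrow> 'a::topological_space" where "continuous_on ({0..1} \<times> {0..1}) h" "h ` ({0..1} \<times> {0..1}) \<subseteq> S"
    "\<And>t. t \<in> {0..1} \<Longrightarrow> h (0,t) = \<gamma> t" "\<And>t. t \<in> {0..1} \<Longrightarrow> h (1,t) = x"
    "\<And>s. s \<in> {0..1} \<Longrightarrow> h (s,1) = h (s,0)"
proof -
  obtain h :: "real \<times> real \<Rightarrow> 'a" where h: "continuous_on ({0..1} \<times> {0..1}) h" "h \<in> ({0..1} \<times> {0..1}) \<rightarrow> S"
    "\<forall>t\<in>{0..1}. h (0,t) = \<gamma> t" "\<forall>t\<in>{0..1}. h (1,t) = x"
    "\<forall>t\<in>{0..1}. pathfinish (h \<circ> Pair t) = pathstart (h \<circ> Pair t)"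
    using assms unfolding homotopic_loops by blast
  show thesis
  proof (rule that)
    show "h ` ({0..1} \<times> {0..1}) \<subseteq> S" using h(2) by blast
    show "h (s,1) = h (s,0)" if "s \<in> {0..1}" for s
      using h(5) that by (simp add: pathstart_def pathfinish_def)
  qed (use h in simp_all)
qed

text \<open>Constant loops at two points are freely homotopic, because
  \<open>simply_connected\<close> quantifies over all pairs of loops; the track of the base point
  under the homotopy is a path between them.\<close>

lemma simply_connected_imp_path_connected_topological:
  fixes S :: "'a::topological_space set"
  assumes "simply_connected S"
  shows "path_connected S"
  unfolding path_connected_def
proof (intro ballI)
  fix x y assume xy: "x \<in> S" "y \<in> S"
  have "homotopic_loops S (\<lambda>t. x) (\<lambda>t. y)"
    using assms[unfolded simply_connected_def, rule_format, of "\<lambda>t. x" "\<lambda>t. y"] xy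
    by (auto simp: path_def path_image_def pathstart_def pathfinish_def)
  then obtain h :: "real \<times> real \<Rightarrow> 'a" where h:
    "continuous_on ({0..1} \<times> {0..1}) h" "h ` ({0..1} \<times> {0..1}) \<subseteq> S"
    "\<And>t. t \<in> {0..1} \<Longrightarrow> h (0,t) = x" "\<And>t. t \<in> {0..1} \<Longrightarrow> h (1,t) = y"
    by (rule homotopic_loops_to_constE) blast
  then show "\<exists>g. path g \<and> path_image g \<subseteq> S \<and> pathstart g = x \<and> pathfinish g = y"
    by (intro exI[of _ "\<lambda>t. h (t,0)"])
       (auto simp: path_def path_image_def pathstart_def pathfinish_def
          intro!: continuous_on_compose2[OF h(1)] continuous_intros)
qed

text \<open>The fibre \<open>'b\<close> carries no topology. The maps \<open>g u v\<close> are
  invertible wherever \<open>U u\<close> and \<open>U v\<close> meet: this is the case w = u of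
  \<open>g_trans\<close> together with \<open>g_refl\<close>.\<close>

locale cech_cocycle =
  fixes S :: "'a::topological_space set" and I :: "'v set"
    and U :: "'v \<Rightarrow> 'a set" and g :: "'v \<Rightarrow> 'v \<Rightarrow> 'b \<Rightarrow> 'b"
  assumes U_open: "v \<in> I \<Longrightarrow> openin (top_of_set S) (U v)"
    and cover: "x \<in> S \<Longrightarrow> \<exists>v\<in>I. x \<in> U v"
    and g_refl: "v \<in> I \<Longrightarrow> g v v r = r"
    and g_trans: "u \<in> I \<Longrightarrow> v \<in> I \<Longrightarrow> w \<in> I \<Longrightarrow> x \<in> U u \<Longrightarrow> x \<in> U v \<Longrightarrow> x \<in> U w
      \<Longrightarrow> g v w (g u v r) = g u w r"
begin

text \<open>A section over \<open>p : X \<rightarrow> S\<close> of the locally constant sheaf glued from constant sheaves on the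
  sets \<open>U v\<close> by \<open>g\<close>; \<open>\<sigma> x v\<close> is its value at \<open>x\<close> seen from \<open>U v\<close>.\<close>

definition section_over :: "('c::topological_space) set \<Rightarrow> ('c \<Rightarrow> 'a) \<Rightarrow> ('c \<Rightarrow> 'v \<Rightarrow> 'b) \<Rightarrow> bool" where
  "section_over X p \<sigma> \<longleftrightarrow>
     (\<forall>x\<in>X. \<forall>v\<in>I. \<forall>w\<in>I. p x \<in> U v \<longrightarrow> p x \<in> U w \<longrightarrow> \<sigma> x w = g v w (\<sigma> x v)) \<and>
     (\<forall>x\<in>X. \<forall>v\<in>I. p x \<in> U v \<longrightarrow>
        (\<exists>N. open N \<and> x \<in> N \<and> (\<forall>y\<in>N \<inter> X. p y \<in> U v \<and> \<sigma> y v = \<sigma> x v)))"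

lemma section_overD1:
  "section_over X p \<sigma> \<Longrightarrow> x \<in> X \<Longrightarrow> v \<in> I \<Longrightarrow> w \<in> I \<Longrightarrow> p x \<in> U v \<Longrightarrow> p x \<in> U w
    \<Longrightarrow> \<sigma> x w = g v w (\<sigma> x v)"
  unfolding section_over_def by blast

lemma section_overD2:
  "section_over X p \<sigma> \<Longrightarrow> x \<in> X \<Longrightarrow> v \<in> I \<Longrightarrow> p x \<in> U v
    \<Longrightarrow> \<exists>N. open N \<and> x \<in> N \<and> (\<forall>y\<in>N \<inter> X. p y \<in> U v \<and> \<sigma> y v = \<sigma> x v)"
  unfolding section_over_def by blast

lemma section_over_pullback:
  assumes \<sigma>: "section_over X p \<sigma>" and q: "continuous_on Y q" "q ` Y \<subseteq> X"
    and eq: "\<And>y. y \<in> Y \<Longrightarrow> p' y = p (q y)"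
  shows "section_over Y p' (\<lambda>y. \<sigma> (q y))"
  unfolding section_over_def
proof (intro conjI ballI impI)
  fix x v w assume "x \<in> Y" "v \<in> I" "w \<in> I" "p' x \<in> U v" "p' x \<in> U w"
  then show "\<sigma> (q x) w = g v w (\<sigma> (q x) v)"
    using section_overD1[OF \<sigma>] q eq by (metis image_subset_iff)
next
  fix x v assume x: "x \<in> Y" "v \<in> I" "p' x \<in> U v"
  then have "q x \<in> X" "p (q x) \<in> U v" using q eq by auto
  then obtain N where N: "open N" "q x \<in> N" "\<forall>y\<in>N \<inter> X. p y \<in> U v \<and> \<sigma> y v = \<sigma> (q x) v"
    using section_overD2[OF \<sigma> _ x(2)] by blast
  then obtain M where M: "open M" "M \<inter> Y = q -` N \<inter> Y"
    using q(1) unfolding continuous_on_open_invariant by metis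
  have "\<forall>y\<in>M \<inter> Y. p' y \<in> U v \<and> \<sigma> (q y) v = \<sigma> (q x) v"
    using M N(3) q(2) eq by fastforce
  then show "\<exists>N. open N \<and> x \<in> N \<and> (\<forall>y\<in>N \<inter> Y. p' y \<in> U v \<and> \<sigma> (q y) v = \<sigma> (q x) v)"
    using M N(2) x(1) by blast
qed

lemma section_over_const:
  assumes "p ` X \<subseteq> U v" "v \<in> I" and p: "continuous_on X p" "p ` X \<subseteq> S"
  shows "section_over X p (\<lambda>x w. g v w r)"
  unfolding section_over_def
proof (intro conjI ballI impI)
  fix x u w assume "x \<in> X" "u \<in> I" "w \<in> I" "p x \<in> U u" "p x \<in> U w"
  then show "g v w r = g u w (g v u r)" using g_trans assms(1,2) by (metis image_subset_iff)
next
  fix x w assume x: "x \<in> X" "w \<in> I" "p x \<in> U w"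
  obtain T where T: "open T" "U w = S \<inter> T" using U_open[OF x(2)] openin_open by metis
  obtain M where M: "open M" "M \<inter> X = p -` T \<inter> X"
    using p(1) T(1) unfolding continuous_on_open_invariant by metis
  have "\<forall>y\<in>M \<inter> X. p y \<in> U w" using M T p(2) by auto
  moreover have "x \<in> M" using M T x by auto
  ultimately show "\<exists>N. open N \<and> x \<in> N \<and> (\<forall>y\<in>N \<inter> X. p y \<in> U w \<and> g v w r = g v w r)"
    using M(1) by blast
qed

text \<open>Both sections change index by the same \<open>g\<close>, so agreement at a point does
  not depend on the index. Seen from one index both are locally constant; hence agreement is an open
  and closed condition.\<close>

lemma section_over_unique:
  assumes X: "connected X" and pS: "p ` X \<subseteq> S"
    and \<sigma>: "section_over X p \<sigma>" and \<tau>: "section_over X p \<tau>"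
    and x0: "x\<^sub>0 \<in> X" "v\<^sub>0 \<in> I" "p x\<^sub>0 \<in> U v\<^sub>0" "\<sigma> x\<^sub>0 v\<^sub>0 = \<tau> x\<^sub>0 v\<^sub>0"
    and x: "x \<in> X" "v \<in> I" "p x \<in> U v"
  shows "\<sigma> x v = \<tau> x v"
proof -
  define P where "P y \<longleftrightarrow> (\<exists>v\<in>I. p y \<in> U v \<and> \<sigma> y v = \<tau> y v)" for y
  have Pv: "\<sigma> y w = \<tau> y w" if "P y" "y \<in> X" "w \<in> I" "p y \<in> U w" for y w
    using that section_overD1[OF \<sigma>] section_overD1[OF \<tau>] unfolding P_def by metis
  have "P x"
  proof (rule connected_induction_simple[OF X, of x\<^sub>0 x])
    show "x\<^sub>0 \<in> X" "x \<in> X" "P x\<^sub>0" using x0 x by (auto simp: P_def)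
  next
    fix a assume a: "a \<in> X"
    obtain v where v: "v \<in> I" "p a \<in> U v" using cover pS a by blast
    obtain N where N: "open N" "a \<in> N" "\<forall>y\<in>N \<inter> X. p y \<in> U v \<and> \<sigma> y v = \<sigma> a v"
      using section_overD2[OF \<sigma> a v] by blast
    obtain M where M: "open M" "a \<in> M" "\<forall>y\<in>M \<inter> X. p y \<in> U v \<and> \<tau> y v = \<tau> a v"
      using section_overD2[OF \<tau> a v] by blast
    have "openin (top_of_set X) (X \<inter> (N \<inter> M))" using N(1) M(1) openin_open by blast
    moreover have "P z" if "y \<in> X \<inter> (N \<inter> M)" "z \<in> X \<inter> (N \<inter> M)" "P y" for y z
    proof -
      have "\<sigma> y v = \<tau> y v" using Pv that N v(1) by auto
      then have "\<sigma> z v = \<tau> z v" using that N(3) M(3) by (metis IntE IntI)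
      then show ?thesis using that N(3) v(1) by (auto simp: P_def)
    qed
    ultimately show "\<exists>T. openin (top_of_set X) T \<and> a \<in> T \<and> (\<forall>x\<in>T. \<forall>y\<in>T. P x \<longrightarrow> P y)"
      using a N(2) M(2) by blast
  qed
  then show ?thesis using Pv x by blast
qed

text \<open>The condition near a point splits into one on A and one on B, whose neighbourhoods are
  intersected. Because the pieces are closed, at a point outside A the neighbourhood - A makes the
  first one vacuous.\<close>

lemma section_over_glue:
  assumes \<sigma>: "section_over A p \<sigma>" and \<tau>: "section_over B p \<tau>" and "closed A" "closed B"
    and eq: "\<And>x v. x \<in> A \<inter> B \<Longrightarrow> v \<in> I \<Longrightarrow> p x \<in> U v \<Longrightarrow> \<sigma> x v = \<tau> x v"
  shows "section_over (A \<union> B) p (\<lambda>x. if x \<in> A then \<sigma> x else \<tau> x)"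
  unfolding section_over_def
proof (intro conjI ballI impI)
  fix x v w assume "x \<in> A \<union> B" "v \<in> I" "w \<in> I" "p x \<in> U v" "p x \<in> U w"
  then show "(if x \<in> A then \<sigma> x else \<tau> x) w = g v w ((if x \<in> A then \<sigma> x else \<tau> x) v)"
    using section_overD1[OF \<sigma>, of x v w] section_overD1[OF \<tau>, of x v w] by (cases "x \<in> A") simp_all
next
  fix x v assume x: "x \<in> A \<union> B" "v \<in> I" "p x \<in> U v"
  let ?\<rho> = "\<lambda>x. if x \<in> A then \<sigma> x else \<tau> x"
  define r where "r = ?\<rho> x v"
  have r: "x \<in> A \<Longrightarrow> \<sigma> x v = r" "x \<in> B \<Longrightarrow> \<tau> x v = r"
    using eq[of x v] x by (auto simp: r_def)
  have "\<exists>N. open N \<and> x \<in> N \<and> (\<forall>y\<in>N \<inter> A. p y \<in> U v \<and> \<sigma> y v = r)"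
  proof (cases "x \<in> A")
    case True
    then show ?thesis using section_overD2[OF \<sigma> True x(2,3)] r(1) by simp
  next
    case False
    then show ?thesis using \<open>closed A\<close> by (intro exI[of _ "- A"]) auto
  qed
  then obtain N where N: "open N" "x \<in> N" "\<forall>y\<in>N \<inter> A. p y \<in> U v \<and> \<sigma> y v = r" by blast
  have "\<exists>M. open M \<and> x \<in> M \<and> (\<forall>y\<in>M \<inter> B. p y \<in> U v \<and> \<tau> y v = r)"
  proof (cases "x \<in> B")
    case True
    then show ?thesis using section_overD2[OF \<tau> True x(2,3)] r(2) by simp
  next
    case False
    then show ?thesis using \<open>closed B\<close> by (intro exI[of _ "- B"]) auto
  qed
  then obtain M where M: "open M" "x \<in> M" "\<forall>y\<in>M \<inter> B. p y \<in> U v \<and> \<tau> y v = r" by blast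
  have "\<forall>y\<in>(N \<inter> M) \<inter> (A \<union> B). p y \<in> U v \<and> ?\<rho> y v = r"
    using N(3) M(3) by auto
  then show "\<exists>N. open N \<and> x \<in> N \<and> (\<forall>y\<in>N \<inter> (A \<union> B). p y \<in> U v \<and> ?\<rho> y v = ?\<rho> x v)"
    unfolding r_def[symmetric] using N(1,2) M(1,2) by (intro exI[of _ "N \<inter> M"]) blast
qed

text \<open>Triviality of the sheaf pulled back to X, stated through germs. The prescribed germ may
  sit at any point of X, which is what allows pieces to be glued one after another.\<close>

definition extendable :: "('c::topological_space) set \<Rightarrow> ('c \<Rightarrow> 'a) \<Rightarrow> bool" where
  "extendable X p \<longleftrightarrow> (\<forall>x\<in>X. \<forall>v\<in>I. \<forall>r. p x \<in> U v \<longrightarrow> (\<exists>\<sigma>. section_over X p \<sigma> \<and> \<sigma> x v = r))"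

lemma extendable_const:
  assumes "p ` X \<subseteq> U v" "v \<in> I" "continuous_on X p" "p ` X \<subseteq> S"
  shows "extendable X p"
  unfolding extendable_def
proof (intro ballI allI impI)
  fix x w r assume x: "x \<in> X" "w \<in> I" "p x \<in> U w"
  have "section_over X p (\<lambda>x u. g v u (g w v r))" by (rule section_over_const[OF assms])
  moreover have "g v w (g w v r) = r"
    using x assms(1,2) g_trans[of w v w "p x"] g_refl by auto
  ultimately show "\<exists>\<sigma>. section_over X p \<sigma> \<and> \<sigma> x w = r" by metis
qed

text \<open>A section over A determines a germ at a point of A \<inter> B, which extends over B. By
  uniqueness on the connected intersection the two sections agree there and can be glued.\<close>

lemma extendable_Un:
  assumes "extendable A p" "extendable B p" "closed A" "closed B" "connected (A \<inter> B)"
    "A \<inter> B \<noteq> {}" "p ` (A \<union> B) \<subseteq> S"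
  shows "extendable (A \<union> B) p"
proof -
  have half: "\<exists>\<sigma>. section_over (A \<union> B) p \<sigma> \<and> \<sigma> x v = r"
    if h: "extendable A p" "extendable B p" "closed A" "closed B" "connected (A \<inter> B)"
    "A \<inter> B \<noteq> {}" "p ` (A \<union> B) \<subseteq> S" "x \<in> A" "v \<in> I" "p x \<in> U v" for A B :: "'c set" and x v r
  proof -
    obtain \<sigma> where \<sigma>: "section_over A p \<sigma>" "\<sigma> x v = r" using h unfolding extendable_def by blast
    obtain y where y: "y \<in> A \<inter> B" using h by blast
    obtain w where w: "w \<in> I" "p y \<in> U w" using cover h(7) y by blast
    obtain \<tau> where \<tau>: "section_over B p \<tau>" "\<tau> y w = \<sigma> y w"
      using h(2) y w unfolding extendable_def by blast
    have eq: "\<sigma> z u = \<tau> z u" if z: "z \<in> A \<inter> B" "u \<in> I" "p z \<in> U u" for z u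
    proof (rule section_over_unique[where X = "A \<inter> B" and p = p and x\<^sub>0 = y and v\<^sub>0 = w])
      show "section_over (A \<inter> B) p \<sigma>"
        using section_over_pullback[OF \<sigma>(1), of "A \<inter> B" "\<lambda>x. x" p] by auto
      show "section_over (A \<inter> B) p \<tau>"
        using section_over_pullback[OF \<tau>(1), of "A \<inter> B" "\<lambda>x. x" p] by auto
    qed (use h y w z \<tau> in auto)
    show ?thesis
      using section_over_glue[OF \<sigma>(1) \<tau>(1) h(3,4) eq] h(8) \<sigma>(2)
      by (intro exI[of _ "\<lambda>x. if x \<in> A then \<sigma> x else \<tau> x"]) auto
  qed
  show ?thesis
    unfolding extendable_def
  proof (intro ballI allI impI)
    fix x v r assume x: "x \<in> A \<union> B" "v \<in> I" "p x \<in> U v"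
    show "\<exists>\<sigma>. section_over (A \<union> B) p \<sigma> \<and> \<sigma> x v = r"
    proof (cases "x \<in> A")
      case True
      then show ?thesis using half[of A B x v r] assms x by blast
    next
      case False
      then show ?thesis using half[of B A x v r] assms x by (simp add: Un_commute Int_commute)
    qed
  qed
qed

text \<open>Nested bisection in both coordinates: small rectangles are mapped into one
  \<open>U v\<close>, and adjacent rectangles meet in a segment, which is connected. Since
  \<open>p\<close> is defined on the whole plane, small rectangles need no truncation at the
  border.\<close>

lemma extendable_rectangle:
  fixes p :: "real \<times> real \<Rightarrow> 'a"
  assumes p: "continuous_on UNIV p" "range p \<subseteq> S" and "a \<le> b" "c \<le> d"
  shows "extendable ({a..b} \<times> {c..d}) p"
proof -
  have cont: "continuous_on X p" for X using p continuous_on_subset by blast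
  have loc: "\<exists>e>0. \<forall>s\<^sub>0 s\<^sub>1 t\<^sub>0 t\<^sub>1. s\<^sub>0 \<le> s \<and> s \<le> s\<^sub>1 \<and> t\<^sub>0 \<le> t \<and> t \<le> t\<^sub>1 \<and> s\<^sub>1 - s\<^sub>0 < e \<and> t\<^sub>1 - t\<^sub>0 < e
      \<longrightarrow> extendable ({s\<^sub>0..s\<^sub>1} \<times> {t\<^sub>0..t\<^sub>1}) p" for s t
  proof -
    obtain v where v: "v \<in> I" "p (s,t) \<in> U v" using cover p(2) by blast
    obtain T where T: "open T" "U v = S \<inter> T" using U_open[OF v(1)] openin_open by metis
    have "open (p -` T)" using p(1) T(1) by (simp add: continuous_on_open_vimage)
    moreover have "(s,t) \<in> p -` T" using v T by auto
    ultimately obtain e where e: "e > 0" "ball (s,t) e \<subseteq> p -` T"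
      using open_contains_ball by blast
    have "extendable ({s\<^sub>0..s\<^sub>1} \<times> {t\<^sub>0..t\<^sub>1}) p"
      if h: "s\<^sub>0 \<le> s \<and> s \<le> s\<^sub>1 \<and> t\<^sub>0 \<le> t \<and> t \<le> t\<^sub>1 \<and> s\<^sub>1 - s\<^sub>0 < e/2 \<and> t\<^sub>1 - t\<^sub>0 < e/2" for s\<^sub>0 s\<^sub>1 t\<^sub>0 t\<^sub>1
    proof (rule extendable_const[where v = v])
      have "(x,y) \<in> ball (s,t) e" if "x \<in> {s\<^sub>0..s\<^sub>1}" "y \<in> {t\<^sub>0..t\<^sub>1}" for x y
      proof -
        have "dist (s,t) (x,y) \<le> dist s x + dist t y"
          by (simp add: dist_Pair_Pair sqrt_sum_squares_le_sum)
        also have "\<dots> < e" using that h by (auto simp: dist_real_def)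
        finally show ?thesis by simp
      qed
      then show "p ` ({s\<^sub>0..s\<^sub>1} \<times> {t\<^sub>0..t\<^sub>1}) \<subseteq> U v" using e(2) T(2) p(2) by fast
    qed (use v cont p in auto)
    then show ?thesis using e(1) by (intro exI[of _ "e/2"]) auto
  qed
  show ?thesis using \<open>a \<le> b\<close>
  proof (induction rule: Bolzano)
    case (trans x y z)
    have "extendable ({x..y} \<times> {c..d} \<union> {y..z} \<times> {c..d}) p"
    proof (rule extendable_Un)
      have "{x..y} \<times> {c..d} \<inter> {y..z} \<times> {c..d} = {y} \<times> {c..d}" using trans by auto
      then show "connected ({x..y} \<times> {c..d} \<inter> {y..z} \<times> {c..d})"
        "{x..y} \<times> {c..d} \<inter> {y..z} \<times> {c..d} \<noteq> {}" using \<open>c \<le> d\<close> by (auto intro!: connected_Times)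
    qed (use trans p in \<open>auto intro: closed_Times\<close>)
    moreover have "{x..y} \<times> {c..d} \<union> {y..z} \<times> {c..d} = {x..z} \<times> {c..d}" using trans by auto
    ultimately show ?case by simp
  next
    case (local s)
    \<comment> \<open>For fixed s, the bisection in the second coordinate runs with the width e
      under the quantifier: joining two intervals replaces their widths by the minimum.\<close>
    have "\<exists>e>0. \<forall>s\<^sub>0 s\<^sub>1. s\<^sub>0 \<le> s \<and> s \<le> s\<^sub>1 \<and> s\<^sub>1 - s\<^sub>0 < e \<longrightarrow> extendable ({s\<^sub>0..s\<^sub>1} \<times> {c..d}) p"
      using \<open>c \<le> d\<close>
    proof (induction rule: Bolzano)
      case (trans x y z)
      then obtain e1 e2 where e: "e1 > 0" "e2 > 0"
        "\<And>s\<^sub>0 s\<^sub>1. s\<^sub>0 \<le> s \<and> s \<le> s\<^sub>1 \<and> s\<^sub>1 - s\<^sub>0 < e1 \<Longrightarrow> extendable ({s\<^sub>0..s\<^sub>1} \<times> {x..y}) p"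
        "\<And>s\<^sub>0 s\<^sub>1. s\<^sub>0 \<le> s \<and> s \<le> s\<^sub>1 \<and> s\<^sub>1 - s\<^sub>0 < e2 \<Longrightarrow> extendable ({s\<^sub>0..s\<^sub>1} \<times> {y..z}) p"
        by blast
      have "extendable ({s\<^sub>0..s\<^sub>1} \<times> {x..z}) p"
        if h: "s\<^sub>0 \<le> s \<and> s \<le> s\<^sub>1 \<and> s\<^sub>1 - s\<^sub>0 < min e1 e2" for s\<^sub>0 s\<^sub>1
      proof -
        have "extendable ({s\<^sub>0..s\<^sub>1} \<times> {x..y} \<union> {s\<^sub>0..s\<^sub>1} \<times> {y..z}) p"
        proof (rule extendable_Un)
          have "{s\<^sub>0..s\<^sub>1} \<times> {x..y} \<inter> {s\<^sub>0..s\<^sub>1} \<times> {y..z} = {s\<^sub>0..s\<^sub>1} \<times> {y}" using trans by auto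
          then show "connected ({s\<^sub>0..s\<^sub>1} \<times> {x..y} \<inter> {s\<^sub>0..s\<^sub>1} \<times> {y..z})"
            "{s\<^sub>0..s\<^sub>1} \<times> {x..y} \<inter> {s\<^sub>0..s\<^sub>1} \<times> {y..z} \<noteq> {}" using h by (auto intro!: connected_Times)
        qed (use e h p in \<open>auto intro: closed_Times\<close>)
        moreover have "{s\<^sub>0..s\<^sub>1} \<times> {x..y} \<union> {s\<^sub>0..s\<^sub>1} \<times> {y..z} = {s\<^sub>0..s\<^sub>1} \<times> {x..z}" using trans by auto
        ultimately show ?thesis by simp
      qed
      then show ?case using e by (intro exI[of _ "min e1 e2"]) auto
    next
      case (local t)
      obtain e where "e > 0" and e: "\<And>s\<^sub>0 s\<^sub>1 t\<^sub>0 t\<^sub>1. s\<^sub>0 \<le> s \<and> s \<le> s\<^sub>1 \<and> t\<^sub>0 \<le> t \<and> t \<le> t\<^sub>1 \<and>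
          s\<^sub>1 - s\<^sub>0 < e \<and> t\<^sub>1 - t\<^sub>0 < e \<Longrightarrow> extendable ({s\<^sub>0..s\<^sub>1} \<times> {t\<^sub>0..t\<^sub>1}) p"
        using loc[of s t] by blast
      show ?case
        by (rule exI[of _ e], intro conjI allI impI \<open>e > 0\<close>, rule exI[of _ e]) (simp add: e \<open>e > 0\<close>)
    qed
    then show ?case .
  qed
qed

section \<open>Continuation along paths and monodromy\<close>

lemma extendable_path:
  assumes "path \<gamma>" "path_image \<gamma> \<subseteq> S"
  shows "extendable {0..1} \<gamma>"
  unfolding extendable_def
proof (intro ballI allI impI)
  fix x v r assume x: "x \<in> {0..1}" "v \<in> I" "\<gamma> x \<in> U v"
  \<comment> \<open>The path becomes a map on the plane that ignores the first coordinate and is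
    clamped in the second, so that the rectangle lemma applies.\<close>
  define p where "p = (\<lambda>z::real\<times>real. \<gamma> (max 0 (min 1 (snd z))))"
  have "continuous_on UNIV (\<lambda>z::real\<times>real. max 0 (min 1 (snd z)))"
    by (intro continuous_intros)
  then have "continuous_on UNIV p" unfolding p_def
    by (rule continuous_on_compose2[OF assms(1)[unfolded path_def]]) auto
  moreover have "range p \<subseteq> S" using assms(2) by (auto simp: p_def path_image_def)
  ultimately have "extendable ({0..1} \<times> {0..1}) p" using extendable_rectangle by simp
  moreover have "(0,x) \<in> {0..1::real} \<times> {0..1::real}" "p (0,x) \<in> U v" using x by (auto simp: p_def)
  ultimately obtain \<sigma> where \<sigma>: "section_over ({0..1} \<times> {0..1}) p \<sigma>" "\<sigma> (0,x) v = r"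
    using x(2) unfolding extendable_def by blast
  have "section_over {0..1} \<gamma> (\<lambda>t. \<sigma> (0,t))"
    by (rule section_over_pullback[OF \<sigma>(1)]) (auto simp: p_def intro!: continuous_intros)
  then show "\<exists>\<sigma>. section_over {0..1} \<gamma> \<sigma> \<and> \<sigma> x v = r" using \<sigma>(2) by metis
qed

text \<open>A section over the homotopy square restricts to \<open>\<sigma>\<close> along its bottom
  and is constant along its top, where the loop is constant. Left and right side are the same path,
  the track of the base point; the sections over them agree at the top and hence at the
  bottom.\<close>

lemma monodromy_trivial:
  assumes "simply_connected S" "path \<gamma>" "path_image \<gamma> \<subseteq> S" "pathfinish \<gamma> = pathstart \<gamma>"
    and \<sigma>: "section_over {0..1} \<gamma> \<sigma>" and v: "v \<in> I" "pathstart \<gamma> \<in> U v"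
  shows "\<sigma> 1 v = \<sigma> 0 v"
proof -
  have "homotopic_loops S \<gamma> (\<lambda>t. pathstart \<gamma>)"
    using assms(1)[unfolded simply_connected_def, rule_format, of \<gamma> "\<lambda>t. pathstart \<gamma>"] assms(2-4)
    by (force simp: path_def path_image_def pathstart_def pathfinish_def)
  then obtain h :: "real \<times> real \<Rightarrow> 'a" where h:
    "continuous_on ({0..1} \<times> {0..1}) h" "h ` ({0..1} \<times> {0..1}) \<subseteq> S"
    "\<And>t. t \<in> {0..1} \<Longrightarrow> h (0,t) = \<gamma> t" "\<And>t. t \<in> {0..1} \<Longrightarrow> h (1,t) = \<gamma> 0"
    "\<And>s. s \<in> {0..1} \<Longrightarrow> h (s,1) = h (s,0)"
    by (rule homotopic_loops_to_constE) (use that in \<open>simp add: pathstart_def\<close>)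
  \<comment> \<open>Retraction of the plane onto the unit square.\<close>
  define c where "c = (\<lambda>z::real\<times>real. (max 0 (min 1 (fst z)), max 0 (min 1 (snd z))) :: real \<times> real)"
  define p where "p = (\<lambda>z. h (c z))"
  have "continuous_on UNIV c" unfolding c_def by (intro continuous_intros)
  then have "continuous_on UNIV p" unfolding p_def
    by (rule continuous_on_compose2[OF h(1)]) (auto simp: c_def)
  moreover have pS: "range p \<subseteq> S" using h(2) by (fastforce simp: p_def c_def)
  ultimately have "extendable ({0..1} \<times> {0..1}) p" using extendable_rectangle by simp
  moreover have "p (0,0) \<in> U v" using h(3)[of 0] v(2) by (simp add: p_def c_def pathstart_def)
  moreover have "(0,0) \<in> {0..1::real} \<times> {0..1::real}" by simp
  ultimately obtain \<tau> where \<tau>: "section_over ({0..1} \<times> {0..1}) p \<tau>" "\<tau> (0,0) v = \<sigma> 0 v"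
    using v(1) unfolding extendable_def by blast
  have pb: "section_over {0..1} q (\<lambda>t. \<tau> (k t))"
    if "continuous_on {0..1} k" "k ` {0..1} \<subseteq> {0..1} \<times> {0..1}" "\<And>t. t \<in> {0..1} \<Longrightarrow> q t = p (k t)" for k :: "real \<Rightarrow> real \<times> real" and q
    using section_over_pullback[OF \<tau>(1) that] .
  have bot: "section_over {0..1} \<gamma> (\<lambda>t. \<tau> (0,t))"
    using h(3) by (intro pb) (auto simp: p_def c_def intro!: continuous_intros)
  have top: "section_over {0..1} (\<lambda>t. \<gamma> 0) (\<lambda>t. \<tau> (1,t))"
    using h(4) by (intro pb) (auto simp: p_def c_def intro!: continuous_intros)
  have left: "section_over {0..1} (\<lambda>s. h (s,0)) (\<lambda>s. \<tau> (s,0))"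
    by (intro pb) (auto simp: p_def c_def intro!: continuous_intros)
  have right: "section_over {0..1} (\<lambda>s. h (s,0)) (\<lambda>s. \<tau> (s,1))"
    using h(5) by (intro pb) (auto simp: p_def c_def intro!: continuous_intros)
  have g0: "\<gamma> 0 \<in> S" "\<gamma> 0 \<in> U v" using assms(3) v by (auto simp: path_image_def pathstart_def)
  have "section_over {0..1::real} (\<lambda>t. \<gamma> 0) (\<lambda>t w. g v w (\<tau> (1,0) v))"
    using g0 v by (intro section_over_const) auto
  then have "\<tau> (1,1) v = g v v (\<tau> (1,0) v)"
    using g0 v g_refl
    by (intro section_over_unique[OF _ _ top, where x\<^sub>0 = 0 and v\<^sub>0 = v and x = 1]) auto
  then have "\<tau> (1,0) v = \<tau> (1,1) v" using g_refl v by simp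
  then have "\<tau> (0,0) v = \<tau> (0,1) v"
    using h(2) v g0 h(3,4)[of 0]
    by (intro section_over_unique[OF _ _ left right, where x\<^sub>0 = 1 and v\<^sub>0 = v and x = 0]) auto
  moreover have "\<tau> (0,1) v = \<sigma> 1 v"
    using assms(3,4) \<tau>(2) v
    by (intro section_over_unique[OF _ _ bot \<sigma>, where x\<^sub>0 = 0 and v\<^sub>0 = v and x = 1])
       (auto simp: path_image_def pathstart_def pathfinish_def)
  ultimately show ?thesis using \<tau>(2) by simp
qed

text \<open>Analytic continuation: the value at \<open>x\<close> obtained along some path from \<open>x\<^sub>0\<close>.\<close>

definition continues :: "'a \<Rightarrow> 'v \<Rightarrow> 'b \<Rightarrow> 'a \<Rightarrow> 'v \<Rightarrow> 'b \<Rightarrow> bool" where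
  "continues x\<^sub>0 v\<^sub>0 r\<^sub>0 x v r \<longleftrightarrow>
     (\<exists>\<gamma> \<sigma>. path \<gamma> \<and> path_image \<gamma> \<subseteq> S \<and> pathstart \<gamma> = x\<^sub>0 \<and> pathfinish \<gamma> = x \<and>
        section_over {0..1} \<gamma> \<sigma> \<and> \<sigma> 0 v\<^sub>0 = r\<^sub>0 \<and> \<sigma> 1 v = r)"

text \<open>The first path followed by the reverse of the second is a loop. Trivial monodromy brings
  the starting value back, so the value at time 1/2 may be computed from either half.\<close>

lemma continues_unique:
  assumes sc: "simply_connected S" and v0: "v\<^sub>0 \<in> I" "x\<^sub>0 \<in> U v\<^sub>0" and v: "v \<in> I" "x \<in> U v"
    and r: "continues x\<^sub>0 v\<^sub>0 r\<^sub>0 x v r" "continues x\<^sub>0 v\<^sub>0 r\<^sub>0 x v r'"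
  shows "r = r'"
proof -
  obtain \<gamma> \<sigma> where \<gamma>: "path \<gamma>" "path_image \<gamma> \<subseteq> S" "pathstart \<gamma> = x\<^sub>0" "pathfinish \<gamma> = x"
    "section_over {0..1} \<gamma> \<sigma>" "\<sigma> 0 v\<^sub>0 = r\<^sub>0" "\<sigma> 1 v = r" using r(1) unfolding continues_def by blast
  obtain \<delta> \<tau> where \<delta>: "path \<delta>" "path_image \<delta> \<subseteq> S" "pathstart \<delta> = x\<^sub>0" "pathfinish \<delta> = x"
    "section_over {0..1} \<delta> \<tau>" "\<tau> 0 v\<^sub>0 = r\<^sub>0" "\<tau> 1 v = r'" using r(2) unfolding continues_def by blast
  define \<eta> where "\<eta> = \<gamma> +++ reversepath \<delta>"
  have \<eta>: "path \<eta>" "path_image \<eta> \<subseteq> S" "pathstart \<eta> = x\<^sub>0" "pathfinish \<eta> = x\<^sub>0"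
    using \<gamma> \<delta> by (auto simp: \<eta>_def path_image_join)
  have "extendable {0..1} \<eta>" by (rule extendable_path[OF \<eta>(1,2)])
  then obtain \<rho> where \<rho>: "section_over {0..1} \<eta> \<rho>" "\<rho> 0 v\<^sub>0 = r\<^sub>0"
    using v0 \<eta>(3) unfolding extendable_def by (force simp: pathstart_def)
  have end': "\<rho> 1 v\<^sub>0 = r\<^sub>0" using monodromy_trivial[OF sc \<eta>(1,2) _ \<rho>(1) v0(1)] \<eta> v0 \<rho>(2) by simp
  have mid: "\<gamma> 1 = \<delta> 1" using \<gamma>(4) \<delta>(4) by (simp add: pathfinish_def)
  have a: "section_over {0..1} \<gamma> (\<lambda>t. \<rho> (t/2))"
    by (rule section_over_pullback[OF \<rho>(1)])
       (auto simp: \<eta>_def joinpaths_def intro!: continuous_intros)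
  have b: "section_over {0..1} \<delta> (\<lambda>t. \<rho> (1 - t/2))"
    using mid by (intro section_over_pullback[OF \<rho>(1)])
       (auto simp: \<eta>_def joinpaths_def reversepath_def intro!: continuous_intros)
  have "\<rho> (1/2) v = r"
    using section_over_unique[OF _ _ a \<gamma>(5), where x\<^sub>0 = 0 and v\<^sub>0 = v\<^sub>0 and x = 1 and v = v] \<gamma> \<rho>(2) v v0
    by (auto simp: path_image_def pathstart_def pathfinish_def)
  moreover have "\<rho> (1 - 1/2) v = r'"
    using section_over_unique[OF _ _ b \<delta>(5), where x\<^sub>0 = 0 and v\<^sub>0 = v\<^sub>0 and x = 1 and v = v] \<delta> end' v v0
    by (auto simp: path_image_def pathstart_def pathfinish_def)
  ultimately show ?thesis by simp
qed

lemma continues_change: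
  assumes "continues x\<^sub>0 v\<^sub>0 r\<^sub>0 x v r" "v \<in> I" "w \<in> I" "x \<in> U v" "x \<in> U w"
  shows "continues x\<^sub>0 v\<^sub>0 r\<^sub>0 x w (g v w r)"
proof -
  obtain \<gamma> \<sigma> where \<gamma>: "path \<gamma>" "path_image \<gamma> \<subseteq> S" "pathstart \<gamma> = x\<^sub>0" "pathfinish \<gamma> = x"
    "section_over {0..1} \<gamma> \<sigma>" "\<sigma> 0 v\<^sub>0 = r\<^sub>0" "\<sigma> 1 v = r" using assms(1) unfolding continues_def by blast
  have "\<sigma> 1 w = g v w r"
    using section_overD1[OF \<gamma>(5), of 1 v w] assms \<gamma>(4,7) by (auto simp: pathfinish_def)
  then show ?thesis unfolding continues_def using \<gamma> by blast
qed

text \<open>The path is prolonged inside \<open>U v\<close>, over which the constant value seen from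
  \<open>v\<close> is a section.\<close>

lemma continues_within:
  assumes "continues x\<^sub>0 v\<^sub>0 r\<^sub>0 x v r" and v0: "v\<^sub>0 \<in> I" "x\<^sub>0 \<in> U v\<^sub>0"
    and v: "v \<in> I" "x \<in> U v" "y \<in> U v" and pc: "path_connected (U v)"
  shows "continues x\<^sub>0 v\<^sub>0 r\<^sub>0 y v r"
proof -
  obtain \<gamma> \<sigma> where \<gamma>: "path \<gamma>" "path_image \<gamma> \<subseteq> S" "pathstart \<gamma> = x\<^sub>0" "pathfinish \<gamma> = x"
    "section_over {0..1} \<gamma> \<sigma>" "\<sigma> 0 v\<^sub>0 = r\<^sub>0" "\<sigma> 1 v = r" using assms(1) unfolding continues_def by blast
  obtain \<delta> where \<delta>: "path \<delta>" "path_image \<delta> \<subseteq> U v" "pathstart \<delta> = x" "pathfinish \<delta> = y"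
    using pc v unfolding path_connected_def by blast
  have US: "U v \<subseteq> S" using U_open[OF v(1)] openin_imp_subset by blast
  define \<eta> where "\<eta> = \<gamma> +++ \<delta>"
  have \<eta>: "path \<eta>" "path_image \<eta> \<subseteq> S" "pathstart \<eta> = x\<^sub>0" "pathfinish \<eta> = y"
    using \<gamma> \<delta> US by (auto simp: \<eta>_def path_image_join)
  have "extendable {0..1} \<eta>" by (rule extendable_path[OF \<eta>(1,2)])
  then obtain \<rho> where \<rho>: "section_over {0..1} \<eta> \<rho>" "\<rho> 0 v\<^sub>0 = r\<^sub>0"
    using v0 \<eta>(3) unfolding extendable_def by (force simp: pathstart_def)
  have mid: "\<gamma> 1 = \<delta> 0" using \<gamma>(4) \<delta>(3) by (simp add: pathfinish_def pathstart_def)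
  have a: "section_over {0..1} \<gamma> (\<lambda>t. \<rho> (t/2))"
    by (rule section_over_pullback[OF \<rho>(1)])
       (auto simp: \<eta>_def joinpaths_def intro!: continuous_intros)
  have b: "section_over {0..1} \<delta> (\<lambda>t. \<rho> ((1 + t)/2))"
    using mid by (intro section_over_pullback[OF \<rho>(1)])
       (auto simp: \<eta>_def joinpaths_def field_simps intro!: continuous_intros)
  have "\<rho> (1/2) v = r"
    using section_over_unique[OF _ _ a \<gamma>(5), where x\<^sub>0 = 0 and v\<^sub>0 = v\<^sub>0 and x = 1 and v = v] \<gamma> \<rho>(2) v v0
    by (auto simp: path_image_def pathstart_def pathfinish_def)
  moreover have "section_over {0..1} \<delta> (\<lambda>t w. g v w (\<rho> (1/2) v))"
    using \<delta> US v by (intro section_over_const) (auto simp: path_def path_image_def)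
  then have "\<rho> 1 v = g v v (\<rho> (1/2) v)"
    using section_over_unique[OF _ _ b, where x\<^sub>0 = 0 and v\<^sub>0 = v and x = 1 and v = v
        and \<tau> = "\<lambda>t w. g v w (\<rho> (1/2) v)"] \<delta> US v g_refl
    by (auto simp: path_image_def pathstart_def pathfinish_def)
  ultimately have "\<rho> 1 v = r" using g_refl v by simp
  then show ?thesis unfolding continues_def using \<eta> \<rho> by blast
qed

text \<open>The value at an index is the one continued to any point of \<open>U v\<close>:
  \<open>continues_unique\<close> removes the dependence on the path,
  \<open>continues_within\<close> the one on the point. The transition rule is read off at a common
  point of two members of the cover.\<close>

theorem global_section:
  assumes sc: "simply_connected S" and pc: "\<And>v. v \<in> I \<Longrightarrow> path_connected (U v)"
    and ne: "\<And>v. v \<in> I \<Longrightarrow> U v \<noteq> {}" and v0: "v\<^sub>0 \<in> I"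
  obtains s where "s v\<^sub>0 = r\<^sub>0"
    "\<And>v w. v \<in> I \<Longrightarrow> w \<in> I \<Longrightarrow> U v \<inter> U w \<noteq> {} \<Longrightarrow> s w = g v w (s v)"
proof -
  obtain x0 where x0: "x0 \<in> U v\<^sub>0" using ne v0 by blast
  have US: "U v \<subseteq> S" if "v \<in> I" for v using U_open[OF that] openin_imp_subset by blast
  have ex: "\<exists>r. continues x0 v\<^sub>0 r\<^sub>0 x v r" if "x \<in> S" for x v
  proof -
    obtain \<gamma> where \<gamma>: "path \<gamma>" "path_image \<gamma> \<subseteq> S" "pathstart \<gamma> = x0" "pathfinish \<gamma> = x"
      using simply_connected_imp_path_connected_topological[OF sc, unfolded path_connected_def,
          rule_format, of x0 x] \<open>x \<in> S\<close> subsetD[OF US[OF v0] x0] by metis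
    then have "extendable {0..1} \<gamma>" using extendable_path by blast
    then obtain \<sigma> where "section_over {0..1} \<gamma> \<sigma>" "\<sigma> 0 v\<^sub>0 = r\<^sub>0"
      using v0 x0 \<gamma>(3) unfolding extendable_def by (force simp: pathstart_def)
    then show ?thesis unfolding continues_def using \<gamma> by blast
  qed
  define s where "s v = (THE r. \<exists>x\<in>U v. continues x0 v\<^sub>0 r\<^sub>0 x v r)" for v
  have s: "s v = r" if v: "v \<in> I" "x \<in> U v" "continues x0 v\<^sub>0 r\<^sub>0 x v r" for v x r
    unfolding s_def
  proof (rule the_equality)
    show "\<exists>x\<in>U v. continues x0 v\<^sub>0 r\<^sub>0 x v r" using that by blast
  next
    fix r' assume "\<exists>x\<in>U v. continues x0 v\<^sub>0 r\<^sub>0 x v r'"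
    then have "continues x0 v\<^sub>0 r\<^sub>0 x v r'" using continues_within[OF _ v0 x0 v(1) _ v(2) pc] v(1) by blast
    then show "r' = r" using continues_unique[OF sc v0 x0 v(1,2)] v(3) by blast
  qed
  show thesis
  proof (rule that)
    have g0: "x0 \<in> S" using US[OF v0] x0 by blast
    have "section_over {0..1::real} (\<lambda>t. x0) (\<lambda>t w. g v\<^sub>0 w r\<^sub>0)"
      using x0 v0 g0 by (intro section_over_const) auto
    then have "continues x0 v\<^sub>0 r\<^sub>0 x0 v\<^sub>0 r\<^sub>0"
      unfolding continues_def using g_refl[OF v0] g0
      by (intro exI[of _ "\<lambda>t. x0"] exI[of _ "\<lambda>t w. g v\<^sub>0 w r\<^sub>0"])
         (auto simp: path_def path_image_def pathstart_def pathfinish_def)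
    then show "s v\<^sub>0 = r\<^sub>0" using s v0 x0 by blast
  next
    fix v w assume vw: "v \<in> I" "w \<in> I" "U v \<inter> U w \<noteq> {}"
    then obtain y where y: "y \<in> U v" "y \<in> U w" by blast
    obtain r where r: "continues x0 v\<^sub>0 r\<^sub>0 y v r" using ex US y vw by blast
    then have "continues x0 v\<^sub>0 r\<^sub>0 y w (g v w r)" using continues_change vw y by blast
    then show "s w = g v w (s v)" using s r vw y by metis
  qed
qed

end

section \<open>Cells and vertex stars of a quad-graph\<close>

lemma arc_inverse:
  assumes "arc \<gamma>" and haus: "Hausdorff_space (top_of_set (path_image \<gamma>))"
  obtains k where "continuous_on (path_image \<gamma>) k" "\<And>t. t \<in> {0..1} \<Longrightarrow> k (\<gamma> t) = t"
proof -
  have "homeomorphic_map (top_of_set {0..1::real}) (top_of_set (path_image \<gamma>)) \<gamma>"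
  proof (rule continuous_imp_homeomorphic_map)
    show "continuous_map (top_of_set {0..1::real}) (top_of_set (path_image \<gamma>)) \<gamma>"
      using assms by (auto simp: arc_def path_def path_image_def)
  qed (use assms in \<open>auto simp: arc_def path_image_def compact_space_subtopology\<close>)
  then obtain k where "homeomorphic_maps (top_of_set {0..1::real}) (top_of_set (path_image \<gamma>)) \<gamma> k"
    using homeomorphic_map_maps by blast
  then show thesis using that[of k] by (auto simp: homeomorphic_maps_def)
qed

text \<open>A convex set that is not collinear stays connected when a point is removed. If m x < m y
  < m z, the image of the set without y would be connected, contain m x and m z, and omit m
  y.\<close>

lemma real_injection_on_convex_imp_collinear:
  fixes C :: "'b::euclidean_space set" and m :: "'b \<Rightarrow> real"
  assumes C: "convex C" and m: "continuous_on C m" "inj_on m C"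
  shows "collinear C"
proof (rule ccontr)
  assume nc: "\<not> collinear C"
  have "infinite C" using nc C
    by (metis collinear_empty collinear_sing convex_connected connected_finite_iff_sing finite_subset order_refl)
  then obtain T where T: "T \<subseteq> C" "card T = 3" "finite T"
    using infinite_arbitrarily_large by blast
  then have "card (m ` T) = 3" using m(2) by (simp add: card_image inj_on_subset)
  then obtain a b c where abc: "m ` T = {a,b,c}" "a \<noteq> b" "b \<noteq> c" "a \<noteq> c"
    by (auto simp: card_3_iff)
  have "\<exists>x y z. {x,y,z} \<subseteq> m ` T \<and> x < y \<and> y < z"
    using abc by (cases a b rule: linorder_cases; cases b c rule: linorder_cases; cases a c rule: linorder_cases) force+
  then obtain x y z where xyz: "x \<in> C" "y \<in> C" "z \<in> C" "m x < m y" "m y < m z"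
    using T(1) by force
  have "connected (C - {y})"
    using connected_convex_diff_countable[OF C nc, of "{y}"] by simp
  then have "connected (m ` (C - {y}))"
    by (rule connected_continuous_image[rotated]) (use m(1) continuous_on_subset in blast)
  moreover have "m x \<in> m ` (C - {y})" "m z \<in> m ` (C - {y})" using xyz by auto
  ultimately have "m y \<in> m ` (C - {y})"
    using xyz(4,5) by (meson connectedD_interval less_imp_le)
  then show False using m(2) xyz(2) by (auto simp: inj_on_def)
qed

text \<open>Composing with the inverse of the arc gives a real injection on C. This is the dimension
  argument that tells two-dimensional pieces of the surface from edges.\<close>

lemma arc_contains_no_disc:
  fixes h :: "'b::euclidean_space \<Rightarrow> 'a::topological_space"
  assumes "arc \<gamma>" "Hausdorff_space (top_of_set (path_image \<gamma>))"
    and h: "continuous_on C h" "inj_on h C" "h ` C \<subseteq> path_image \<gamma>" and C: "convex C"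
  shows "collinear C"
proof -
  obtain k where k: "continuous_on (path_image \<gamma>) k" "\<And>t. t \<in> {0..1} \<Longrightarrow> k (\<gamma> t) = t"
    using arc_inverse[OF assms(1,2)] by blast
  have "inj_on k (path_image \<gamma>)" using k(2) by (auto simp: inj_on_def path_image_def)
  then have "inj_on (k \<circ> h) C" using h(2,3) by (meson comp_inj_on inj_on_subset)
  moreover have "continuous_on C (k \<circ> h)"
    using h k(1) by (meson continuous_on_compose continuous_on_subset)
  ultimately show ?thesis using real_injection_on_convex_imp_collinear C by blast
qed

lemma interior_imp_not_collinear:
  fixes C :: "'b::euclidean_space set"
  assumes "interior C \<noteq> {}" "DIM('b) \<ge> 2"
  shows "\<not> collinear C"
  using aff_dim_nonempty_interior[OF assms(1)] assms(2) by (simp add: collinear_aff_dim)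

lemma image_subset_closedin:
  assumes "continuous_on X f" "f ` X \<subseteq> S" "closedin (top_of_set S) K" "A \<subseteq> X" "X \<subseteq> closure A"
    "f ` A \<subseteq> K"
  shows "f ` X \<subseteq> K"
proof -
  obtain T where T: "closed T" "X \<inter> f -` K = X \<inter> T"
    using continuous_closedin_preimage_gen[OF assms(1) _ assms(3)] assms(2)
    by (metis closedin_closed image_subset_iff_funcset)
  have "A \<subseteq> T" using assms(4,6) T(2) by blast
  then have "X \<subseteq> T" using assms(5) T(1) by (metis closure_minimal order_trans)
  then show ?thesis using T(2) by blast
qed

locale quad_cells =
  fixes D :: "('a::topological_space) cell_decomposition"
  assumes quad: "quad_graph D"
begin

abbreviation "S \<equiv> surface D"
abbreviation "V \<equiv> verts D"

lemma haus: "T \<subseteq> S \<Longrightarrow> Hausdorff_space (top_of_set T)"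
  using quad Hausdorff_space_subtopology[of "top_of_set S" T]
  by (auto simp: quad_graph_def topological_surface_def subtopology_subtopology inf.absorb2)

lemma part: "partition_on S (open_cells D)"
  using quad by (simp add: quad_graph_def)

lemma open_cell_eq: "A \<in> open_cells D \<Longrightarrow> B \<in> open_cells D \<Longrightarrow> x \<in> A \<Longrightarrow> x \<in> B \<Longrightarrow> A = B"
  using part unfolding partition_on_def disjoint_def by blast

lemma cell_subset: "A \<in> closed_cells D \<Longrightarrow> A \<subseteq> S"
  using quad unfolding quad_graph_def locally_finite_in_def topspace_euclidean_subtopology by blast

lemma locfin: "\<B> \<subseteq> closed_cells D \<Longrightarrow> locally_finite_in (top_of_set S) \<B>"
  using quad locally_finite_in_subset[of "top_of_set S" "closed_cells D" \<B>]
  unfolding quad_graph_def by meson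

lemma Int_cells: "A \<in> closed_cells D \<Longrightarrow> B \<in> closed_cells D \<Longrightarrow> A \<inter> B \<noteq> {} \<Longrightarrow> A \<inter> B \<in> closed_cells D"
  using quad unfolding quad_graph_def by blast

lemma vert_in_open_cells: "v \<in> V \<Longrightarrow> {v} \<in> open_cells D"
  and edge_in_open_cells: "e \<in> edges D \<Longrightarrow> e - V \<in> open_cells D"
  and face_in_open_cells: "Q \<in> faces D \<Longrightarrow> Q - \<Union>(edges_of D Q) \<in> open_cells D"
  by (auto simp: open_cells_def)

lemma vert_in_closed_cells: "v \<in> V \<Longrightarrow> {v} \<in> closed_cells D"
  and edge_in_closed_cells: "e \<in> edges D \<Longrightarrow> e \<in> closed_cells D"
  and face_in_closed_cells: "Q \<in> faces D \<Longrightarrow> Q \<in> closed_cells D"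
  by (auto simp: closed_cells_def)

lemma edge_arc:
  assumes "e \<in> edges D"
  obtains \<gamma> where "arc \<gamma>" "path_image \<gamma> = e" "e \<inter> V = {pathstart \<gamma>, pathfinish \<gamma>}"
  using assms quad by (auto simp: quad_graph_def is_edge_cell_def)

lemma edge_ends:
  assumes "e \<in> edges D"
  obtains v w where "v \<noteq> w" "e \<inter> V = {v,w}"
proof -
  obtain \<gamma> where \<gamma>: "arc \<gamma>" "path_image \<gamma> = e" "e \<inter> V = {pathstart \<gamma>, pathfinish \<gamma>}"
    using edge_arc[OF assms] .
  then show thesis using \<gamma>(3) arc_distinct_ends[OF \<gamma>(1)]
    by (intro that[of "pathfinish \<gamma>" "pathstart \<gamma>"]) (auto simp: insert_commute)
qed

definition chart :: "'a set \<Rightarrow> (real \<times> real \<Rightarrow> 'a) \<Rightarrow> bool" where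
  "chart Q h \<longleftrightarrow> continuous_on unit_square h \<and> inj_on h unit_square \<and> h ` unit_square = Q \<and>
        Q \<inter> V = h ` ({0, 1} \<times> {0, 1}) \<and>
        edges_of D Q = {h ` ({0..1} \<times> {0}), h ` ({0..1} \<times> {1}),
                        h ` ({0} \<times> {0..1}), h ` ({1} \<times> {0..1})}"

lemma face_chart:
  assumes "Q \<in> faces D"
  obtains h where "chart Q h"
proof -
  have "is_quad_cell D Q" using assms quad by (auto simp: quad_graph_def)
  then obtain h k where h: "homeomorphism unit_square Q h k"
        "Q \<inter> verts D = h ` ({0, 1} \<times> {0, 1})"
        "edges_of D Q = {h ` ({0..1} \<times> {0}), h ` ({0..1} \<times> {1}),
                        h ` ({0} \<times> {0..1}), h ` ({1} \<times> {0..1})}"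
    unfolding is_quad_cell_def by (elim exE conjE) (rule that)
  have "inj_on h unit_square" using h(1) by (metis homeomorphism_def inj_on_inverseI)
  then have "chart Q h" using h by (simp add: chart_def homeomorphism_def)
  then show thesis by (rule that)
qed

lemma open_face:
  assumes "chart Q h"
  shows "Q - \<Union>(edges_of D Q) = h ` ({0<..<1} \<times> {0<..<1})"
proof -
  have h: "inj_on h unit_square" "h ` unit_square = Q" using assms by (auto simp: chart_def)
  have eq: "unit_square - ({0..1} \<times> {0} \<union> {0..1} \<times> {1} \<union> {0} \<times> {0..1} \<union> {1} \<times> {0..1}) = {0<..<1} \<times> {0<..<1::real}"
    by force
  have "\<Union>(edges_of D Q) = h ` ({0..1} \<times> {0} \<union> {0..1} \<times> {1} \<union> {0} \<times> {0..1} \<union> {1} \<times> {0..1})"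
    using assms by (simp add: chart_def image_Un Un_assoc)
  then have "Q - \<Union>(edges_of D Q) = h ` (unit_square - ({0..1} \<times> {0} \<union> {0..1} \<times> {1} \<union> {0} \<times> {0..1} \<union> {1} \<times> {0..1}))"
    using h by (subst inj_on_image_set_diff[OF h(1)]) auto
  then show ?thesis using eq by simp
qed

lemma closed_edge: "e \<in> edges D \<Longrightarrow> closedin (top_of_set S) e"
proof -
  assume e: "e \<in> edges D"
  obtain \<gamma> where \<gamma>: "arc \<gamma>" "path_image \<gamma> = e" "e \<inter> V = {pathstart \<gamma>, pathfinish \<gamma>}"
    using edge_arc[OF e] .
  then have "compact e" unfolding arc_def path_def path_image_def
    using compact_continuous_image compact_Icc by blast
  then show ?thesis
    using cell_subset[OF edge_in_closed_cells[OF e]] haus[of S]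
    by (simp add: compactin_imp_closedin compactin_subtopology)
qed

lemma closed_face: "Q \<in> faces D \<Longrightarrow> closedin (top_of_set S) Q"
proof -
  assume Q: "Q \<in> faces D"
  then obtain h where "chart Q h" using face_chart by blast
  then have "compact Q" unfolding chart_def
    by (metis compact_continuous_image compact_Times compact_Icc)
  then show ?thesis
    using cell_subset[OF face_in_closed_cells[OF Q]] haus[of S]
    by (simp add: compactin_imp_closedin compactin_subtopology)
qed

lemma closed_vert: "v \<in> V \<Longrightarrow> closedin (top_of_set S) {v}"
    using cell_subset[OF vert_in_closed_cells] haus[of S]
    by (simp add: compactin_imp_closedin compactin_subtopology)

lemma closed_cell: "A \<in> closed_cells D \<Longrightarrow> closedin (top_of_set S) A"
  using closed_edge closed_face closed_vert by (auto simp: closed_cells_def)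

text \<open>Local finiteness makes arbitrary unions of closed cells closed. The openness of the star
  neighbourhoods and of complements of parts of the skeleton rests on this.\<close>

lemma closed_Union_cells: "\<B> \<subseteq> closed_cells D \<Longrightarrow> closedin (top_of_set S) (\<Union>\<B>)"
  using closedin_locally_finite_Union locfin closed_cell by (metis subsetD)

lemma edge_subset_closed:
  assumes "e \<in> edges D" "closedin (top_of_set S) K" "e - V \<subseteq> K"
  shows "e \<subseteq> K"
proof -
  obtain \<gamma> where \<gamma>: "arc \<gamma>" "path_image \<gamma> = e" "e \<inter> V = {pathstart \<gamma>, pathfinish \<gamma>}"
    using edge_arc[OF assms(1)] .
  have "\<gamma> ` {0..1} \<subseteq> K"
  proof (rule image_subset_closedin[OF _ _ assms(2)])
    show "continuous_on {0..1} \<gamma>" using \<gamma>(1) by (simp add: arc_def path_def)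
    show "\<gamma> ` {0..1} \<subseteq> S" using \<gamma>(2) cell_subset[OF edge_in_closed_cells[OF assms(1)]] by (simp add: path_image_def)
    show "{0<..<1} \<subseteq> {0..1::real}" "{0..1} \<subseteq> closure {0<..<1::real}" by auto
    show "\<gamma> ` {0<..<1} \<subseteq> K"
    proof clarify
      fix t :: real assume t: "t \<in> {0<..<1}"
      have "\<gamma> t \<in> e" using t \<gamma>(2) by (auto simp: path_image_def)
      moreover have "\<gamma> t \<noteq> \<gamma> 0" "\<gamma> t \<noteq> \<gamma> 1"
        using t \<gamma>(1) unfolding arc_def inj_on_def by fastforce+
      ultimately have "\<gamma> t \<in> e - V" using \<gamma>(3) by (auto simp: pathstart_def pathfinish_def)
      then show "\<gamma> t \<in> K" using assms(3) by blast
    qed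
  qed
  then show ?thesis using \<gamma>(2) by (simp add: path_image_def)
qed

lemma face_subset_closed:
  assumes "Q \<in> faces D" "closedin (top_of_set S) K" "Q - \<Union>(edges_of D Q) \<subseteq> K"
  shows "Q \<subseteq> K"
proof -
  obtain h where h: "chart Q h" using face_chart[OF assms(1)] .
  have "h ` unit_square \<subseteq> K"
  proof (rule image_subset_closedin[OF _ _ assms(2)])
    show "continuous_on unit_square h" using h by (simp add: chart_def)
    show "h ` unit_square \<subseteq> S" using h cell_subset[OF face_in_closed_cells[OF assms(1)]] by (simp add: chart_def)
    show "{0<..<1} \<times> {0<..<1::real} \<subseteq> unit_square" by auto
    show "unit_square \<subseteq> closure ({0<..<1} \<times> {0<..<1})" by (auto simp: closure_Times)
    show "h ` ({0<..<1} \<times> {0<..<1}) \<subseteq> K" using open_face[OF h] assms(3) by simp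
  qed
  then show ?thesis using h by (simp add: chart_def)
qed

lemma square_not_collinear: "\<not> collinear ({0<..<1::real} \<times> {0<..<1::real})"
proof (rule interior_imp_not_collinear)
  have "interior ({0<..<1::real} \<times> {0<..<1::real}) = {0<..<1::real} \<times> {0<..<1::real}"
    by (simp add: interior_open open_Times)
  moreover have "(1/2, 1/2) \<in> {0<..<1::real} \<times> {0<..<1::real}" by simp
  ultimately show "interior ({0<..<1::real} \<times> {0<..<1::real}) \<noteq> {}" by (metis empty_iff)
qed simp

text \<open>An open face is the injective image of an open square, which does not fit into an arc.
  In the partition into open cells this keeps faces and edges apart.\<close>

lemma open_face_not_in_edge:
  assumes "Q \<in> faces D" "e \<in> edges D"
  shows "\<not> Q - \<Union>(edges_of D Q) \<subseteq> e"
proof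
  assume sub: "Q - \<Union>(edges_of D Q) \<subseteq> e"
  obtain h where h: "chart Q h" using face_chart[OF assms(1)] .
  obtain \<gamma> where \<gamma>: "arc \<gamma>" "path_image \<gamma> = e" "e \<inter> V = {pathstart \<gamma>, pathfinish \<gamma>}"
    using edge_arc[OF assms(2)] .
  have "e \<subseteq> S" using cell_subset edge_in_closed_cells assms by blast
  have "collinear ({0<..<1::real} \<times> {0<..<1::real})"
  proof (rule arc_contains_no_disc[OF \<gamma>(1)])
    show "Hausdorff_space (top_of_set (path_image \<gamma>))" using haus \<gamma>(2) \<open>e \<subseteq> S\<close> by simp
    have "{0<..<1::real} \<times> {0<..<1::real} \<subseteq> unit_square" by auto
    then show "continuous_on ({0<..<1} \<times> {0<..<1}) h" "inj_on h ({0<..<1} \<times> {0<..<1})"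
      using h unfolding chart_def by (auto intro: continuous_on_subset inj_on_subset)
    show "h ` ({0<..<1} \<times> {0<..<1}) \<subseteq> path_image \<gamma>" using open_face[OF h] sub \<gamma>(2) by simp
  qed (simp add: convex_Times)
  then show False using square_not_collinear by blast
qed

lemma open_face_nonempty: "Q \<in> faces D \<Longrightarrow> Q - \<Union>(edges_of D Q) \<noteq> {}"
  using part face_in_open_cells[of Q] unfolding partition_on_def by metis

lemma open_edge_nonempty: "e \<in> edges D \<Longrightarrow> e - V \<noteq> {}"
  using part edge_in_open_cells[of e] unfolding partition_on_def by metis

lemma open_face_not_sing:
  assumes "Q \<in> faces D" shows "Q - \<Union>(edges_of D Q) \<noteq> {v}"
proof
  assume eq: "Q - \<Union>(edges_of D Q) = {v}"
  obtain h where h: "chart Q h" using face_chart[OF assms(1)] .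
  have "inj_on h ({0<..<1} \<times> {0<..<1})"
    using h unfolding chart_def by (auto intro: inj_on_subset)
  moreover have "(1/2,1/2) \<in> {0<..<1::real} \<times> {0<..<1::real}" "(1/3,1/2) \<in> {0<..<1::real} \<times> {0<..<1::real}"
    by auto
  moreover have "h (1/2,1/2) = h (1/3,1/2)"
    using eq[unfolded open_face[OF h]] calculation(2,3) by (metis imageI singletonD)
  ultimately have "(1/2,1/2) = (1/3::real,1/2::real)" by (metis inj_onD)
  then show False by simp
qed

lemma face_edges: "e \<in> edges_of D Q \<Longrightarrow> e \<in> edges D \<and> e \<subseteq> Q"
  by (auto simp: edges_of_def)

text \<open>If x were on the border of Q', its cell in the partition would be a vertex or an open
  edge, but it is the open face of Q, which is neither. So both faces have the same open cell, and
  this is dense in each of them.\<close>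

lemma open_face_unique:
  assumes "Q \<in> faces D" "Q' \<in> faces D" "x \<in> Q - \<Union>(edges_of D Q)" "x \<in> Q'"
  shows "Q' = Q"
proof -
  have oQ: "Q - \<Union>(edges_of D Q) \<in> open_cells D" using face_in_open_cells assms by blast
  have "x \<in> Q' - \<Union>(edges_of D Q')"
  proof (rule ccontr)
    assume "x \<notin> Q' - \<Union>(edges_of D Q')"
    then obtain e where e: "e \<in> edges D" "x \<in> e" using assms(4) face_edges by blast
    show False
    proof (cases "x \<in> V")
      case True
      then show False
        using open_cell_eq[OF oQ vert_in_open_cells[OF True] assms(3)] open_face_not_sing assms(1) by auto
    next
      case False
      then show False
        using open_cell_eq[OF oQ edge_in_open_cells[OF e(1)] assms(3)] e(2) open_face_not_in_edge[OF assms(1) e(1)] by auto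
    qed
  qed
  then have eq: "Q - \<Union>(edges_of D Q) = Q' - \<Union>(edges_of D Q')"
    using open_cell_eq oQ face_in_open_cells assms by metis
  have "Q \<subseteq> Q'" by (rule face_subset_closed[OF assms(1) closed_face[OF assms(2)]]) (use eq in auto)
  moreover have "Q' \<subseteq> Q" by (rule face_subset_closed[OF assms(2) closed_face[OF assms(1)]]) (use eq in auto)
  ultimately show ?thesis by auto
qed

lemma open_edge_unique:
  assumes "e \<in> edges D" "e' \<in> edges D" "x \<in> e - V" "x \<in> e'"
  shows "e' = e"
proof -
  have eq: "e - V = e' - V"
    using open_cell_eq[OF edge_in_open_cells edge_in_open_cells] assms by blast
  have "e \<subseteq> e'" by (rule edge_subset_closed[OF assms(1) closed_edge[OF assms(2)]]) (use eq in auto)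
  moreover have "e' \<subseteq> e" by (rule edge_subset_closed[OF assms(2) closed_edge[OF assms(1)]]) (use eq in auto)
  ultimately show ?thesis by auto
qed

lemma open_edge_in_face:
  assumes "e \<in> edges D" "Q \<in> faces D" "x \<in> e - V" "x \<in> Q"
  shows "e \<in> edges_of D Q"
proof (cases "x \<in> Q - \<Union>(edges_of D Q)")
  case True
  then have "Q - \<Union>(edges_of D Q) = e - V"
    using open_cell_eq[OF face_in_open_cells edge_in_open_cells] assms by blast
  then show ?thesis using open_face_not_in_edge[OF assms(2,1)] by auto
next
  case False
  then obtain e' where e': "e' \<in> edges_of D Q" "x \<in> e'" using assms(4) by blast
  then have "e' = e" using open_edge_unique[OF assms(1) _ assms(3)] face_edges by blast
  then show ?thesis using e' by simp
qed

text \<open>Strong regularity makes the intersection a closed cell. If it were a face, an inner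
  point of it would determine that face and make it equal to both Q and Q'.\<close>

lemma Int_faces_cases:
  assumes "Q \<in> faces D" "Q' \<in> faces D" "Q \<noteq> Q'" "Q \<inter> Q' \<noteq> {}"
  obtains v where "v \<in> V" "Q \<inter> Q' = {v}"
    | e where "e \<in> edges_of D Q \<inter> edges_of D Q'" "Q \<inter> Q' = e"
proof -
  have "Q \<inter> Q' \<in> closed_cells D" using Int_cells face_in_closed_cells assms by blast
  then consider v where "v \<in> V" "Q \<inter> Q' = {v}" | "Q \<inter> Q' \<in> edges D" | "Q \<inter> Q' \<in> faces D"
    unfolding closed_cells_def by auto
  then show thesis
  proof cases
    case 3
    then obtain x where "x \<in> Q \<inter> Q' - \<Union>(edges_of D (Q \<inter> Q'))" using open_face_nonempty by blast
    then have "Q = Q \<inter> Q'" "Q' = Q \<inter> Q'"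
      using open_face_unique[OF 3 assms(1)] open_face_unique[OF 3 assms(2)] by blast+
    then show thesis using assms(3) by blast
  qed (use that in \<open>auto simp: edges_of_def\<close>)
qed

lemma Int_faces_edge:
  assumes "Q \<in> faces D" "Q' \<in> faces D" "Q \<noteq> Q'" "e \<in> edges_of D Q" "e \<in> edges_of D Q'"
  shows "Q \<inter> Q' = e"
proof -
  have e: "e \<in> edges D" "e \<subseteq> Q \<inter> Q'" using assms face_edges by auto
  obtain v w where vw: "v \<noteq> w" "e \<inter> V = {v,w}" using edge_ends[OF e(1)] .
  have "v \<in> e" "w \<in> e" using vw(2) by auto
  then have vw': "v \<in> Q \<inter> Q'" "w \<in> Q \<inter> Q'" using e(2) by auto
  then have "Q \<inter> Q' \<noteq> {}" by auto
  then show ?thesis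
  proof (rule Int_faces_cases[OF assms(1-3)])
    fix u assume "Q \<inter> Q' = {u}"
    then show ?thesis using vw' vw(1) by simp
  next
    fix e' assume e': "e' \<in> edges_of D Q \<inter> edges_of D Q'" "Q \<inter> Q' = e'"
    obtain x where "x \<in> e - V" using open_edge_nonempty e by blast
    then have "e' = e" using open_edge_unique[OF e(1), of e' x] e e' face_edges by blast
    then show ?thesis using e' by simp
  qed
qed

text \<open>Strong regularity excludes that distinct faces share a diagonal pair of vertices, so
  diagonals never have to be compared between faces.\<close>

lemma common_vertices:
  assumes "Q \<in> faces D" "Q' \<in> faces D" "Q \<noteq> Q'" "v \<in> Q \<inter> Q' \<inter> V" "w \<in> Q \<inter> Q' \<inter> V" "v \<noteq> w"
  obtains e where "e \<in> edges_of D Q" "e \<in> edges_of D Q'" "e \<inter> V = {v,w}"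
proof (rule Int_faces_cases[OF assms(1-3)])
  show "Q \<inter> Q' \<noteq> {}" using assms by blast
next
  fix u assume "Q \<inter> Q' = {u}" then show thesis using assms(4-6) by auto
next
  fix e assume e: "e \<in> edges_of D Q \<inter> edges_of D Q'" "Q \<inter> Q' = e"
  then obtain a b where "e \<inter> V = {a,b}" using edge_ends face_edges by (metis IntD1)
  moreover have "v \<in> e \<inter> V" "w \<in> e \<inter> V" using assms e by auto
  ultimately have "e \<inter> V = {v,w}" using assms(6) by auto
  then show thesis using that e by blast
qed

subsection \<open>Combinatorics of a face\<close>

lemma face_cycle_rotate: "face_cycle D Q a b c d \<Longrightarrow> face_cycle D Q b c d a"
  by (auto simp: face_cycle_def)

lemma face_cycle_reflect: "face_cycle D Q a b c d \<Longrightarrow> face_cycle D Q a d c b"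
  by (auto simp: face_cycle_def insert_commute)

lemma face_cycle_exists:
  assumes "Q \<in> faces D"
  obtains a b c d where "face_cycle D Q a b c d"
proof -
  obtain h where h: "chart Q h" using face_chart[OF assms(1)] .
  then have inj: "inj_on h unit_square" by (simp add: chart_def)
  have ne: "h p \<noteq> h q" if "p \<in> unit_square" "q \<in> unit_square" "p \<noteq> q" for p q
    using inj that by (metis inj_onD)
  have side: "h ` A \<inter> V = h ` (A \<inter> {0,1} \<times> {0,1})" if "A \<subseteq> unit_square" for A
  proof -
    have "h ` A \<inter> V = h ` A \<inter> (Q \<inter> V)" using that h by (auto simp: chart_def)
    also have "\<dots> = h ` A \<inter> h ` ({0,1} \<times> {0,1})" using h by (simp add: chart_def)
    also have "\<dots> = h ` (A \<inter> {0,1} \<times> {0,1})"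
      by (rule inj_on_image_Int[OF inj that, symmetric]) auto
    finally show ?thesis .
  qed
  have c: "{0,1} \<times> {0,1} = {(0,0),(1,0),(1,1),(0,1)::real\<times>real}"
      "{0..1} \<times> {0} \<inter> {0,1} \<times> {0,1} = {(0,0),(1,0)::real\<times>real}"
      "{0..1} \<times> {1} \<inter> {0,1} \<times> {0,1} = {(1,1),(0,1)::real\<times>real}"
      "{0} \<times> {0..1} \<inter> {0,1} \<times> {0,1} = {(0,1),(0,0)::real\<times>real}"
      "{1} \<times> {0..1} \<inter> {0,1} \<times> {0,1} = {(1,0),(1,1)::real\<times>real}"
    by auto
  have es: "(\<lambda>e. e \<inter> V) ` edges_of D Q =
     {h ` {(0,0),(1,0)}, h ` {(1,1),(0,1)}, h ` {(0,1),(0,0)}, h ` {(1,0),(1,1)}}"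
    using h unfolding chart_def by (auto simp: side c subset_iff insert_commute)
  have "face_cycle D Q (h (0,0)) (h (1,0)) (h (1,1)) (h (0,1))"
    unfolding face_cycle_def es using assms h ne by (auto simp: chart_def c)
  then show thesis by (rule that)
qed

lemma face_cycle_edge:
  assumes "face_cycle D Q a b c d"
  obtains e where "e \<in> edges_of D Q" "e \<inter> V = {a,b}"
proof -
  have "{a,b} \<in> (\<lambda>e. e \<inter> V) ` edges_of D Q" using assms by (auto simp: face_cycle_def)
  then show thesis using that by blast
qed

lemma face_cycle_of_edge:
  assumes "Q \<in> faces D" "e \<in> edges_of D Q" "e \<inter> V = {v,w}"
  obtains w' v' where "face_cycle D Q v w w' v'"
proof -
  obtain a b c d where *: "face_cycle D Q a b c d" using face_cycle_exists[OF assms(1)] .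
  then have "{v,w} \<in> {{a,b},{b,c},{c,d},{d,a}}"
    using assms unfolding face_cycle_def by (metis imageI)
  then show thesis
    using that * face_cycle_rotate face_cycle_reflect unfolding doubleton_eq_iff insert_iff empty_iff
    by metis
qed

subsection \<open>The surface is locally two-dimensional\<close>

text \<open>A half disc around the chart image of x is convex and not collinear even at boundary
  points. The dimension arguments use these two properties only, so inner and boundary points of the
  surface are treated alike.\<close>

lemma disc_neighbourhood:
  assumes "openin (top_of_set S) O'" "x \<in> O'"
  obtains N C h where "x \<in> N" "N \<subseteq> O'" "openin (top_of_set S) N" "convex (C::complex set)"
    "\<not> collinear C" "continuous_on C h" "inj_on h C" "h ` C = N"
proof -
  have "x \<in> S" using assms openin_imp_subset by blast
  then obtain U W where U: "x \<in> U" "openin (top_of_set S) U" "openin (top_of_set {z::complex. Im z \<ge> 0}) W"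
    "U homeomorphic W"
    using quad unfolding quad_graph_def topological_surface_def by meson
  then obtain f g where fg: "homeomorphism U W f g" by (auto simp: homeomorphic_def)
  obtain R where R: "open R" "O' = S \<inter> R" using assms(1) by (auto simp: openin_open)
  have "O' \<inter> U = U \<inter> R" using R(2) openin_imp_subset[OF U(2)] by blast
  then have "openin (top_of_set U) (O' \<inter> U)" using R(1) by (simp add: openin_open_Int)
  then have "openin (top_of_set W) (f ` (O' \<inter> U))" using homeomorphism_imp_open_map[OF fg] by blast
  then have "openin (top_of_set {z. Im z \<ge> 0}) (f ` (O' \<inter> U))" using U(3) openin_trans by blast
  then obtain T where T: "open T" "f ` (O' \<inter> U) = {z. Im z \<ge> 0} \<inter> T" by (auto simp: openin_open)
  have "f x \<in> T" "Im (f x) \<ge> 0" using T(2) assms(2) U(1) by blast+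
  then obtain r where r: "r > 0" "ball (f x) r \<subseteq> T" using T(1) open_contains_ball by blast
  define C where "C = ball (f x) r \<inter> {z. Im z \<ge> 0}"
  have CW: "C \<subseteq> f ` (O' \<inter> U)" using r T(2) by (auto simp: C_def)
  have "f ` (O' \<inter> U) \<subseteq> W" using fg by (auto simp: homeomorphism_def)
  then have CW': "C \<subseteq> W" using CW by blast
  have "W \<subseteq> {z. Im z \<ge> 0}" using U(3) openin_imp_subset by blast
  then have "C = W \<inter> ball (f x) r" using CW' by (auto simp: C_def)
  then have "openin (top_of_set W) C" by (simp add: openin_open_Int)
  then have "openin (top_of_set U) (g ` C)"
    using homeomorphism_imp_open_map homeomorphism_symD[OF fg] by blast
  then have op: "openin (top_of_set S) (g ` C)" using U(2) openin_trans by blast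
  have sub: "g ` C \<subseteq> O'"
  proof
    fix y assume "y \<in> g ` C"
    then obtain z where "z \<in> O' \<inter> U" "y = g (f z)" using CW by blast
    then show "y \<in> O'" using fg by (auto simp: homeomorphism_def)
  qed
  have xin: "x \<in> g ` C"
  proof -
    have "f x \<in> C" using r \<open>Im (f x) \<ge> 0\<close> by (simp add: C_def)
    then show ?thesis using fg U(1) unfolding homeomorphism_def by (metis imageI)
  qed
  have nc: "\<not> collinear C"
  proof (rule interior_imp_not_collinear)
    \<comment> \<open>The ball of radius r/2 centred r/2 above f x lies in C even if f x is on the
      boundary of the half-plane.\<close>
    have "ball (f x + \<i> * of_real (r/2)) (r/2) \<subseteq> C"
    proof
      fix z assume z: "z \<in> ball (f x + \<i> * of_real (r/2)) (r/2)"
      then have "dist (f x + \<i> * of_real (r/2)) z < r/2" by simp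
      moreover have "dist (f x) (f x + \<i> * of_real (r/2)) = r/2"
        using r(1) by (simp add: dist_norm norm_mult)
      ultimately have "dist (f x) z < r"
        using dist_triangle[of "f x" z "f x + \<i> * of_real (r/2)"] by linarith
      moreover have "\<bar>Im (f x + \<i> * of_real (r/2) - z)\<bar> < r/2"
        using z abs_Im_le_cmod[of "f x + \<i> * of_real (r/2) - z"] by (simp only: mem_ball dist_norm)
      then have "\<bar>Im (f x) + r/2 - Im z\<bar> < r/2" by simp
      then have "Im z \<ge> 0" using \<open>Im (f x) \<ge> 0\<close> by linarith
      ultimately show "z \<in> C" by (simp add: C_def)
    qed
    then show "interior C \<noteq> {}"
      using r(1) by (metis centre_in_ball empty_iff half_gt_zero interior_maximal open_ball subsetD)
  qed simp
  have "convex {z. Im z \<ge> 0}" using convex_halfspace_Im_ge[of 0] by simp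
  then have "convex C" unfolding C_def by (intro convex_Int) auto
  moreover have "continuous_on C g" using fg CW' unfolding homeomorphism_def by (metis continuous_on_subset)
  moreover have "inj_on g C" using fg CW' unfolding homeomorphism_def
    by (metis (no_types, lifting) inj_on_inverseI subsetD)
  ultimately show thesis using that xin sub op nc by blast
qed

text \<open>A point on no face would have a neighbourhood made of vertices and open edges only.
  After cutting away the vertices and all edges but one, this leaves a disc inside an arc.\<close>

lemma Union_faces: "\<Union>(faces D) = S"
proof
  show "\<Union>(faces D) \<subseteq> S" using cell_subset face_in_closed_cells by blast
  show "S \<subseteq> \<Union>(faces D)"
  proof (rule ccontr)
    assume "\<not> S \<subseteq> \<Union>(faces D)"
    then obtain x where x: "x \<in> S - \<Union>(faces D)" by blast
    have clF: "closedin (top_of_set S) (\<Union>(faces D))"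
      by (rule closed_Union_cells) (auto simp: closed_cells_def)
    then have oF: "openin (top_of_set S) (S - \<Union>(faces D))" by (simp add: openin_diff)
    have cells: "y \<in> V \<or> (\<exists>e\<in>edges D. y \<in> e - V)" if "y \<in> S - \<Union>(faces D)" for y
    proof -
      have "y \<in> \<Union>(open_cells D)" using part that by (simp add: partition_on_def)
      then show ?thesis using that by (auto simp: open_cells_def)
    qed
    \<comment> \<open>A vertex is not isolated in the surface, and it has a neighbourhood without
      other vertices; so a point of an open edge, still outside all faces, lies next to it.\<close>
    have "\<exists>y\<in>S - \<Union>(faces D). y \<notin> V"
    proof (cases "x \<in> V")
      case True
      have "closedin (top_of_set S) (\<Union>((\<lambda>v. {v}) ` (V - {x})))"
        by (rule closed_Union_cells) (auto simp: closed_cells_def)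
      then have cl: "closedin (top_of_set S) (V - {x})" by simp
      have "openin (top_of_set S) (S - \<Union>(faces D) - (V - {x}))" using oF cl by (rule openin_diff)
      moreover have "x \<in> S - \<Union>(faces D) - (V - {x})" using x by blast
      ultimately obtain N and C :: "complex set" and h where N: "x \<in> N" "N \<subseteq> S - \<Union>(faces D) - (V - {x})"
        "\<not> collinear C" "inj_on h C" "h ` C = N" by (rule disc_neighbourhood)
      have "N \<noteq> {x}"
      proof
        assume "N = {x}"
        then have "card C = 1" using N(4,5) by (metis card_image is_singletonI is_singleton_altdef)
        then show False using N(3) by (metis card_1_singletonE collinear_sing)
      qed
      then show ?thesis using N(1,2) by blast
    qed (use x in blast)
    then obtain y e where y: "y \<in> S - \<Union>(faces D)" "e \<in> edges D" "y \<in> e - V" using cells by blast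
    have cl: "closedin (top_of_set S) (\<Union>(edges D - {e} \<union> (\<lambda>v. {v}) ` V))"
      by (rule closed_Union_cells) (auto simp: closed_cells_def)
    have "openin (top_of_set S) (S - \<Union>(faces D) - \<Union>(edges D - {e} \<union> (\<lambda>v. {v}) ` V))"
      using oF cl by (rule openin_diff)
    moreover have "y \<notin> e'" if "e' \<in> edges D - {e}" for e'
      using open_edge_unique[OF y(2) _ y(3), of e'] that by blast
    then have "y \<in> S - \<Union>(faces D) - \<Union>(edges D - {e} \<union> (\<lambda>v. {v}) ` V)"
      using y(1,3) by blast
    ultimately obtain N and C :: "complex set" and h where N: "y \<in> N"
      "N \<subseteq> S - \<Union>(faces D) - \<Union>(edges D - {e} \<union> (\<lambda>v. {v}) ` V)" "convex C"
      "\<not> collinear C" "continuous_on C h" "inj_on h C" "h ` C = N" by (rule disc_neighbourhood)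
    have "N \<subseteq> e"
    proof
      fix p assume "p \<in> N"
      then have p: "p \<in> S - \<Union>(faces D)" "p \<notin> \<Union>(edges D - {e} \<union> (\<lambda>v. {v}) ` V)" using N(2) by blast+
      then obtain e' where "e' \<in> edges D" "p \<in> e' - V" using cells[OF p(1)] by blast
      then show "p \<in> e" using p(2) by blast
    qed
    obtain \<gamma> where \<gamma>: "arc \<gamma>" "path_image \<gamma> = e" "e \<inter> V = {pathstart \<gamma>, pathfinish \<gamma>}"
    using edge_arc[OF y(2)] .
    have "e \<subseteq> S" using cell_subset edge_in_closed_cells y by blast
    have "collinear C"
      by (rule arc_contains_no_disc[OF \<gamma>(1) _ N(5,6) _ N(3)]) (use haus \<open>e \<subseteq> S\<close> \<gamma>(2) N(7) \<open>N \<subseteq> e\<close> in auto)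
    then show False using N(4) by blast
  qed
qed

text \<open>The unit square has no isolated point, and the face is its image under a continuous
  injection.\<close>

lemma vertex_not_isolated_in_face:
  assumes "Q \<in> faces D" "v \<in> Q" "openin (top_of_set S) N" "v \<in> N"
  shows "Q \<inter> N - {v} \<noteq> {}"
proof
  assume eq: "Q \<inter> N - {v} = {}"
  obtain h where h: "chart Q h" using face_chart[OF assms(1)] .
  have QS: "Q \<subseteq> S" using cell_subset face_in_closed_cells assms by blast
  have cl: "closedin (top_of_set S) (S - N)" using assms(3) by (simp add: closedin_diff)
  obtain z where z: "z \<in> unit_square" "h z = v" using h assms(2) by (auto simp: chart_def)
  have "h ` unit_square \<subseteq> S - N"
  proof (rule image_subset_closedin[OF _ _ cl])
    show "continuous_on unit_square h" "h ` unit_square \<subseteq> S" using h QS by (auto simp: chart_def)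
    show "unit_square - {z} \<subseteq> unit_square" by blast
    have ns: "unit_square \<noteq> {p}" for p
    proof
      assume eq: "unit_square = {p}"
      have "(0::real,0::real) \<in> unit_square" "(1::real,0::real) \<in> unit_square" by auto
      then show False unfolding eq by auto
    qed
    have "connected unit_square" by (intro connected_Times) auto
    then have "z islimpt unit_square" by (rule connected_imp_perfect[OF _ z(1) ns])
    then have "z \<in> closure (unit_square - {z})" by (simp add: islimpt_in_closure)
    moreover have "unit_square - {z} \<subseteq> closure (unit_square - {z})" by (rule closure_subset)
    ultimately have "unit_square \<subseteq> closure (unit_square - {z})" by blast
    then show "unit_square \<subseteq> closure (unit_square - {z})" .
    show "h ` (unit_square - {z}) \<subseteq> S - N"
    proof (rule image_subsetI)
      fix p assume p: "p \<in> unit_square - {z}"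
      then have "h p \<noteq> v" using h z unfolding chart_def inj_on_def by blast
      moreover have "h p \<in> Q" using h p unfolding chart_def by blast
      ultimately show "h p \<in> S - N" using eq QS by blast
    qed
  qed
  then show False using z assms(4) by blast
qed

text \<open>The union of \<open>\<A>\<close> and the union of the remaining faces are closed, cover
  S, and meet in vertices only. Around such a vertex a disc neighbourhood stays connected when the
  vertex is removed, but the two unions would separate it.\<close>

lemma faces_edge_connected:
  assumes "connected S" and \<A>: "\<A> \<subseteq> faces D" "\<A> \<noteq> {}"
    and adj: "\<And>Q Q' e. Q \<in> \<A> \<Longrightarrow> Q' \<in> faces D \<Longrightarrow> Q \<noteq> Q' \<Longrightarrow> e \<in> edges_of D Q \<Longrightarrow> e \<in> edges_of D Q'
      \<Longrightarrow> Q' \<in> \<A>"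
  shows "\<A> = faces D"
proof (rule ccontr)
  assume "\<A> \<noteq> faces D"
  then have B: "faces D - \<A> \<noteq> {}" using \<A> by blast
  have clA: "closedin (top_of_set S) (\<Union>\<A>)" and clB: "closedin (top_of_set S) (\<Union>(faces D - \<A>))"
    using \<A> by (auto intro!: closed_Union_cells simp: closed_cells_def)
  have cov: "\<Union>\<A> \<union> \<Union>(faces D - \<A>) = S" using \<A> Union_faces by blast
  have "\<Union>\<A> \<noteq> {}" "\<Union>(faces D - \<A>) \<noteq> {}"
    using open_face_nonempty \<A> B by blast+
  then have "\<Union>\<A> \<inter> \<Union>(faces D - \<A>) \<noteq> {}"
    using assms(1) clA clB cov unfolding connected_closedin_eq by blast
  then obtain x Q Q' where x: "Q \<in> \<A>" "Q' \<in> faces D - \<A>" "x \<in> Q \<inter> Q'" by blast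
  have AB: "\<Union>\<A> \<inter> \<Union>(faces D - \<A>) \<subseteq> V"
  proof
    fix y assume "y \<in> \<Union>\<A> \<inter> \<Union>(faces D - \<A>)"
    then obtain R R' where R: "R \<in> \<A>" "R' \<in> faces D - \<A>" "y \<in> R \<inter> R'" by blast
    then have "R \<in> faces D" "R' \<in> faces D" "R \<noteq> R'" "R \<inter> R' \<noteq> {}" using \<A> by auto
    then show "y \<in> V"
    proof (rule Int_faces_cases)
      fix v assume "v \<in> V" "R \<inter> R' = {v}" then show ?thesis using R(3) by simp
    next
      fix e assume "e \<in> edges_of D R \<inter> edges_of D R'"
      then show ?thesis using adj[of R R' e] R by blast
    qed
  qed
  then have xV: "x \<in> V" using x by blast
  \<comment> \<open>A neighbourhood of x without other vertices is needed, because only then are the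
    two unions disjoint on N - {x}.\<close>
  have "closedin (top_of_set S) (\<Union>((\<lambda>v. {v}) ` (V - {x})))"
    by (rule closed_Union_cells) (auto simp: closed_cells_def)
  then have "openin (top_of_set S) (S - (V - {x}))" by (simp add: openin_diff)
  moreover have "x \<in> S - (V - {x})" using x cov \<A> by blast
  ultimately obtain N and C :: "complex set" and h where N: "x \<in> N" "N \<subseteq> S - (V - {x})"
    "openin (top_of_set S) N" "convex C" "\<not> collinear C" "continuous_on C h" "inj_on h C" "h ` C = N"
    by (rule disc_neighbourhood)
  obtain z where z: "z \<in> C" "h z = x" using N by blast
  have "connected (C - {z})" using connected_convex_diff_countable[OF N(4,5), of "{z}"] by simp
  then have "connected (h ` (C - {z}))"
    by (rule connected_continuous_image[rotated]) (use N(6) continuous_on_subset in blast)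
  moreover have "h ` (C - {z}) = N - {x}" using N(7,8) z by (auto simp: inj_on_def)
  ultimately have con: "connected (N - {x})" by simp
  have NS: "N - {x} \<subseteq> S" using N(2) by blast
  have cl: "closedin (top_of_set (N - {x})) (K \<inter> (N - {x}))" if "closedin (top_of_set S) K" for K
  proof -
    obtain T where "closed T" "K = S \<inter> T" using \<open>closedin (top_of_set S) K\<close> by (auto simp: closedin_closed)
    moreover from this have "K \<inter> (N - {x}) = (N - {x}) \<inter> T" using NS by blast
    ultimately show ?thesis by (simp add: closedin_closed_Int)
  qed
  have "(\<Union>\<A> \<inter> (N - {x})) \<union> (\<Union>(faces D - \<A>) \<inter> (N - {x})) = N - {x}" using cov NS by blast
  moreover have "(\<Union>\<A> \<inter> (N - {x})) \<inter> (\<Union>(faces D - \<A>) \<inter> (N - {x})) = {}" using AB N(2) by blast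
  moreover have "\<Union>\<A> \<inter> (N - {x}) \<noteq> {}"
    using vertex_not_isolated_in_face[of Q x N] x \<A> N by blast
  moreover have "\<Union>(faces D - \<A>) \<inter> (N - {x}) \<noteq> {}"
    using vertex_not_isolated_in_face[of Q' x N] x \<A> N by blast
  ultimately show False using con cl[OF clA] cl[OF clB] unfolding connected_closedin_eq by meson
qed

subsection \<open>Star neighbourhoods\<close>

text \<open>The complement of all faces that miss v. It contains the open star, and at the boundary
  of the surface it can also contain points of boundary edges opposite to v. Every face through a
  common point of several such sets contains all their centres, so the cocycle condition concerns a
  single face.\<close>

definition star_nbhd :: "'a \<Rightarrow> 'a set" where
  "star_nbhd v = {x \<in> S. \<forall>Q\<in>faces D. x \<in> Q \<longrightarrow> v \<in> Q}"

lemma star_nbhd_open: "openin (top_of_set S) (star_nbhd v)"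
proof -
  have "star_nbhd v = S - \<Union>{Q \<in> faces D. v \<notin> Q}" by (auto simp: star_nbhd_def)
  moreover have "closedin (top_of_set S) (\<Union>{Q \<in> faces D. v \<notin> Q})"
    by (rule closed_Union_cells) (auto simp: closed_cells_def)
  ultimately show ?thesis by (simp add: openin_diff)
qed

lemma vert_in_surface: "v \<in> V \<Longrightarrow> v \<in> S"
  using cell_subset vert_in_closed_cells by blast

lemma centre_in_star: "v \<in> V \<Longrightarrow> v \<in> star_nbhd v"
  using vert_in_surface by (auto simp: star_nbhd_def)

text \<open>An inner point of a face belongs to the set of each corner; a point of an open edge
  belongs to those of both ends, because every face through it contains the whole edge.\<close>

lemma star_nbhds_cover:
  assumes "x \<in> S" shows "\<exists>v\<in>V. x \<in> star_nbhd v"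
proof -
  obtain Q where Q: "Q \<in> faces D" "x \<in> Q" using Union_faces assms by blast
  obtain a b c d where *: "face_cycle D Q a b c d" using face_cycle_exists[OF Q(1)] .
  consider "x \<in> Q - \<Union>(edges_of D Q)" | e where "e \<in> edges_of D Q" "x \<in> e - V" | "x \<in> V"
    using Q by blast
  then show ?thesis
  proof cases
    case 1
    then have "x \<in> star_nbhd a"
      using open_face_unique[OF Q(1) _ 1] * assms by (auto simp: star_nbhd_def face_cycle_def)
    then show ?thesis using * by (auto simp: face_cycle_def)
  next
    case (2 e)
    obtain v w where vw: "e \<inter> V = {v,w}" using edge_ends 2 face_edges by metis
    have "v \<in> Q'" if "Q' \<in> faces D" "x \<in> Q'" for Q'
      using open_edge_in_face[OF _ that(1) 2(2) that(2)] face_edges 2 vw by blast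
    then have "x \<in> star_nbhd v" using assms by (auto simp: star_nbhd_def)
    then show ?thesis using vw by blast
  next
    case 3
    then show ?thesis using centre_in_star by blast
  qed
qed

text \<open>In a chart of a face through x, the corner v is joined to x by a straight segment. Its
  inner points lie in the open face or in a side through v, and such points see only faces that
  contain v.\<close>

lemma star_nbhd_path_connected:
  assumes v: "v \<in> V"
  shows "path_connected (star_nbhd v)"
proof -
  have "path_component (star_nbhd v) v x" if x: "x \<in> star_nbhd v" for x
  proof -
    obtain Q where Q: "Q \<in> faces D" "x \<in> Q" using Union_faces x by (auto simp: star_nbhd_def)
    then have vQ: "v \<in> Q" using x by (auto simp: star_nbhd_def)
    obtain h where h: "chart Q h" using face_chart[OF Q(1)] .
    have "Q \<inter> V = h ` ({0,1} \<times> {0,1})" using h unfolding chart_def by blast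
    then have "v \<in> h ` ({0,1} \<times> {0,1})" using IntI[OF vQ v] by (simp only:)
    then obtain c where c: "c \<in> {0,1} \<times> {0,1}" "h c = v" by (metis imageE)
    obtain z where z: "z \<in> unit_square" "h z = x" using Q(2) h by (auto simp: chart_def)
    define q where "q t = (1 - t) *\<^sub>R c + t *\<^sub>R z" for t :: real
    have c': "c \<in> unit_square" using c(1) by auto
    have "convex unit_square" by (intro convex_Times) auto
    then have qsq: "q t \<in> unit_square" if "t \<in> {0..1}" for t
      unfolding q_def using that c' z(1) by (intro convexD_alt) auto
    have "continuous_on {0..1} (h \<circ> q)"
    proof (rule continuous_on_compose)
      show "continuous_on {0..1} q" unfolding q_def by (intro continuous_intros)
      show "continuous_on (q ` {0..1}) h"
        using h qsq unfolding chart_def by (meson continuous_on_subset image_subsetI)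
    qed
    moreover have "h (q t) \<in> star_nbhd v" if t: "t \<in> {0..1}" for t
    proof (cases "t = 0 \<or> t = 1")
      case True
      then show ?thesis using x centre_in_star[OF v] c z by (auto simp: q_def)
    next
      case False
      then have t': "0 < t" "t < 1" using t by auto
      have yS: "h (q t) \<in> S" using qsq[OF t] h cell_subset[OF face_in_closed_cells[OF Q(1)]]
        by (auto simp: chart_def)
      show ?thesis
      proof (cases "q t \<in> {0<..<1} \<times> {0<..<1}")
        case True
        then have "h (q t) \<in> Q - \<Union>(edges_of D Q)" unfolding open_face[OF h] by (rule imageI)
        then show ?thesis using open_face_unique[OF Q(1)] yS vQ unfolding star_nbhd_def by blast
      next
        case nint: False
        obtain c1 c2 z1 z2 where cz: "c = (c1,c2)" "z = (z1,z2)" by (cases c, cases z)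
        have b: "0 \<le> z1" "z1 \<le> 1" "0 \<le> z2" "z2 \<le> 1" "c1 \<in> {0,1}" "c2 \<in> {0,1}" using c z cz by auto
        have qt: "q t = ((1 - t) * c1 + t * z1, (1 - t) * c2 + t * z2)" by (simp add: q_def cz)
        \<comment> \<open>0 and 1 are extreme points of the unit interval: if a coordinate of
          \<open>q t\<close> takes one of these values for 0 < t < 1, then both ends of the segment
          have the same value there.\<close>
        have comp: "d = s" "e = s" if "d \<in> {0,1}" "0 \<le> e" "e \<le> 1" "(1 - t) * d + t * e = s" "s = 0 \<or> s = 1" for d e s :: real
        proof -
          have "0 \<le> t * e" "t * e \<le> t" using that(2,3) t' by (auto intro: mult_left_le)
          then have "t * e \<noteq> 1" "1 - t + t * e \<noteq> 0" using t' by linarith+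
          then have "d = s \<and> e = s" using that t' by auto
          then show "d = s" "e = s" by auto
        qed
        have bq: "fst (q t) \<in> {0,1} \<or> snd (q t) \<in> {0,1}"
          using nint qsq[OF t] by (cases "q t") force
        obtain A where A: "h ` A \<in> edges_of D Q" "A \<subseteq> unit_square" "c \<in> A" "q t \<in> A"
        proof -
          have "\<exists>A\<in>{{0..1} \<times> {0}, {0..1} \<times> {1}, {0} \<times> {0..1}, {1} \<times> {0..1}}. c \<in> A \<and> q t \<in> A"
            using bq qsq[OF t] comp[OF b(5,1,2)] comp[OF b(6,3,4)] c' unfolding qt cz by auto
          then obtain A where A: "A \<in> {{0..1} \<times> {0}, {0..1} \<times> {1}, {0} \<times> {0..1}, {1} \<times> {0..1}}"
            "c \<in> A \<and> q t \<in> A" by (elim bexE) (rule that)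
          have "edges_of D Q = image h ` {{0..1} \<times> {0}, {0..1} \<times> {1}, {0} \<times> {0..1}, {1} \<times> {0..1}}"
            using h by (simp add: chart_def)
          then have "h ` A \<in> edges_of D Q" using A(1) by blast
          moreover have "A \<subseteq> unit_square" using A(1) by auto
          ultimately show thesis using that A(2) by blast
        qed
        have ve: "v \<in> h ` A" using A c by blast
        show ?thesis
        proof (cases "h (q t) \<in> V")
          case True
          then have "q t \<in> {0,1} \<times> {0,1}"
          proof -
            have "Q \<inter> V = h ` ({0,1} \<times> {0,1})" "h ` unit_square = Q" using h unfolding chart_def by blast+
            moreover have "h (q t) \<in> h ` unit_square" using qsq[OF t] by (rule imageI)
            ultimately have "h (q t) \<in> h ` ({0,1} \<times> {0,1})" using True by (metis IntI)
            then obtain k where k: "k \<in> {0,1} \<times> {0,1}" "h (q t) = h k" by (metis imageE)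
            then have "k \<in> unit_square" by auto
            have "inj_on h unit_square" using h by (simp add: chart_def)
            then have "q t = k" by (rule inj_onD[OF _ k(2) qsq[OF t] \<open>k \<in> unit_square\<close>])
            then show ?thesis using k by simp
          qed
          then have "q t = c" using comp[OF b(5,1,2)] comp[OF b(6,3,4)] unfolding qt cz by auto
          then show ?thesis using c centre_in_star[OF v] by simp
        next
          case False
          then have "h (q t) \<in> h ` A - V" using A by blast
          then have "h ` A \<in> edges_of D Q'" if "Q' \<in> faces D" "h (q t) \<in> Q'" for Q'
            using open_edge_in_face[OF _ that(1)] that(2) A(1) face_edges by blast
          then show ?thesis using yS ve face_edges unfolding star_nbhd_def by blast
        qed
      qed
    qed
    ultimately have "path (h \<circ> q)" "path_image (h \<circ> q) \<subseteq> star_nbhd v"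
      by (auto simp: path_def path_image_def)
    moreover have "pathstart (h \<circ> q) = v" "pathfinish (h \<circ> q) = x"
      using c z by (auto simp: pathstart_def pathfinish_def q_def)
    ultimately show ?thesis unfolding path_component_def by blast
  qed
  then show ?thesis unfolding path_connected_component by (meson path_component_sym path_component_trans)
qed

lemma star_nbhds_meet:
  assumes "v \<in> Q" "w \<in> Q" "Q \<in> faces D"
  shows "star_nbhd v \<inter> star_nbhd w \<noteq> {}"
proof -
  obtain x where x: "x \<in> Q - \<Union>(edges_of D Q)" using open_face_nonempty assms by blast
  then have "x \<in> S" using cell_subset face_in_closed_cells assms by blast
  then have "x \<in> star_nbhd v \<inter> star_nbhd w"
    using open_face_unique[OF assms(3) _ x] assms by (auto simp: star_nbhd_def)
  then show ?thesis by blast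
qed

lemma star_nbhd_face:
  assumes "x \<in> star_nbhd v"
  obtains Q where "Q \<in> faces D" "\<And>w. x \<in> star_nbhd w \<Longrightarrow> w \<in> Q"
proof -
  obtain Q where "Q \<in> faces D" "x \<in> Q" using Union_faces assms by (auto simp: star_nbhd_def)
  then show thesis using that[of Q] by (auto simp: star_nbhd_def)
qed

end

section \<open>Determinants of order four\<close>

lemma vector_4 [simp]:
  "(vector [x,y,z,w] :: ('a::zero)^4) $ 1 = x"
  "(vector [x,y,z,w] :: ('a::zero)^4) $ 2 = y"
  "(vector [x,y,z,w] :: ('a::zero)^4) $ 3 = z"
  "(vector [x,y,z,w] :: ('a::zero)^4) $ 4 = w"
  unfolding vector_def by simp_all

lemma det_4:
  "det (M::'a::comm_ring_1^4^4) =
    M$1$1 * (M$2$2 * (M$3$3 * M$4$4 - M$3$4 * M$4$3) - M$2$3 * (M$3$2 * M$4$4 - M$3$4 * M$4$2)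
      + M$2$4 * (M$3$2 * M$4$3 - M$3$3 * M$4$2))
    - M$1$2 * (M$2$1 * (M$3$3 * M$4$4 - M$3$4 * M$4$3) - M$2$3 * (M$3$1 * M$4$4 - M$3$4 * M$4$1)
      + M$2$4 * (M$3$1 * M$4$3 - M$3$3 * M$4$1))
    + M$1$3 * (M$2$1 * (M$3$2 * M$4$4 - M$3$4 * M$4$2) - M$2$2 * (M$3$1 * M$4$4 - M$3$4 * M$4$1)
      + M$2$4 * (M$3$1 * M$4$2 - M$3$2 * M$4$1))
    - M$1$4 * (M$2$1 * (M$3$2 * M$4$3 - M$3$3 * M$4$2) - M$2$2 * (M$3$1 * M$4$3 - M$3$3 * M$4$1)
      + M$2$3 * (M$3$1 * M$4$2 - M$3$2 * M$4$1))"
proof -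
  have f1234: "finite {2::4, 3, 4}" "1 \<notin> {2::4, 3, 4}" by auto
  have f234: "finite {3::4, 4}" "2 \<notin> {3::4, 4}" by auto
  have f34: "finite {4::4}" "3 \<notin> {4::4}" by auto
  show ?thesis
    unfolding det_def UNIV_4
    unfolding sum_over_permutations_insert[OF f1234]
    unfolding sum_over_permutations_insert[OF f234]
    unfolding sum_over_permutations_insert[OF f34]
    unfolding permutes_sing
    by (simp add: sign_swap_id permutation_swap_id sign_compose sign_id swap_id_eq
        permutation_compose transpose_def algebra_simps)
qed

definition minor :: "real^4 \<Rightarrow> real^4 \<Rightarrow> 4 \<Rightarrow> 4 \<Rightarrow> real" where
  "minor p q i j = p$i * q$j - p$j * q$i"

text \<open>Laplace expansion by the first two and the last two rows. Exchanging rows within a pair,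
  or the two pairs, only permutes the minors or changes their signs, which makes the symmetries of
  the twist visible.\<close>

lemma det_Laplace: "det (vector [p, q, r, s] :: real^4^4) =
    minor p q 1 2 * minor r s 3 4 - minor p q 1 3 * minor r s 2 4 + minor p q 1 4 * minor r s 2 3
  + minor p q 2 3 * minor r s 1 4 - minor p q 2 4 * minor r s 1 3 + minor p q 3 4 * minor r s 1 2"
  unfolding det_4 vector_4 minor_def by (simp add: algebra_simps)

lemma minor_swap: "minor q p i j = - minor p q i j"
  by (simp add: minor_def)

lemma det_relabel:
  "det (vector [p, q, s, r] :: real^4^4) = - det (vector [p, q, r, s])"
  "det (vector [q, p, s, r] :: real^4^4) = det (vector [p, q, r, s])"
  "det (vector [r, s, p, q] :: real^4^4) = det (vector [p, q, r, s])"
  unfolding det_Laplace minor_swap[of s r] minor_swap[of q p] by simp_all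

lemma det_swap_middle: "det (vector [p, r, q, s] :: real^4^4) = - det (vector [p, q, r, s])"
  unfolding det_Laplace minor_def by (simp add: algebra_simps)

lemma det_linear_row:
  "det (vector [p, q, x *\<^sub>R p + y *\<^sub>R q + z *\<^sub>R r, s] :: real^4^4) = z * det (vector [p, q, r, s])"
proof -
  have lin: "minor (x *\<^sub>R p + y *\<^sub>R q + z *\<^sub>R r) s i j = x * minor p s i j + y * minor q s i j + z * minor r s i j" for i j
    by (simp add: minor_def algebra_simps)
  have "det (vector [p, q, p, s] :: real^4^4) = 0" "det (vector [p, q, q, s] :: real^4^4) = 0"
    unfolding det_Laplace minor_def by (simp_all add: algebra_simps)
  moreover have "det (vector [p, q, x *\<^sub>R p + y *\<^sub>R q + z *\<^sub>R r, s] :: real^4^4)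
     = x * det (vector [p, q, p, s]) + y * det (vector [p, q, q, s]) + z * det (vector [p, q, r, s])"
    unfolding det_Laplace lin by (simp add: algebra_simps)
  ultimately show ?thesis by simp
qed

section \<open>Barycentric coordinates of a skew quadrilateral\<close>

lemma hom_components [simp]: "hom x $ 1 = x $ 1" "hom x $ 2 = x $ 2" "hom x $ 3 = x $ 3" "hom x $ 4 = 1"
  by (simp_all add: hom_def)

lemma hom_inject [simp]: "hom x = hom y \<longleftrightarrow> x = y"
  by (auto simp: vec_eq_iff forall_3 forall_4)

lemma hom_nonzero [simp]: "hom x \<noteq> 0"
  by (metis hom_components(4) zero_index zero_neq_one)

definition comb :: "real^3 \<Rightarrow> real^3 \<Rightarrow> real^3 \<Rightarrow> real^3 \<Rightarrow> real \<Rightarrow> real \<Rightarrow> real \<Rightarrow> real \<Rightarrow> real^4" where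
  "comb a b c d \<alpha> \<beta> \<gamma> \<delta> = \<alpha> *\<^sub>R hom a + \<beta> *\<^sub>R hom b + \<gamma> *\<^sub>R hom c + \<delta> *\<^sub>R hom d"

definition skew :: "real^3 \<Rightarrow> real^3 \<Rightarrow> real^3 \<Rightarrow> real^3 \<Rightarrow> bool" where
  "skew a b c d \<longleftrightarrow> (\<forall>\<alpha> \<beta> \<gamma> \<delta>. comb a b c d \<alpha> \<beta> \<gamma> \<delta> = 0 \<longrightarrow> \<alpha> = 0 \<and> \<beta> = 0 \<and> \<gamma> = 0 \<and> \<delta> = 0)"

lemma comb_rotate: "comb b c d a \<beta> \<gamma> \<delta> \<alpha> = comb a b c d \<alpha> \<beta> \<gamma> \<delta>"
  by (simp add: comb_def)

lemma skew_rotate: "skew a b c d \<Longrightarrow> skew b c d a"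
  unfolding skew_def by (metis comb_rotate)

lemma comb_hom:
  "\<alpha> + \<beta> + \<gamma> + \<delta> = 1 \<Longrightarrow>
    comb a b c d \<alpha> \<beta> \<gamma> \<delta> = hom (\<alpha> *\<^sub>R a + \<beta> *\<^sub>R b + \<gamma> *\<^sub>R c + \<delta> *\<^sub>R d)"
  by (simp add: comb_def vec_eq_iff forall_4)

lemma comb_last: "comb a b c d \<alpha> \<beta> \<gamma> \<delta> $ 4 = \<alpha> + \<beta> + \<gamma> + \<delta>"
  by (simp add: comb_def)

lemma comb_scale: "r *\<^sub>R comb a b c d \<alpha> \<beta> \<gamma> \<delta> = comb a b c d (r * \<alpha>) (r * \<beta>) (r * \<gamma>) (r * \<delta>)"
  by (simp add: comb_def scaleR_add_right)

lemma comb_add: "comb a b c d \<alpha> \<beta> \<gamma> \<delta> + comb a b c d \<alpha>' \<beta>' \<gamma>' \<delta>'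
    = comb a b c d (\<alpha> + \<alpha>') (\<beta> + \<beta>') (\<gamma> + \<gamma>') (\<delta> + \<delta>')"
  by (simp add: comb_def scaleR_add_left)

text \<open>The forms \<open>A\<close>, \<open>B\<close>, \<open>C\<close>, \<open>E\<close> are the
  basis dual to \<open>hom a\<close>, \<open>hom b\<close>, \<open>hom c\<close>,
  \<open>hom d\<close>, so \<open>E\<close> belongs to \<open>d\<close>. Being linear on homogeneous
  coordinates they serve for points, where they sum to 1, and for directions, where they sum to
  0.\<close>

locale skew_quad =
  fixes a b c d :: "real^3" and A B C E :: "real^4 \<Rightarrow> real"
  assumes lin: "linear A" "linear B" "linear C" "linear E"
    and coord: "A (comb a b c d \<alpha> \<beta> \<gamma> \<delta>) = \<alpha>" "B (comb a b c d \<alpha> \<beta> \<gamma> \<delta>) = \<beta>"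
      "C (comb a b c d \<alpha> \<beta> \<gamma> \<delta>) = \<gamma>" "E (comb a b c d \<alpha> \<beta> \<gamma> \<delta>) = \<delta>"
    and comb_coord: "comb a b c d (A x) (B x) (C x) (E x) = x"

lemma skew_coordinates:
  assumes "skew a b c d"
  obtains A B C E where "skew_quad a b c d A B C E"
proof -
  define f where "f v = comb a b c d (v$1) (v$2) (v$3) (v$4)" for v :: "real^4"
  have lf: "linear f"
    by (rule linearI) (simp_all add: f_def comb_add comb_scale)
  have "inj f"
    unfolding linear_injective_0[OF lf]
  proof (intro allI impI)
    fix v assume "f v = 0"
    then have "v$1 = 0 \<and> v$2 = 0 \<and> v$3 = 0 \<and> v$4 = 0"
      using assms[unfolded skew_def, rule_format, of "v$1" "v$2" "v$3" "v$4"] by (simp add: f_def)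
    then show "v = 0" by (simp add: vec_eq_iff forall_4)
  qed
  then obtain g where g: "linear g" "\<And>x. g (f x) = x" "\<And>x. f (g x) = x"
    using linear_injective_isomorphism[OF lf] by blast
  have gc: "g (comb a b c d \<alpha> \<beta> \<gamma> \<delta>) = vector [\<alpha>, \<beta>, \<gamma>, \<delta>]" for \<alpha> \<beta> \<gamma> \<delta>
    using g(2)[of "vector [\<alpha>, \<beta>, \<gamma>, \<delta>]"] unfolding f_def vector_4 .
  have ln: "linear (\<lambda>x. g x $ i)" for i
    using linear_compose[OF g(1) bounded_linear.linear[OF bounded_linear_vec_nth]] by (simp add: o_def)
  have "skew_quad a b c d (\<lambda>x. g x $ 1) (\<lambda>x. g x $ 2) (\<lambda>x. g x $ 3) (\<lambda>x. g x $ 4)"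
  proof (rule skew_quad.intro)
    show "comb a b c d (g x $ 1) (g x $ 2) (g x $ 3) (g x $ 4) = x" for x
      using g(3)[of x] unfolding f_def .
  qed (simp_all only: ln gc vector_4)
  then show thesis by (rule that)
qed

section \<open>Patches in coordinates\<close>

definition patch :: "real \<Rightarrow> real^3 \<Rightarrow> real^3 \<Rightarrow> real^3 \<Rightarrow> real^3 \<Rightarrow> (real^3) set" where
  "patch k a b c d = {\<alpha> *\<^sub>R a + \<beta> *\<^sub>R b + \<gamma> *\<^sub>R c + \<delta> *\<^sub>R d | \<alpha> \<beta> \<gamma> \<delta>.
     0 \<le> \<alpha> \<and> 0 \<le> \<beta> \<and> 0 \<le> \<gamma> \<and> 0 \<le> \<delta> \<and> \<alpha> + \<beta> + \<gamma> + \<delta> = 1 \<and> \<alpha> * \<gamma> = k * (\<beta> * \<delta>)}"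

lemma patchI:
  "0 \<le> \<alpha> \<Longrightarrow> 0 \<le> \<beta> \<Longrightarrow> 0 \<le> \<gamma> \<Longrightarrow> 0 \<le> \<delta> \<Longrightarrow> \<alpha> + \<beta> + \<gamma> + \<delta> = 1 \<Longrightarrow> \<alpha> * \<gamma> = k * (\<beta> * \<delta>)
    \<Longrightarrow> x = \<alpha> *\<^sub>R a + \<beta> *\<^sub>R b + \<gamma> *\<^sub>R c + \<delta> *\<^sub>R d \<Longrightarrow> x \<in> patch k a b c d"
  unfolding patch_def by blast

lemma patchE:
  assumes "x \<in> patch k a b c d"
  obtains \<alpha> \<beta> \<gamma> \<delta> where "0 \<le> \<alpha>" "0 \<le> \<beta>" "0 \<le> \<gamma>" "0 \<le> \<delta>" "\<alpha> + \<beta> + \<gamma> + \<delta> = 1" "\<alpha> * \<gamma> = k * (\<beta> * \<delta>)"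
    "x = \<alpha> *\<^sub>R a + \<beta> *\<^sub>R b + \<gamma> *\<^sub>R c + \<delta> *\<^sub>R d"
  using assms unfolding patch_def by blast

lemma patch_reflect: "patch k a d c b = patch k a b c d"
proof -
  have "patch k a d c b \<subseteq> patch k a b c d" for a b c d
  proof
    fix x assume "x \<in> patch k a d c b"
    then obtain \<alpha> \<beta> \<gamma> \<delta> where "0 \<le> \<alpha>" "0 \<le> \<beta>" "0 \<le> \<gamma>" "0 \<le> \<delta>" "\<alpha> + \<beta> + \<gamma> + \<delta> = 1" "\<alpha> * \<gamma> = k * (\<beta> * \<delta>)"
    "x = \<alpha> *\<^sub>R a + \<beta> *\<^sub>R d + \<gamma> *\<^sub>R c + \<delta> *\<^sub>R b" by (rule patchE)
    then show "x \<in> patch k a b c d" by (intro patchI[of \<alpha> \<delta> \<gamma> \<beta>]) (auto simp: algebra_simps)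
  qed
  then show ?thesis by blast
qed

text \<open>The equation pairs a with c and b with d, so a shift by one vertex exchanges the two
  products and inverts k. In the logarithm of k this is the slope -1 along edges.\<close>

lemma patch_rotate:
  assumes "k > 0" shows "patch (1 / k) b c d a = patch k a b c d"
proof
  show "patch (1 / k) b c d a \<subseteq> patch k a b c d"
  proof
    fix x assume "x \<in> patch (1 / k) b c d a"
    then obtain \<alpha> \<beta> \<gamma> \<delta> where "0 \<le> \<alpha>" "0 \<le> \<beta>" "0 \<le> \<gamma>" "0 \<le> \<delta>" "\<alpha> + \<beta> + \<gamma> + \<delta> = 1" "\<alpha> * \<gamma> = 1 / k * (\<beta> * \<delta>)"
    "x = \<alpha> *\<^sub>R b + \<beta> *\<^sub>R c + \<gamma> *\<^sub>R d + \<delta> *\<^sub>R a" by (rule patchE)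
    then show "x \<in> patch k a b c d" using assms
      by (intro patchI[of \<delta> \<alpha> \<beta> \<gamma>]) (auto simp: field_simps)
  qed
  show "patch k a b c d \<subseteq> patch (1 / k) b c d a"
  proof
    fix x assume "x \<in> patch k a b c d"
    then obtain \<alpha> \<beta> \<gamma> \<delta> where "0 \<le> \<alpha>" "0 \<le> \<beta>" "0 \<le> \<gamma>" "0 \<le> \<delta>" "\<alpha> + \<beta> + \<gamma> + \<delta> = 1" "\<alpha> * \<gamma> = k * (\<beta> * \<delta>)"
    "x = \<alpha> *\<^sub>R a + \<beta> *\<^sub>R b + \<gamma> *\<^sub>R c + \<delta> *\<^sub>R d" by (rule patchE)
    then show "x \<in> patch (1 / k) b c d a" using assms
      by (intro patchI[of \<beta> \<gamma> \<delta> \<alpha>]) (auto simp: field_simps)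
  qed
qed

definition patch_weight :: "real \<Rightarrow> real \<Rightarrow> real \<Rightarrow> real" where
  "patch_weight k u v = k * (1 - u) * (1 - v) + u * (1 - v) + u * v + (1 - u) * v"

text \<open>The rational bilinear (Bezier) patch with weight k at a and weight 1 at the other
  corners; \<open>patch_weight\<close> is its denominator.\<close>

definition patch_param :: "real^3 \<Rightarrow> real^3 \<Rightarrow> real^3 \<Rightarrow> real^3 \<Rightarrow> real \<Rightarrow> real \<times> real \<Rightarrow> real^3" where
  "patch_param a b c d k = (\<lambda>(u,v). (1 / patch_weight k u v) *\<^sub>R
     ((k * (1 - u) * (1 - v)) *\<^sub>R a + (u * (1 - v)) *\<^sub>R b + (u * v) *\<^sub>R c + ((1 - u) * v) *\<^sub>R d))"

lemma patch_weight_pos: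
  assumes "k > 0" "u \<in> {0..1}" "v \<in> {0..1}"
  shows "patch_weight k u v > 0"
proof -
  have "patch_weight k u v = k * ((1 - u) * (1 - v)) + (1 - (1 - u) * (1 - v))"
    by (simp add: patch_weight_def algebra_simps)
  moreover have "0 \<le> (1 - u) * (1 - v)" "(1 - u) * (1 - v) \<le> 1"
    using assms by (auto intro: mult_le_one)
  moreover have "k * w + (1 - w) > 0" if "0 \<le> w" "w \<le> 1" for w
    using that assms(1) by (cases "w = 0") (auto intro: add_pos_nonneg)
  ultimately show ?thesis by simp
qed

lemma patch_param_image:
  assumes k: "k > 0"
  shows "patch_param a b c d k ` unit_square = patch k a b c d"
proof
  show "patch_param a b c d k ` unit_square \<subseteq> patch k a b c d"
  proof clarify
    fix u v :: real assume uv: "u \<in> {0..1}" "v \<in> {0..1}"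
    define W where "W = patch_weight k u v"
    have W: "W > 0" using patch_weight_pos[OF k uv] by (simp add: W_def)
    show "patch_param a b c d k (u, v) \<in> patch k a b c d"
    proof (rule patchI)
      show "patch_param a b c d k (u, v) = (k * (1 - u) * (1 - v) / W) *\<^sub>R a + (u * (1 - v) / W) *\<^sub>R b
          + (u * v / W) *\<^sub>R c + ((1 - u) * v / W) *\<^sub>R d"
        by (simp add: patch_param_def W_def scaleR_add_right)
      have "k * (1 - u) * (1 - v) / W + u * (1 - v) / W + u * v / W + (1 - u) * v / W
        = (k * (1 - u) * (1 - v) + u * (1 - v) + u * v + (1 - u) * v) / W"
        by (simp only: add_divide_distrib)
      also have "\<dots> = 1" using W by (simp add: W_def patch_weight_def)
      finally show "k * (1 - u) * (1 - v) / W + u * (1 - v) / W + u * v / W + (1 - u) * v / W = 1" .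
      show "k * (1 - u) * (1 - v) / W * (u * v / W) = k * (u * (1 - v) / W * ((1 - u) * v / W))" by simp
    qed (use k uv W in auto)
  qed
  show "patch k a b c d \<subseteq> patch_param a b c d k ` unit_square"
  proof
    fix x assume "x \<in> patch k a b c d"
    then obtain \<alpha> \<beta> \<gamma> \<delta> where h: "0 \<le> \<alpha>" "0 \<le> \<beta>" "0 \<le> \<gamma>" "0 \<le> \<delta>" "\<alpha> + \<beta> + \<gamma> + \<delta> = 1" "\<alpha> * \<gamma> = k * (\<beta> * \<delta>)"
      "x = \<alpha> *\<^sub>R a + \<beta> *\<^sub>R b + \<gamma> *\<^sub>R c + \<delta> *\<^sub>R d" by (rule patchE)
    \<comment> \<open>Inverse of the parametrization: 1 - u : u equals \<alpha> : k \<beta> as well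
      as \<delta> : \<gamma>, and 1 - v : v equals \<alpha> : k \<delta> as well as \<beta> :
      \<gamma>. The mediants of these ratios stay defined when one of them becomes 0 : 0.\<close>
    define s0 s1 t0 t1 where "s0 = \<alpha> + k * \<delta>" and "s1 = k * (\<beta> + \<gamma>)" and "t0 = \<alpha> + k * \<beta>" and "t1 = k * (\<delta> + \<gamma>)"
    define T where "T = \<alpha> + k * (\<beta> + \<gamma> + \<delta>)"
    have T: "T > 0"
    proof (cases "\<alpha> > 0")
      case False
      then have "\<beta> + \<gamma> + \<delta> = 1" using h by linarith
      then show ?thesis using k h by (simp add: T_def)
    qed (use h k in \<open>auto simp: T_def intro: add_pos_nonneg\<close>)
    have sT: "s0 + s1 = T" "t0 + t1 = T" by (simp_all add: s0_def s1_def t0_def t1_def T_def algebra_simps)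
    have nn: "s0 \<ge> 0" "s1 \<ge> 0" "t0 \<ge> 0" "t1 \<ge> 0" using h k by (auto simp: s0_def s1_def t0_def t1_def)
    have id: "k * (s0 * t0) = k * T * \<alpha>" "s1 * t0 = k * T * \<beta>" "s1 * t1 = k * T * \<gamma>" "s0 * t1 = k * T * \<delta>"
    proof -
      have "s0 * t0 = \<alpha> * \<alpha> + k * (\<alpha> * \<beta>) + k * (\<alpha> * \<delta>) + k * (k * (\<beta> * \<delta>))" by (simp add: s0_def t0_def algebra_simps)
      also have "\<dots> = T * \<alpha>" unfolding h(6)[symmetric] by (simp add: T_def algebra_simps)
      finally show "k * (s0 * t0) = k * T * \<alpha>" by simp
      have "s1 * t0 = k * (\<alpha> * \<beta> + \<alpha> * \<gamma> + k * (\<beta> * \<beta>) + k * (\<beta> * \<gamma>))" by (simp add: s1_def t0_def algebra_simps)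
      then show "s1 * t0 = k * T * \<beta>" unfolding h(6) by (simp add: T_def algebra_simps)
      have "s0 * t1 = k * (\<alpha> * \<delta> + \<alpha> * \<gamma> + k * (\<delta> * \<delta>) + k * (\<delta> * \<gamma>))" by (simp add: s0_def t1_def algebra_simps)
      then show "s0 * t1 = k * T * \<delta>" unfolding h(6) by (simp add: T_def algebra_simps)
      have "s1 * t1 = k * (k * (\<beta> * \<delta>) + k * (\<beta> * \<gamma> + \<gamma> * \<gamma> + \<delta> * \<gamma>))" by (simp add: s1_def t1_def algebra_simps)
      then show "s1 * t1 = k * T * \<gamma>" unfolding h(6)[symmetric] by (simp add: T_def algebra_simps)
    qed
    define u v where "u = s1 / T" and "v = t1 / T"
    have uv: "1 - u = s0 / T" "1 - v = t0 / T" using sT T by (simp_all add: u_def v_def field_simps)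
    have sq: "(u,v) \<in> unit_square" using nn sT T by (auto simp: u_def v_def field_simps)
    have sh: "k * (1 - u) * (1 - v) = (k / T) * \<alpha>" "u * (1 - v) = (k / T) * \<beta>" "(1 - u) * v = (k / T) * \<delta>"
      "u * v = (k / T) * \<gamma>"
    proof -
      have "k * (1 - u) * (1 - v) = k * (s0 * t0) / (T * T)" unfolding uv by simp
      then show "k * (1 - u) * (1 - v) = (k / T) * \<alpha>" unfolding id using T by simp
      have "u * (1 - v) = s1 * t0 / (T * T)" unfolding uv u_def by simp
      then show "u * (1 - v) = (k / T) * \<beta>" unfolding id using T by simp
      have "(1 - u) * v = s0 * t1 / (T * T)" unfolding uv v_def by simp
      then show "(1 - u) * v = (k / T) * \<delta>" unfolding id using T by simp
      have "u * v = s1 * t1 / (T * T)" unfolding u_def v_def by simp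
      then show "u * v = (k / T) * \<gamma>" unfolding id using T by simp
    qed
    have "patch_weight k u v = (k / T) * (\<alpha> + \<beta> + \<gamma> + \<delta>)"
      unfolding patch_weight_def sh by (simp add: distrib_left)
    then have w: "patch_weight k u v = k / T" using h(5) by simp
    have "patch_param a b c d k (u,v) = x"
      unfolding patch_param_def prod.case w sh h(7) using T k by (simp add: scaleR_add_right)
    then show "x \<in> patch_param a b c d k ` unit_square" using sq by (metis imageI)
  qed
qed

text \<open>Up to positive scaling and the edge direction \<open>b - a\<close>, the only tangent direction of the patch at
  a point of the edge \<open>ab\<close>: that of the line of the other regulus.\<close>

definition ruling :: "real \<Rightarrow> real \<Rightarrow> real^3 \<Rightarrow> real^3 \<Rightarrow> real^3 \<Rightarrow> real^3 \<Rightarrow> real^3" where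
  "ruling k \<tau> a b c d = (k * \<tau>) *\<^sub>R c + (1 - \<tau>) *\<^sub>R d - (k * \<tau> + (1 - \<tau>)) *\<^sub>R ((1 - \<tau>) *\<^sub>R a + \<tau> *\<^sub>R b)"

lemma ruling_weight_pos: "k > 0 \<Longrightarrow> 0 \<le> \<tau> \<Longrightarrow> \<tau> \<le> 1 \<Longrightarrow> k * \<tau> + (1 - \<tau>) > (0::real)"
  by (cases "\<tau> = 0") (auto intro: add_pos_nonneg)

section \<open>Tangent vectors of a patch at the points of an edge\<close>

lemma tangent_vector_line:
  assumes "\<And>t. t \<in> {0..1} \<Longrightarrow> p + t *\<^sub>R u \<in> M"
  shows "u \<in> tangent_vectors M p"
  unfolding tangent_vectors_def
proof (intro CollectI exI conjI)
  show "(\<lambda>t. p + t *\<^sub>R u) ` {0..1} \<subseteq> M" using assms by blast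
  show "((\<lambda>t. p + t *\<^sub>R u) has_vector_derivative u) (at 0 within {0..1})"
    by (auto intro!: derivative_eq_intros)
qed simp

lemma nonneg_derivative:
  fixes f :: "real \<Rightarrow> real"
  assumes "(f has_vector_derivative f') (at 0 within {0..1})" "f 0 = 0" "\<And>t. t \<in> {0..1} \<Longrightarrow> f t \<ge> 0"
  shows "f' \<ge> 0"
proof -
  have "((\<lambda>t. (f t - f 0) / (t - 0)) \<longlongrightarrow> f') (at 0 within {0..1})"
    using assms(1) unfolding has_real_derivative_iff_has_vector_derivative[symmetric]
    by (simp add: has_field_derivative_iff)
  moreover have "\<forall>\<^sub>F t in at 0 within {0..1}. 0 \<le> (f t - f 0) / (t - 0)"
    unfolding eventually_at_filter using assms(2,3) by (auto intro!: always_eventually)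
  moreover have "at (0::real) within {0..1} \<noteq> bot"
    by (simp add: trivial_limit_within islimpt_Icc)
  ultimately show ?thesis by (rule tendsto_lowerbound)
qed

context skew_quad
begin

text \<open>Linear parts of the affine functions x \<mapsto> A (hom x) and so on: the coordinates of
  directions, and the derivatives of the point coordinates along curves.\<close>

definition A0 where "A0 u = A (hom u - hom 0)"
definition B0 where "B0 u = B (hom u - hom 0)"
definition C0 where "C0 u = C (hom u - hom 0)"
definition E0 where "E0 u = E (hom u - hom 0)"

lemma linear_hom_diff: "linear (\<lambda>u. hom u - hom 0)"
  by (rule linearI) (simp_all add: vec_eq_iff forall_4)

lemma lin0: "linear A0" "linear B0" "linear C0" "linear E0"
proof -
  have "A0 = A \<circ> (\<lambda>u. hom u - hom 0)" "B0 = B \<circ> (\<lambda>u. hom u - hom 0)"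
    "C0 = C \<circ> (\<lambda>u. hom u - hom 0)" "E0 = E \<circ> (\<lambda>u. hom u - hom 0)"
    by (simp_all add: fun_eq_iff A0_def B0_def C0_def E0_def)
  then show "linear A0" "linear B0" "linear C0" "linear E0"
    using linear_compose[OF linear_hom_diff] lin by simp_all
qed

lemma direction: "A0 u *\<^sub>R a + B0 u *\<^sub>R b + C0 u *\<^sub>R c + E0 u *\<^sub>R d = u"
  and direction_sum: "A0 u + B0 u + C0 u + E0 u = 0"
proof -
  have "comb a b c d (A0 u) (B0 u) (C0 u) (E0 u) = hom u - hom 0"
    unfolding A0_def B0_def C0_def E0_def by (rule comb_coord)
  then show "A0 u *\<^sub>R a + B0 u *\<^sub>R b + C0 u *\<^sub>R c + E0 u *\<^sub>R d = u" "A0 u + B0 u + C0 u + E0 u = 0"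
    by (simp_all add: comb_def vec_eq_iff forall_3 forall_4)
qed

lemma coord_sum: "A (hom x) + B (hom x) + C (hom x) + E (hom x) = 1"
  using comb_last[of a b c d "A (hom x)" "B (hom x)" "C (hom x)" "E (hom x)"] by (simp add: comb_coord)

lemma coord_point: "\<alpha> + \<beta> + \<gamma> + \<delta> = 1 \<Longrightarrow> x = \<alpha> *\<^sub>R a + \<beta> *\<^sub>R b + \<gamma> *\<^sub>R c + \<delta> *\<^sub>R d \<Longrightarrow>
    A (hom x) = \<alpha> \<and> B (hom x) = \<beta> \<and> C (hom x) = \<gamma> \<and> E (hom x) = \<delta>"
  by (metis comb_hom coord)

lemma point_coord: "x = A (hom x) *\<^sub>R a + B (hom x) *\<^sub>R b + C (hom x) *\<^sub>R c + E (hom x) *\<^sub>R d"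
  by (metis comb_hom comb_coord coord_sum hom_inject)

lemma coord0_direction: "\<alpha> + \<beta> + \<gamma> + \<delta> = 0 \<Longrightarrow> u = \<alpha> *\<^sub>R a + \<beta> *\<^sub>R b + \<gamma> *\<^sub>R c + \<delta> *\<^sub>R d \<Longrightarrow>
    A0 u = \<alpha> \<and> B0 u = \<beta> \<and> C0 u = \<gamma> \<and> E0 u = \<delta>"
proof -
  assume h: "\<alpha> + \<beta> + \<gamma> + \<delta> = 0" "u = \<alpha> *\<^sub>R a + \<beta> *\<^sub>R b + \<gamma> *\<^sub>R c + \<delta> *\<^sub>R d"
  then have "hom u - hom 0 = comb a b c d \<alpha> \<beta> \<gamma> \<delta>"
    by (simp add: comb_def vec_eq_iff forall_4)
  then show ?thesis by (simp add: A0_def B0_def C0_def E0_def coord)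
qed

lemma mem_patch:
  "x \<in> patch k a b c d \<longleftrightarrow> 0 \<le> A (hom x) \<and> 0 \<le> B (hom x) \<and> 0 \<le> C (hom x) \<and> 0 \<le> E (hom x) \<and>
     A (hom x) * C (hom x) = k * (B (hom x) * E (hom x))"
proof
  assume "x \<in> patch k a b c d"
  then show "0 \<le> A (hom x) \<and> 0 \<le> B (hom x) \<and> 0 \<le> C (hom x) \<and> 0 \<le> E (hom x) \<and>
     A (hom x) * C (hom x) = k * (B (hom x) * E (hom x))"
    by (rule patchE) (use coord_point in metis)
qed (use coord_sum point_coord in \<open>blast intro: patchI\<close>)

lemma patch_inject:
  assumes "k > 0" "patch k a b c d = patch k' a b c d"
  shows "k = k'"
proof -
  \<comment> \<open>The point with coordinates proportional to k, 1, 1, 1 is the centre u = v = 1/2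
    of the rational parametrization. All its coordinates are positive, so k can be read off.\<close>
  define W where "W = k + 3"
  define x where "x = (k / W) *\<^sub>R a + (1 / W) *\<^sub>R b + (1 / W) *\<^sub>R c + (1 / W) *\<^sub>R d"
  have W: "W > 0" using assms(1) by (simp add: W_def)
  have "k / W + 1 / W + 1 / W + 1 / W = (k + 3) / W" by (simp add: add_divide_distrib)
  then have s: "k / W + 1 / W + 1 / W + 1 / W = 1" using W by (simp add: W_def)
  have c: "A (hom x) = k / W" "B (hom x) = 1 / W" "C (hom x) = 1 / W" "E (hom x) = 1 / W"
    using coord_point[OF s x_def] by auto
  have "x \<in> patch k a b c d" unfolding mem_patch c using assms(1) W by simp
  then have "x \<in> patch k' a b c d" using assms(2) by simp
  then have "k / W * (1 / W) = k' * (1 / W * (1 / W))" unfolding mem_patch c by blast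
  then show ?thesis using W by (simp add: field_simps)
qed

lemma coord0_ruling: "C0 (ruling k \<tau> a b c d) = k * \<tau>" "E0 (ruling k \<tau> a b c d) = 1 - \<tau>"
    "C0 (b - a) = 0" "E0 (b - a) = 0"
proof -
  let ?s = "k * \<tau> + (1 - \<tau>)"
  have "A0 (ruling k \<tau> a b c d) = - ?s * (1 - \<tau>) \<and> B0 (ruling k \<tau> a b c d) = - ?s * \<tau> \<and>
     C0 (ruling k \<tau> a b c d) = k * \<tau> \<and> E0 (ruling k \<tau> a b c d) = 1 - \<tau>"
  proof (rule coord0_direction)
    show "ruling k \<tau> a b c d = (- ?s * (1 - \<tau>)) *\<^sub>R a + (- ?s * \<tau>) *\<^sub>R b + (k * \<tau>) *\<^sub>R c + (1 - \<tau>) *\<^sub>R d"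
      by (simp add: ruling_def vec_eq_iff algebra_simps)
  qed (simp add: algebra_simps)
  then show "C0 (ruling k \<tau> a b c d) = k * \<tau>" "E0 (ruling k \<tau> a b c d) = 1 - \<tau>" by auto
  have "A0 (b - a) = -1 \<and> B0 (b - a) = 1 \<and> C0 (b - a) = 0 \<and> E0 (b - a) = 0"
    by (rule coord0_direction) auto
  then show "C0 (b - a) = 0" "E0 (b - a) = 0" by auto
qed

text \<open>\<open>C0\<close> and \<open>E0\<close> are coordinates on the quotient of directions by
  b - a. Tangent planes through the edge become lines in this two-dimensional quotient.\<close>

lemma direction_eqI:
  assumes "C0 u = C0 w" "E0 u = E0 w"
  shows "\<exists>\<nu>. u = w + \<nu> *\<^sub>R (b - a)"
proof -
  have "B0 (u - w) = - A0 (u - w)" "C0 (u - w) = 0" "E0 (u - w) = 0"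
    using direction_sum[of "u - w"] assms lin0 by (auto simp: linear_diff)
  then have "u - w = B0 (u - w) *\<^sub>R (b - a)"
    using direction[of "u - w"] by (simp add: algebra_simps)
  then show ?thesis by (metis add.commute diff_add_cancel)
qed

context
  fixes k \<tau> :: real and p :: "real^3"
  assumes k: "k > 0" and \<tau>: "0 \<le> \<tau>" "\<tau> \<le> 1" and p: "p = (1 - \<tau>) *\<^sub>R a + \<tau> *\<^sub>R b"
begin

lemma coord_p: "A (hom p) = 1 - \<tau>" "B (hom p) = \<tau>" "C (hom p) = 0" "E (hom p) = 0"
  using coord_point[of "1 - \<tau>" \<tau> 0 0 p] p by auto

text \<open>Along a curve in the patch the derivative of A C - k B E vanishes; at p, where C and E
  are 0, this reads (1 - \<tau>) C0 u = k \<tau> E0 u. Nonnegativity of C and E on the curve gives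
  the sign of l.\<close>

lemma tangent_vectors_patch_subset:
  assumes "u \<in> tangent_vectors (patch k a b c d) p"
  obtains l m where "l \<ge> 0" "u = l *\<^sub>R ruling k \<tau> a b c d + m *\<^sub>R (b - a)"
proof -
  obtain \<gamma> where \<gamma>: "\<gamma> 0 = p" "\<gamma> ` {0..1} \<subseteq> patch k a b c d"
    "(\<gamma> has_vector_derivative u) (at 0 within {0..1})"
    using assms unfolding tangent_vectors_def by blast
  have der: "((\<lambda>t. F (hom (\<gamma> t))) has_vector_derivative F (hom u - hom 0)) (at 0 within {0..1})"
    if "linear F" for F :: "real^4 \<Rightarrow> real"
  proof -
    have bl: "bounded_linear (\<lambda>u. F (hom u - hom 0))"
      using linear_compose[OF linear_hom_diff that] by (simp add: o_def linear_conv_bounded_linear)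
    have "((\<lambda>t. F (hom (\<gamma> t) - hom 0) + F (hom 0)) has_vector_derivative F (hom u - hom 0)) (at 0 within {0..1})"
      using bounded_linear.has_vector_derivative[OF bl \<gamma>(3)] by (auto intro!: derivative_eq_intros)
    then show ?thesis using that by (simp add: linear_diff)
  qed
  have mem: "0 \<le> A (hom (\<gamma> t)) \<and> 0 \<le> B (hom (\<gamma> t)) \<and> 0 \<le> C (hom (\<gamma> t)) \<and> 0 \<le> E (hom (\<gamma> t)) \<and>
     A (hom (\<gamma> t)) * C (hom (\<gamma> t)) = k * (B (hom (\<gamma> t)) * E (hom (\<gamma> t)))" if "t \<in> {0..1}" for t
    using \<gamma>(2) that mem_patch by blast
  note at0 = coord_p[folded \<gamma>(1)]
  have C: "C0 u \<ge> 0" and E: "E0 u \<ge> 0"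
    using nonneg_derivative[OF der[OF lin(3)]] nonneg_derivative[OF der[OF lin(4)]] mem at0
    by (auto simp: C0_def E0_def)
  have zero: "A (hom (\<gamma> t)) * C (hom (\<gamma> t)) - k * (B (hom (\<gamma> t)) * E (hom (\<gamma> t))) = 0" if "t \<in> {0..1}" for t
    using mem[OF that] by simp
  let ?f = "\<lambda>t. A (hom (\<gamma> t)) * C (hom (\<gamma> t)) - k * (B (hom (\<gamma> t)) * E (hom (\<gamma> t)))"
  have "(?f has_vector_derivative (1 - \<tau>) * C0 u - k * (\<tau> * E0 u)) (at 0 within {0..1})"
    using der[OF lin(1)] der[OF lin(2)] der[OF lin(3)] der[OF lin(4)]
    unfolding has_real_derivative_iff_has_vector_derivative[symmetric]
    by (auto intro!: derivative_eq_intros simp: at0 C0_def E0_def)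
  moreover have "(?f has_vector_derivative 0) (at 0 within {0..1})"
    by (rule has_vector_derivative_transform[where f = "\<lambda>t. 0"]) (auto simp: zero)
  ultimately have eq: "(1 - \<tau>) * C0 u = k * \<tau> * E0 u"
    using vector_derivative_unique_within[of 0 "{0..1}" ?f] by (force simp: trivial_limit_within islimpt_Icc)
  let ?s = "k * \<tau> + (1 - \<tau>)"
  have s: "?s > 0" using ruling_weight_pos[OF k \<tau>] .
  \<comment> \<open>On the ruling C0 + E0 equals k \<tau> + (1 - \<tau>), so this quotient is the
    only possible multiple.\<close>
  define l where "l = (C0 u + E0 u) / ?s"
  have "C0 (l *\<^sub>R ruling k \<tau> a b c d) = l * (k * \<tau>)" "E0 (l *\<^sub>R ruling k \<tau> a b c d) = l * (1 - \<tau>)"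
    using lin0 by (simp_all add: linear_scale coord0_ruling)
  moreover have "(C0 u + E0 u) * (k * \<tau>) = C0 u * ?s" "(C0 u + E0 u) * (1 - \<tau>) = E0 u * ?s"
    using eq by (simp_all add: algebra_simps)
  then have "l * (k * \<tau>) = C0 u" "l * (1 - \<tau>) = E0 u"
    using s unfolding l_def by (simp_all add: nonzero_divide_eq_eq)
  ultimately obtain m where "u = l *\<^sub>R ruling k \<tau> a b c d + m *\<^sub>R (b - a)"
    using direction_eqI[of u "l *\<^sub>R ruling k \<tau> a b c d"] by auto
  moreover have "l \<ge> 0" using C E s by (simp add: l_def)
  ultimately show thesis using that by blast
qed

text \<open>The line of the other regulus through p runs inside the patch to a point of the edge cd;
  the factor in front makes it arrive there at time 1.\<close>

lemma ruling_tangent: "(1 / (k * \<tau> + (1 - \<tau>))) *\<^sub>R ruling k \<tau> a b c d \<in> tangent_vectors (patch k a b c d) p"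
proof (rule tangent_vector_line)
  fix t :: real assume t: "t \<in> {0..1}"
  let ?s = "k * \<tau> + (1 - \<tau>)"
  have s: "?s > 0" using ruling_weight_pos[OF k \<tau>] .
  define x y where "x = k * \<tau> / ?s" and "y = (1 - \<tau>) / ?s"
  have R: "(1 / ?s) *\<^sub>R ruling k \<tau> a b c d = x *\<^sub>R c + y *\<^sub>R d - p"
    using s unfolding ruling_def p[symmetric] x_def y_def by (simp add: scaleR_add_right scaleR_diff_right)
  have eq: "p + t *\<^sub>R (1 / ?s) *\<^sub>R ruling k \<tau> a b c d = ((1 - t) * (1 - \<tau>)) *\<^sub>R a + ((1 - t) * \<tau>) *\<^sub>R b
      + (t * x) *\<^sub>R c + (t * y) *\<^sub>R d"
    unfolding R unfolding p by (simp add: vec_eq_iff algebra_simps)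
  have "x + y = 1" using s by (simp add: x_def y_def add_divide_distrib[symmetric])
  then have sum: "t * x + t * y = t" by (metis distrib_left mult.right_neutral)
  have nn: "0 \<le> x" "0 \<le> y" using k \<tau> s by (simp_all add: x_def y_def)
  show "p + t *\<^sub>R (1 / ?s) *\<^sub>R ruling k \<tau> a b c d \<in> patch k a b c d"
  proof (rule patchI[OF _ _ _ _ _ _ eq])
    show "(1 - t) * (1 - \<tau>) + (1 - t) * \<tau> + t * x + t * y = 1"
      using sum by (simp add: algebra_simps)
    show "(1 - t) * (1 - \<tau>) * (t * x) = k * ((1 - t) * \<tau> * (t * y))"
      by (simp add: x_def y_def)
  qed (use t \<tau> k nn in auto)
qed

text \<open>At an end of the edge only one direction along it is tangential to the patch. The
  vectors from p to b and from p to a always are, possibly as the zero vector, and their difference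
  is b - a.\<close>

lemma edge_tangent: "b - a \<in> tangent_space (patch k a b c d) p"
proof -
  have "(1 - \<tau>) *\<^sub>R (b - a) \<in> tangent_vectors (patch k a b c d) p"
  proof (rule tangent_vector_line)
    fix t :: real assume t: "t \<in> {0..1}"
    show "p + t *\<^sub>R (1 - \<tau>) *\<^sub>R (b - a) \<in> patch k a b c d"
    proof (rule patchI[of "(1 - \<tau>) * (1 - t)" "\<tau> + t * (1 - \<tau>)" 0 0])
      show "p + t *\<^sub>R (1 - \<tau>) *\<^sub>R (b - a) = ((1 - \<tau>) * (1 - t)) *\<^sub>R a + (\<tau> + t * (1 - \<tau>)) *\<^sub>R b + 0 *\<^sub>R c + 0 *\<^sub>R d"
        unfolding p by (simp add: vec_eq_iff algebra_simps)
      show "(1 - \<tau>) * (1 - t) + (\<tau> + t * (1 - \<tau>)) + 0 + 0 = 1" by (simp add: algebra_simps)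
    qed (use t \<tau> in auto)
  qed
  moreover have "(- \<tau>) *\<^sub>R (b - a) \<in> tangent_vectors (patch k a b c d) p"
  proof (rule tangent_vector_line)
    fix t :: real assume t: "t \<in> {0..1}"
    have tt: "t * \<tau> \<le> \<tau>" using t \<tau> by (simp add: mult_left_le_one_le)
    show "p + t *\<^sub>R (- \<tau>) *\<^sub>R (b - a) \<in> patch k a b c d"
    proof (rule patchI[of "1 - \<tau> + t * \<tau>" "\<tau> - t * \<tau>" 0 0])
      show "p + t *\<^sub>R (- \<tau>) *\<^sub>R (b - a) = (1 - \<tau> + t * \<tau>) *\<^sub>R a + (\<tau> - t * \<tau>) *\<^sub>R b + 0 *\<^sub>R c + 0 *\<^sub>R d"
        unfolding p by (simp add: algebra_simps)
    qed (use t \<tau> tt in auto)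
  qed
  ultimately have "(1 - \<tau>) *\<^sub>R (b - a) - (- \<tau>) *\<^sub>R (b - a) \<in> tangent_space (patch k a b c d) p"
    unfolding tangent_space_def by (intro span_diff span_base)
  moreover have "(1 - \<tau>) *\<^sub>R (b - a) - (- \<tau>) *\<^sub>R (b - a) = b - a"
    by (simp add: algebra_simps)
  ultimately show ?thesis by simp
qed

lemma tangent_space_patch: "tangent_space (patch k a b c d) p = span {b - a, ruling k \<tau> a b c d}"
proof
  show "tangent_space (patch k a b c d) p \<subseteq> span {b - a, ruling k \<tau> a b c d}"
    unfolding tangent_space_def
  proof (rule span_minimal)
    show "tangent_vectors (patch k a b c d) p \<subseteq> span {b - a, ruling k \<tau> a b c d}"
    proof
      fix u assume "u \<in> tangent_vectors (patch k a b c d) p"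
      then obtain l m where "u = l *\<^sub>R ruling k \<tau> a b c d + m *\<^sub>R (b - a)"
        using tangent_vectors_patch_subset by metis
      moreover have "l *\<^sub>R ruling k \<tau> a b c d + m *\<^sub>R (b - a) \<in> span {b - a, ruling k \<tau> a b c d}"
        by (intro span_add span_scale span_base) auto
      ultimately show "u \<in> span {b - a, ruling k \<tau> a b c d}" by simp
    qed
  qed simp
  let ?s = "k * \<tau> + (1 - \<tau>)"
  have s: "?s > 0" using ruling_weight_pos[OF k \<tau>] .
  have "?s *\<^sub>R (1 / ?s) *\<^sub>R ruling k \<tau> a b c d \<in> tangent_space (patch k a b c d) p"
    unfolding tangent_space_def by (intro span_scale span_base ruling_tangent)
  then have "ruling k \<tau> a b c d \<in> tangent_space (patch k a b c d) p" using s by simp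
  then show "span {b - a, ruling k \<tau> a b c d} \<subseteq> tangent_space (patch k a b c d) p"
    using edge_tangent unfolding tangent_space_def by (intro span_minimal) auto
qed

end

end

section \<open>Smooth joints\<close>

text \<open>\<open>z\<close> and \<open>z'\<close> are the components of d' and c' transverse to the
  edge ab, measured by d in the plane of a, b, d and by c in the plane of a, b, c. A negative sign
  means opposite sides of the line ab in that plane.\<close>

locale adjacent_quads = skew_quad +
  fixes c' d' :: "real^3" and x y z x' y' z' k k' :: real
  assumes d': "d' = x *\<^sub>R a + y *\<^sub>R b + z *\<^sub>R d" "x + y + z = 1"
    and c': "c' = x' *\<^sub>R a + y' *\<^sub>R b + z' *\<^sub>R c" "x' + y' + z' = 1"
    and skew': "skew a b c' d'" and k: "k > 0" "k' > 0"
begin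

lemma z_nonzero: "z \<noteq> 0" "z' \<noteq> 0"
proof -
  have ne: "\<not> skew a b c' d'" if "comb a b c' d' \<alpha> \<beta> \<gamma> \<delta> = 0" "\<gamma> \<noteq> 0 \<or> \<delta> \<noteq> 0" for \<alpha> \<beta> \<gamma> \<delta>
    using that unfolding skew_def by blast
  have "comb a b c' d' x y 0 (- 1) = 0" if "z = 0"
    using that d' by (simp add: comb_def vec_eq_iff forall_3 forall_4)
  then show "z \<noteq> 0" using ne[of x y 0 "-1"] skew' by auto
  have "comb a b c' d' x' y' (- 1) 0 = 0" if "z' = 0"
    using that c' by (simp add: comb_def vec_eq_iff forall_3 forall_4)
  then show "z' \<noteq> 0" using ne[of x' y' "-1" 0] skew' by auto
qed

text \<open>Together with \<open>coord0_ruling\<close> this compares the two rulings modulo b - a.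
  For 0 < \<tau> < 1 they are proportional iff k z = k' z', a condition free of \<tau>, so one inner
  point of the edge decides about the whole edge.\<close>

lemma coord0_ruling': "C0 (ruling k' \<tau> a b c' d') = k' * \<tau> * z'" "E0 (ruling k' \<tau> a b c' d') = (1 - \<tau>) * z"
proof -
  let ?s = "k' * \<tau> + (1 - \<tau>)"
  have "A0 (ruling k' \<tau> a b c' d') = k' * \<tau> * x' + (1 - \<tau>) * x - ?s * (1 - \<tau>) \<and>
     B0 (ruling k' \<tau> a b c' d') = k' * \<tau> * y' + (1 - \<tau>) * y - ?s * \<tau> \<and>
     C0 (ruling k' \<tau> a b c' d') = k' * \<tau> * z' \<and> E0 (ruling k' \<tau> a b c' d') = (1 - \<tau>) * z"
  proof (rule coord0_direction)
    show "ruling k' \<tau> a b c' d' = (k' * \<tau> * x' + (1 - \<tau>) * x - ?s * (1 - \<tau>)) *\<^sub>R a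
       + (k' * \<tau> * y' + (1 - \<tau>) * y - ?s * \<tau>) *\<^sub>R b + (k' * \<tau> * z') *\<^sub>R c + ((1 - \<tau>) * z) *\<^sub>R d"
      by (simp add: ruling_def c' d' vec_eq_iff algebra_simps)
    have "k' * \<tau> * x' + k' * \<tau> * y' + k' * \<tau> * z' = k' * \<tau>"
      by (metis c'(2) distrib_left mult.right_neutral)
    moreover have "(1 - \<tau>) * x + (1 - \<tau>) * y + (1 - \<tau>) * z = 1 - \<tau>"
      by (metis d'(2) distrib_left mult.right_neutral)
    moreover have "?s * (1 - \<tau>) + ?s * \<tau> = ?s" by (simp add: distrib_left[symmetric])
    ultimately show "k' * \<tau> * x' + (1 - \<tau>) * x - ?s * (1 - \<tau>) + (k' * \<tau> * y' + (1 - \<tau>) * y - ?s * \<tau>)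
      + k' * \<tau> * z' + (1 - \<tau>) * z = 0" by linarith
  qed
  then show "C0 (ruling k' \<tau> a b c' d') = k' * \<tau> * z'" "E0 (ruling k' \<tau> a b c' d') = (1 - \<tau>) * z" by auto
qed

lemma edge_nonzero: "b - a \<noteq> 0"
proof
  assume "b - a = 0"
  then have "comb a b c d 1 (-1) 0 0 = 0" by (simp add: comb_def)
  then have "A 0 = 1" by (metis coord(1))
  then show False using lin by (simp add: linear_0)
qed

text \<open>The second ruling is s times the first modulo b - a, and comparing \<open>C0\<close> and
  \<open>E0\<close> gives k' z' = s k and z = s. The vector n is nonnegative on the first ruling and
  nonpositive on the second, so s \<le> 0.\<close>

lemma C1_joint_imp:
  assumes joint: "\<And>p. p \<in> closed_segment a b \<Longrightarrow> C1_joint (patch k a b c d) (patch k' a b c' d') (b - a) p"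
  shows "z < 0 \<and> z' < 0 \<and> k * z = k' * z'"
proof -
  obtain A' B' C' E' where "skew_quad a b c' d' A' B' C' E'" using skew_coordinates[OF skew'] .
  then interpret q': skew_quad a b c' d' A' B' C' E' .
  \<comment> \<open>The midpoint is used because at the ends of the edge the two tangent planes
    coincide for all k and k' and say nothing about them.\<close>
  define p where "p = (1 - 1/2) *\<^sub>R a + (1/2) *\<^sub>R b"
  let ?w = "ruling k (1/2) a b c d" and ?w' = "ruling k' (1/2) a b c' d'"
  have "p \<in> closed_segment a b" unfolding p_def closed_segment_def by (intro CollectI exI[of _ "1/2"]) simp
  then obtain n where TS: "tangent_space (patch k a b c d) p = tangent_space (patch k' a b c' d') p"
    and n: "n \<in> tangent_space (patch k a b c d) p" "n \<noteq> 0" "n \<bullet> (b - a) = 0"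
    and pos: "\<And>u. u \<in> tangent_vectors (patch k a b c d) p \<Longrightarrow> n \<bullet> u \<ge> 0"
    and neg: "\<And>u. u \<in> tangent_vectors (patch k' a b c' d') p \<Longrightarrow> n \<bullet> u \<le> 0"
    using joint[of p] unfolding C1_joint_def by blast
  note t = k(1) _ _ p_def and t' = k(2) _ _ p_def
  have sp: "tangent_space (patch k a b c d) p = span {b - a, ?w}"
    "tangent_space (patch k' a b c' d') p = span {b - a, ?w'}"
    using tangent_space_patch[OF t] q'.tangent_space_patch[OF t'] by auto
  have w: "n \<bullet> ?w \<ge> 0" "n \<bullet> ?w' \<le> 0"
    using pos[OF ruling_tangent[OF t]] neg[OF q'.ruling_tangent[OF t']] k
    by (auto simp: zero_le_mult_iff mult_le_0_iff zero_le_divide_iff divide_le_0_iff)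
  have "?w' \<in> span {b - a, ?w}" using TS sp by (metis insertCI span_base)
  then obtain s m where w': "?w' = m *\<^sub>R (b - a) + s *\<^sub>R ?w"
    by (auto simp: span_insert span_singleton algebra_simps)
  have "n \<in> span {b - a, ?w}" using n(1) sp by simp
  then obtain s1 m1 where n': "n = m1 *\<^sub>R (b - a) + s1 *\<^sub>R ?w"
    by (auto simp: span_insert span_singleton algebra_simps)
  have "n \<bullet> n = s1 * (n \<bullet> ?w)"
    using n(3) arg_cong[OF n', of "\<lambda>u. n \<bullet> u"] by (simp add: inner_add_right)
  then have "n \<bullet> ?w \<noteq> 0" using n(2) by auto
  then have "n \<bullet> ?w > 0" using w by simp
  moreover have "n \<bullet> ?w' = s * (n \<bullet> ?w)" unfolding w' using n(3) by (simp add: inner_add_right)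
  ultimately have s: "s \<le> 0" using w(2) by (auto simp: mult_le_0_iff)
  have "C0 ?w' = s * C0 ?w" "E0 ?w' = s * E0 ?w"
    unfolding w' using lin0 by (simp_all add: linear_add linear_scale coord0_ruling)
  then have e: "k' * z' = s * k" "z = s" by (simp_all add: coord0_ruling' coord0_ruling)
  then have "z < 0" using s z_nonzero by simp
  moreover have "k * z = k' * z'" using e by simp
  moreover have "k * z < 0" using calculation(1) k by (simp add: mult_pos_neg)
  ultimately show ?thesis using k(2) by (simp add: zero_less_mult_iff mult_less_0_iff)
qed

text \<open>For every \<tau> the second ruling is z times the first modulo b - a, with z < 0. So the
  planes agree and the patches extend to opposite sides.\<close>

lemma C1_joint_if:
  assumes z: "z < 0" and kz: "k * z = k' * z'" and p: "p \<in> closed_segment a b"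
  shows "C1_joint (patch k a b c d) (patch k' a b c' d') (b - a) p"
proof -
  obtain A' B' C' E' where "skew_quad a b c' d' A' B' C' E'" using skew_coordinates[OF skew'] .
  then interpret q': skew_quad a b c' d' A' B' C' E' .
  obtain \<tau> where \<tau>: "0 \<le> \<tau>" "\<tau> \<le> 1" "p = (1 - \<tau>) *\<^sub>R a + \<tau> *\<^sub>R b"
    using p by (auto simp: closed_segment_def)
  note t = k(1) \<tau> and t' = k(2) \<tau>
  let ?w = "ruling k \<tau> a b c d" and ?w' = "ruling k' \<tau> a b c' d'"
  note sp = tangent_space_patch[OF t] q'.tangent_space_patch[OF t']
  have "\<exists>m. ?w' = z *\<^sub>R ?w + m *\<^sub>R (b - a)"
    by (rule direction_eqI) (use lin0 kz in \<open>simp_all add: linear_scale coord0_ruling coord0_ruling' mult.commute mult.left_commute\<close>)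
  then obtain m where w': "?w' = z *\<^sub>R ?w + m *\<^sub>R (b - a)" by blast
  have w: "?w = (1 / z) *\<^sub>R ?w' - (m / z) *\<^sub>R (b - a)"
    unfolding w' using z by (simp add: scaleR_add_right)
  have "span {b - a, ?w} = span {b - a, ?w'}"
  proof (rule span_eq[THEN iffD2], intro conjI)
    have "(1 / z) *\<^sub>R ?w' - (m / z) *\<^sub>R (b - a) \<in> span {b - a, ?w'}"
      by (intro span_diff span_scale span_base) auto
    then show "{b - a, ?w} \<subseteq> span {b - a, ?w'}" using w by (auto intro: span_base)
    have "z *\<^sub>R ?w + m *\<^sub>R (b - a) \<in> span {b - a, ?w}"
      by (intro span_add span_scale span_base) auto
    then show "{b - a, ?w'} \<subseteq> span {b - a, ?w}" using w' by (auto intro: span_base)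
  qed
  then have TS: "tangent_space (patch k a b c d) p = tangent_space (patch k' a b c' d') p"
    using sp by simp
  \<comment> \<open>Gram-Schmidt: n is the ruling made orthogonal to the edge.\<close>
  define q where "q = (?w \<bullet> (b - a)) / ((b - a) \<bullet> (b - a))"
  define n where "n = ?w - q *\<^sub>R (b - a)"
  have "(w - ((w \<bullet> e) / (e \<bullet> e)) *\<^sub>R e) \<bullet> e = 0" if "e \<noteq> 0" for w e :: "real^3"
    using that by (simp add: inner_diff_left)
  then have nba: "n \<bullet> (b - a) = 0" using edge_nonzero unfolding n_def q_def by blast
  have nw: "n \<bullet> ?w = n \<bullet> n" using nba by (simp add: n_def inner_diff_right)
  have nw': "n \<bullet> ?w' = z * (n \<bullet> n)" unfolding w' using nba nw by (simp add: inner_add_right)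
  have n0: "n \<noteq> 0"
  proof
    assume "n = 0"
    then have "?w = q *\<^sub>R (b - a)" by (simp add: n_def)
    then have "C0 ?w = 0" "E0 ?w = 0" using lin0 by (simp_all add: linear_scale coord0_ruling)
    then show False using k by (auto simp: coord0_ruling)
  qed
  show ?thesis
    unfolding C1_joint_def
  proof (intro conjI bexI ballI)
    show "n \<in> tangent_space (patch k a b c d) p"
      unfolding sp n_def by (intro span_diff span_scale span_base) auto
    show "0 \<le> n \<bullet> u" if u: "u \<in> tangent_vectors (patch k a b c d) p" for u
    proof -
      obtain l m where "l \<ge> 0" "u = l *\<^sub>R ?w + m *\<^sub>R (b - a)" using tangent_vectors_patch_subset[OF t u] .
      then show ?thesis using nba nw by (simp add: inner_add_right)
    qed
    show "n \<bullet> u \<le> 0" if u: "u \<in> tangent_vectors (patch k' a b c' d') p" for u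
    proof -
      obtain l m where "l \<ge> 0" "u = l *\<^sub>R ?w' + m *\<^sub>R (b - a)" using q'.tangent_vectors_patch_subset[OF t' u] .
      then show ?thesis using nba nw' z by (simp add: inner_add_right mult_nonneg_nonpos mult_nonpos_nonneg)
    qed
  qed (use TS n0 nba in auto)
qed

text \<open>A linear form that vanishes on the edge line and is positive at two points is positive
  on the segment between them. \<open>E\<close> is such a form for d and d', and \<open>C\<close>
  for c and c'.\<close>

lemma same_side_if: "z > 0 \<Longrightarrow> same_side a b d d'"
  and same_side_if': "z' > 0 \<Longrightarrow> same_side a b c c'"
proof -
  have no: "closed_segment e e' \<inter> affine hull {a, b} = {}"
    if F: "linear F" "F (hom a) = 0" "F (hom b) = 0" "F (hom e) > 0" "F (hom e') > 0" for F :: "real^4 \<Rightarrow> real" and e e'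
  proof -
    have F_affine: "F (hom (u *\<^sub>R p + v *\<^sub>R q)) = u * F (hom p) + v * F (hom q)" if "u + v = 1" for u v p q
    proof -
      have "hom (u *\<^sub>R p + v *\<^sub>R q) = u *\<^sub>R hom p + v *\<^sub>R hom q"
        using that by (simp add: vec_eq_iff forall_4)
      then show ?thesis using F(1) by (simp add: linear_add linear_scale)
    qed
    have "F (hom q) = 0" if "q \<in> affine hull {a, b}" for q
      using that F(2,3) F_affine by (auto simp: affine_hull_2)
    moreover have "F (hom q) > 0" if q: "q \<in> closed_segment e e'" for q
    proof -
      obtain u where u: "0 \<le> u" "u \<le> 1" "q = (1 - u) *\<^sub>R e + u *\<^sub>R e'" using q by (auto simp: closed_segment_def)
      have "F (hom q) = (1 - u) * F (hom e) + u * F (hom e')" unfolding u(3) by (rule F_affine) simp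
      then show ?thesis using u F(4,5) by (cases "u = 0") (auto intro: add_nonneg_pos)
    qed
    ultimately show ?thesis by force
  qed
  have co: "C (hom a) = 0" "C (hom b) = 0" "C (hom c) = 1" "C (hom c') = z'"
    "E (hom a) = 0" "E (hom b) = 0" "E (hom d) = 1" "E (hom d') = z"
    using coord_point[of 1 0 0 0 a] coord_point[of 0 1 0 0 b] coord_point[of 0 0 1 0 c]
      coord_point[of 0 0 0 1 d] coord_point[of x' y' z' 0 c'] coord_point[of x y 0 z d'] c' d' by auto
  show "z > 0 \<Longrightarrow> same_side a b d d'" unfolding same_side_def by (rule no[OF lin(4)]) (simp_all add: co)
  show "z' > 0 \<Longrightarrow> same_side a b c c'" unfolding same_side_def by (rule no[OF lin(3)]) (simp_all add: co)
qed

lemma hom_c'_d': "hom d' = x *\<^sub>R hom a + y *\<^sub>R hom b + z *\<^sub>R hom d"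
    "hom c' = x' *\<^sub>R hom a + y' *\<^sub>R hom b + z' *\<^sub>R hom c"
  using c' d' by (simp_all add: vec_eq_iff forall_4)

lemma det_adjacent: "det (vector [hom a, hom b, hom d', hom c'] :: real^4^4)
   = z * z' * det (vector [hom a, hom b, hom d, hom c] :: real^4^4)"
proof -
  have "det (vector [hom a, hom b, hom d', hom c'] :: real^4^4) = z * det (vector [hom a, hom b, hom d, hom c'])"
    unfolding hom_c'_d'(1) by (rule det_linear_row)
  also have "det (vector [hom a, hom b, hom d, hom c'] :: real^4^4) = - det (vector [hom a, hom b, hom c', hom d])"
    by (rule det_relabel)
  also have "det (vector [hom a, hom b, hom c', hom d] :: real^4^4) = z' * det (vector [hom a, hom b, hom c, hom d])"
    unfolding hom_c'_d'(2) by (rule det_linear_row)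
  also have "det (vector [hom a, hom b, hom c, hom d] :: real^4^4) = - det (vector [hom a, hom b, hom d, hom c])"
    by (rule det_relabel)
  finally show ?thesis by simp
qed

lemma cross_adjacent: "cross3 (b - a) (d' - a) = z *\<^sub>R cross3 (b - a) (d - a)"
   "cross3 (a - b) (c' - b) = z' *\<^sub>R cross3 (a - b) (c - b)"
proof -
  have "d' - a = y *\<^sub>R (b - a) + z *\<^sub>R (d - a)"
  proof -
    have x: "x = 1 - y - z" using d'(2) by linarith
    show ?thesis unfolding d'(1) x by (simp add: vec_eq_iff algebra_simps)
  qed
  then show "cross3 (b - a) (d' - a) = z *\<^sub>R cross3 (b - a) (d - a)"
    by (simp add: cross_add_right cross_mult_right)
  have "c' - b = x' *\<^sub>R (a - b) + z' *\<^sub>R (c - b)"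
  proof -
    have y: "y' = 1 - x' - z'" using c'(2) by linarith
    show ?thesis unfolding c'(1) y by (simp add: vec_eq_iff algebra_simps)
  qed
  then show "cross3 (a - b) (c' - b) = z' *\<^sub>R cross3 (a - b) (c - b)"
    by (simp add: cross_add_right cross_mult_right)
qed

end

text \<open>Up to a constant that depends on the vertex only, \<open>k * curv a b c d\<close> is the absolute value of
  the Gaussian curvature of \<open>patch k a b c d\<close> at \<open>a\<close>, a quantity shared by all patches of a
  hyperbolic net around \<open>a\<close>.\<close>

definition curv :: "real^3 \<Rightarrow> real^3 \<Rightarrow> real^3 \<Rightarrow> real^3 \<Rightarrow> real" where
  "curv a b c d = \<bar>det (vector [hom a, hom b, hom d, hom c] :: real^4^4)\<bar> / (norm (cross3 (b - a) (d - a)))\<^sup>2"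

section \<open>The curvature constant under change of labels and of face\<close>

lemma curv_reflect: "curv a d c b = curv a b c d"
proof -
  have "det (vector [hom a, hom d, hom b, hom c] :: real^4^4) = - det (vector [hom a, hom b, hom d, hom c])"
    by (rule det_swap_middle)
  moreover have "norm (cross3 (d - a) (b - a)) = norm (cross3 (b - a) (d - a))"
    using cross_skew[of "d - a" "b - a"] by simp
  ultimately show ?thesis by (simp add: curv_def)
qed

lemma (in skew_quad) det_nonzero: "det (vector [hom a, hom b, hom d, hom c] :: real^4^4) \<noteq> 0"
proof -
  define M where "M = (vector [hom a, hom b, hom d, hom c] :: real^4^4)"
  \<comment> \<open>Row i holds the coordinates of the i-th unit vector, in the order a, b, d, c of
    the rows of M; so R is the inverse of M.\<close>
  define R where "R = (\<chi> i. vector [A (axis i 1), B (axis i 1), E (axis i 1), C (axis i 1)] :: real^4^4)"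
  have "(R ** M) $ i = mat 1 $ i" for i
  proof -
    have "(R ** M) $ i = comb a b c d (A (axis i 1)) (B (axis i 1)) (C (axis i 1)) (E (axis i 1))"
      by (simp add: R_def M_def matrix_matrix_mult_def comb_def sum_4 vec_eq_iff)
    also have "\<dots> = mat 1 $ i" unfolding comb_coord by (simp add: mat_def axis_def vec_eq_iff)
    finally show ?thesis .
  qed
  then have "R ** M = mat 1" by (simp add: vec_eq_iff)
  then have "det R * det M = 1" by (metis det_I det_mul)
  then show ?thesis unfolding M_def by auto
qed

lemma (in skew_quad) cross_nonzero: "cross3 (b - a) (d - a) \<noteq> 0"
proof
  assume "cross3 (b - a) (d - a) = 0"
  then have "collinear {0, b - a, d - a}" by (simp add: cross_eq_0)
  then consider "b - a = 0" | "d - a = 0" | r where "d - a = r *\<^sub>R (b - a)" unfolding collinear_lemma by blast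
  then obtain \<alpha> \<beta> \<delta> where s: "\<alpha> + \<beta> + \<delta> = 0" "\<alpha> *\<^sub>R a + \<beta> *\<^sub>R b + \<delta> *\<^sub>R d = 0" "\<beta> \<noteq> 0 \<or> \<delta> \<noteq> 0"
  proof cases
    case 1 then show ?thesis using that[of "-1" 1 0] by simp
  next
    case 2 then show ?thesis using that[of "-1" 0 1] by simp
  next
    case (3 r) then show ?thesis using that[of "r - 1" "- r" 1] by (simp add: algebra_simps)
  qed
  then have "A0 0 = \<alpha> \<and> B0 0 = \<beta> \<and> C0 0 = 0 \<and> E0 0 = \<delta>" by (intro coord0_direction) auto
  then show False using s lin0 by (auto simp: linear_0)
qed

lemma curv_pos:
  assumes "skew a b c d" shows "curv a b c d > 0"
proof -
  obtain A B C E where "skew_quad a b c d A B C E" using skew_coordinates[OF assms] .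
  then interpret skew_quad a b c d A B C E .
  show ?thesis using det_nonzero cross_nonzero by (simp add: curv_def)
qed

text \<open>The determinant changes by z z' at both ends, the cross product by z at a and by z' at
  b. So for z, z' of equal sign, k z = k' z' is the same as equality of \<open>k * curv\<close> at
  a, where |K| is its square.\<close>

lemma (in adjacent_quads) curv_adjacent:
  "curv a b c' d' = \<bar>z' / z\<bar> * curv a b c d" "curv b a d' c' = \<bar>z / z'\<bar> * curv b a d c"
proof -
  have scale: "\<bar>s * r * G\<bar> / (norm (s *\<^sub>R X))\<^sup>2 = \<bar>r / s\<bar> * (\<bar>G\<bar> / (norm X)\<^sup>2)" if "s \<noteq> 0"
    for s r G :: real and X :: "real^3"
    using that by (simp add: abs_mult power_mult_distrib power2_eq_square)
  show "curv a b c' d' = \<bar>z' / z\<bar> * curv a b c d"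
    unfolding curv_def det_adjacent cross_adjacent by (rule scale) (rule z_nonzero)
  have sw: "det (vector [hom b, hom a, hom c', hom d'] :: real^4^4) = det (vector [hom a, hom b, hom d', hom c'])"
    "det (vector [hom b, hom a, hom c, hom d] :: real^4^4) = det (vector [hom a, hom b, hom d, hom c])"
    by (rule det_relabel)+
  have "\<bar>z * z' * G\<bar> / (norm (z' *\<^sub>R X))\<^sup>2 = \<bar>z / z'\<bar> * (\<bar>G\<bar> / (norm X)\<^sup>2)" for G and X :: "real^3"
    using scale[OF z_nonzero(2), of z G X] by (simp only: mult.commute[of z z'])
  then show "curv b a d' c' = \<bar>z / z'\<bar> * curv b a d c"
    unfolding curv_def sw det_adjacent cross_adjacent .
qed

section \<open>Projective points and lines\<close>

lemma span_singleton_scale: "r \<noteq> 0 \<Longrightarrow> span {r *\<^sub>R x} = span {x :: 'v::real_vector}"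
proof -
  assume r: "r \<noteq> 0"
  have "x = (1 / r) *\<^sub>R r *\<^sub>R x" using r by simp
  moreover have "(1 / r) *\<^sub>R r *\<^sub>R x \<in> span {r *\<^sub>R x}" by (intro span_scale span_base) simp
  ultimately have "x \<in> span {r *\<^sub>R x}" by metis
  moreover have "r *\<^sub>R x \<in> span {x}" by (intro span_scale span_base) simp
  ultimately show ?thesis unfolding span_eq by simp
qed

lemma span_singleton_eqD:
  assumes "span {x} = span {y :: 'v::real_vector}" "x \<noteq> 0"
  obtains r where "r \<noteq> 0" "x = r *\<^sub>R y"
proof -
  have "x \<in> span {y}" using assms(1) span_base[of x "{x}"] by simp
  then obtain r where "x = r *\<^sub>R y" by (auto simp: span_singleton)
  then show thesis using that assms(2) by auto
qed

lemma span_in_RP3: "span {x} \<in> RP3 \<longleftrightarrow> x \<noteq> 0"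
  by (auto simp: RP3_def dim_eq_0 dim_singleton subspace_span)

lemma RP3_E:
  assumes "p \<in> RP3" obtains x where "x \<noteq> 0" "p = span {x}"
proof -
  obtain B where B: "B \<subseteq> p" "independent B" "p \<subseteq> span B" "card B = dim p" using basis_exists by blast
  then obtain x where x: "B = {x}" using assms by (auto simp: RP3_def card_1_singleton_iff)
  have "span B \<subseteq> p" by (rule span_minimal[OF B(1)]) (use assms in \<open>simp add: RP3_def\<close>)
  then have "p = span {x}" using B x by auto
  moreover have "x \<noteq> 0" using B(2) x by auto
  ultimately show thesis using that by blast
qed

lemma topspace_RP3: "topspace RP3_topology = RP3"
proof -
  have "{x::real^4. x \<noteq> 0 \<and> span {x} \<in> RP3} = - {0}" by (auto simp: span_in_RP3)
  then have "openin RP3_topology RP3" by (simp add: openin_RP3_topology open_Compl)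
  then show ?thesis
    by (metis openin_RP3_topology openin_subset openin_topspace subset_antisym)
qed

text \<open>The open sets compare the squared cosine of the angle with x, a function on lines, with
  the mean of its value 1 at x and its value at y. \<open>f\<close> and \<open>g\<close> are the two
  sides cleared of denominators, hence homogeneous of degree two.\<close>

lemma Hausdorff_RP3: "Hausdorff_space RP3_topology"
  unfolding Hausdorff_space_def topspace_RP3
proof (intro allI impI)
  fix p q assume "p \<in> RP3 \<and> q \<in> RP3 \<and> p \<noteq> q"
  then obtain x y where x: "x \<noteq> 0" "p = span {x}" and y: "y \<noteq> 0" "q = span {y}" and ne: "span {x} \<noteq> span {y}"
    using RP3_E by metis
  define f where "f z = (z \<bullet> x)\<^sup>2 * (y \<bullet> y) * (x \<bullet> x)" for z :: "real^4"
  define g where "g z = (z \<bullet> z) * ((x \<bullet> y)\<^sup>2 + (x \<bullet> x) * (y \<bullet> y)) * (x \<bullet> x) / 2" for z :: "real^4"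
  have cont: "continuous_on UNIV f" "continuous_on UNIV g"
    unfolding f_def g_def by (auto intro!: continuous_intros)
  have cs: "(x \<bullet> y)\<^sup>2 < (x \<bullet> x) * (y \<bullet> y)"
  proof -
    have "\<bar>x \<bullet> y\<bar> \<noteq> norm x * norm y"
    proof
      assume "\<bar>x \<bullet> y\<bar> = norm x * norm y"
      then consider "norm x *\<^sub>R y = norm y *\<^sub>R x" | "norm x *\<^sub>R y = - norm y *\<^sub>R x"
        using norm_cauchy_schwarz_abs_eq[of x y] by blast
      then have "y = (norm y / norm x) *\<^sub>R x \<or> y = (- norm y / norm x) *\<^sub>R x"
        by cases (use x(1) in \<open>metis (no_types, opaque_lifting) divide_inverse_commute norm_eq_zero scaleR_scaleR left_inverse scaleR_one\<close>)+
      then obtain r where "y = r *\<^sub>R x" by blast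
      then show False using ne y(1) span_singleton_scale by (metis scaleR_zero_left)
    qed
    then have "\<bar>x \<bullet> y\<bar> < norm x * norm y" using Cauchy_Schwarz_ineq2[of x y] by linarith
    then have "\<bar>x \<bullet> y\<bar>\<^sup>2 < (norm x * norm y)\<^sup>2" by (intro power_strict_mono) auto
    then show ?thesis by (simp add: power_mult_distrib power2_norm_eq_inner)
  qed
  have pos: "x \<bullet> x > 0" "y \<bullet> y > 0" using x y by auto
  have sc: "f (r *\<^sub>R z) = r\<^sup>2 * f z" "g (r *\<^sub>R z) = r\<^sup>2 * g z" for r z
    by (simp_all add: f_def g_def power_mult_distrib power2_eq_square)
  have inv: "(\<exists>z. z \<noteq> 0 \<and> span {w} = span {z} \<and> P (f z) (g z)) \<longleftrightarrow> P (f w) (g w)"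
    if "w \<noteq> 0" "\<And>r a b. r > 0 \<Longrightarrow> P (r * a) (r * b) = P a b" for w P
  proof
    assume "\<exists>z. z \<noteq> 0 \<and> span {w} = span {z} \<and> P (f z) (g z)"
    then obtain z where z: "span {w} = span {z}" "P (f z) (g z)" by blast
    obtain r where "r \<noteq> 0" "w = r *\<^sub>R z" using span_singleton_eqD[OF z(1) \<open>w \<noteq> 0\<close>] .
    then show "P (f w) (g w)" using z(2) that(2)[of "r\<^sup>2"] sc by simp
  qed (use that in blast)
  define Up where "Up P = {span {z} | z. z \<noteq> 0 \<and> P (f z) (g z)}" for P :: "real \<Rightarrow> real \<Rightarrow> bool"
  have mem: "span {w} \<in> Up P \<longleftrightarrow> P (f w) (g w)"
    if "w \<noteq> 0" "\<And>r a b. r > 0 \<Longrightarrow> P (r * a) (r * b) = P a b" for w P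
    using inv[of w P, OF that] unfolding Up_def by (simp add: conj_commute) blast
  have op: "openin RP3_topology (Up P)"
    if "\<And>r a b. r > 0 \<Longrightarrow> P (r * a) (r * b) = P a b" "open {z. P (f z) (g z)}" for P
  proof -
    have "{z. z \<noteq> 0 \<and> span {z} \<in> Up P} = {z. P (f z) (g z)} - {0}"
    proof -
      have "span {z} \<in> Up P \<longleftrightarrow> P (f z) (g z)" if "z \<noteq> 0" for z
        by (rule mem[of z P]) (use that \<open>\<And>r a b. r > 0 \<Longrightarrow> P (r * a) (r * b) = P a b\<close> in auto)
      then show ?thesis by blast
    qed
    then have "open {z. z \<noteq> 0 \<and> span {z} \<in> Up P}" using that(2) by (simp add: open_Diff)
    moreover have "Up P \<subseteq> RP3" by (auto simp: Up_def span_in_RP3)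
    ultimately show ?thesis by (simp add: openin_RP3_topology)
  qed
  have sg: "r > 0 \<Longrightarrow> (r * a < r * b) = (a < b)" for r a b :: real by simp
  have "openin RP3_topology (Up (\<lambda>a b. a < b))" "openin RP3_topology (Up (\<lambda>a b. b < a))"
    by (auto intro!: op open_Collect_less cont)
  moreover have "p \<in> Up (\<lambda>a b. b < a)"
  proof -
    have "(x \<bullet> y)\<^sup>2 + (x \<bullet> x) * (y \<bullet> y) < 2 * ((x \<bullet> x) * (y \<bullet> y))" using cs by simp
    then have "g x < f x" using pos
      by (simp add: f_def g_def power2_eq_square mult.commute mult.left_commute)
    then show ?thesis using mem[OF x(1), of "\<lambda>a b. b < a"] x(2) by simp
  qed
  moreover have "q \<in> Up (\<lambda>a b. a < b)"
  proof -
    have "2 * (x \<bullet> y)\<^sup>2 < (x \<bullet> y)\<^sup>2 + (x \<bullet> x) * (y \<bullet> y)" using cs by simp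
    then have "f y < g y" using pos
      by (simp add: f_def g_def inner_commute[of y x] mult.commute mult.left_commute)
    then show ?thesis using mem[OF y(1), of "\<lambda>a b. a < b"] y(2) by simp
  qed
  moreover have "disjnt (Up (\<lambda>a b. b < a)) (Up (\<lambda>a b. a < b))"
  proof -
    have False if "z \<noteq> 0" "span {z} \<in> Up (\<lambda>a b. b < a)" "span {z} \<in> Up (\<lambda>a b. a < b)" for z
      using that mem[OF that(1), of "\<lambda>a b. b < a"] mem[OF that(1), of "\<lambda>a b. a < b"] by simp
    then show ?thesis unfolding disjnt_iff Up_def by blast
  qed
  ultimately show "\<exists>U W. openin RP3_topology U \<and> openin RP3_topology W \<and> p \<in> U \<and> q \<in> W \<and> disjnt U W"
    by blast
qed

lemma independent_pair_dim:
  fixes x y :: "'v::euclidean_space"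
  assumes "\<And>u v. u *\<^sub>R x + v *\<^sub>R y = 0 \<Longrightarrow> u = 0 \<and> v = 0"
  shows "dim (span {x, y}) = 2"
proof -
  have ne: "x \<noteq> y" using assms[of 1 "-1"] by auto
  have "x \<notin> span {y}"
  proof
    assume "x \<in> span {y}"
    then obtain r where "x = r *\<^sub>R y" by (auto simp: span_singleton)
    then have "1 *\<^sub>R x + (- r) *\<^sub>R y = 0" by simp
    then show False using assms by fastforce
  qed
  moreover have "y \<noteq> 0" using assms[of 0 1] by auto
  ultimately have "independent {x, y}" by (simp add: independent_insert)
  then have "dim {x, y} = card {x, y}" by (rule dim_eq_card_independent)
  moreover have "card {x, y} = 2" using ne by simp
  ultimately show ?thesis by (simp only: dim_span)
qed

lemma span_pair: "span {x, y} = {u *\<^sub>R x + v *\<^sub>R y | u v. True}" for x y :: "'v::real_vector"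
proof
  have "u *\<^sub>R x + v *\<^sub>R y \<in> span {x, y}" for u v
    by (intro span_add span_scale span_base) auto
  then show "{u *\<^sub>R x + v *\<^sub>R y | u v. True} \<subseteq> span {x, y}" by blast
  show "span {x, y} \<subseteq> {u *\<^sub>R x + v *\<^sub>R y | u v. True}"
  proof
    fix w assume "w \<in> span {x, y}"
    then obtain u where "w - u *\<^sub>R x \<in> span {y}" using span_breakdown[of x "{x,y}" w]
      by (metis insertI1 span_breakdown_eq)
    then obtain v where "w - u *\<^sub>R x = v *\<^sub>R y" by (auto simp: span_singleton)
    then have "w = u *\<^sub>R x + v *\<^sub>R y" by (simp add: algebra_simps)
    then show "w \<in> {u *\<^sub>R x + v *\<^sub>R y | u v. True}" by blast
  qed
qed

lemma proj_line_through:
  fixes x y :: "real^4"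
  assumes "proj_line L" "span {x} \<in> L" "span {y} \<in> L"
    and ind: "\<And>u v. u *\<^sub>R x + v *\<^sub>R y = 0 \<Longrightarrow> u = 0 \<and> v = 0"
  shows "L = {span {u *\<^sub>R x + v *\<^sub>R y} | u v. u \<noteq> 0 \<or> v \<noteq> 0}"
proof -
  obtain W where W: "subspace W" "dim W = 2" "L = proj_subspace W"
    using assms(1)[unfolded proj_line_def] by (elim exE conjE) (rule that)
  have "x \<in> W" "y \<in> W" using assms(2,3) W(3) span_base[of x "{x}"] span_base[of y "{y}"]
    by (auto simp: proj_subspace_def)
  then have sub: "span {x, y} \<subseteq> W" using W(1) by (intro span_minimal) auto
  have d2: "dim (span {x, y}) = 2" by (rule independent_pair_dim) (rule ind)
  have "span {x, y} = W"
    by (rule subspace_dim_equal[OF subspace_span W(1) sub]) (use d2 W(2) in simp)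
  then have W': "W = {u *\<^sub>R x + v *\<^sub>R y | u v. True}" by (simp add: span_pair)
  show ?thesis
  proof
    show "L \<subseteq> {span {u *\<^sub>R x + v *\<^sub>R y} | u v. u \<noteq> 0 \<or> v \<noteq> 0}"
    proof
      fix p assume p: "p \<in> L"
      then obtain w where w: "w \<noteq> 0" "p = span {w}" using W(3) RP3_E by (auto simp: proj_subspace_def)
      then have "w \<in> W" using p W(3) span_base[of w "{w}"] by (auto simp: proj_subspace_def)
      then obtain u v where "w = u *\<^sub>R x + v *\<^sub>R y" using W' by blast
      then show "p \<in> {span {u *\<^sub>R x + v *\<^sub>R y} | u v. u \<noteq> 0 \<or> v \<noteq> 0}" using w by fastforce
    qed
    show "{span {u *\<^sub>R x + v *\<^sub>R y} | u v. u \<noteq> 0 \<or> v \<noteq> 0} \<subseteq> L"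
    proof clarify
      fix u v :: real assume uv: "u \<noteq> 0 \<or> v \<noteq> 0"
      then have "u *\<^sub>R x + v *\<^sub>R y \<noteq> 0" using ind by blast
      moreover have "span {u *\<^sub>R x + v *\<^sub>R y} \<subseteq> W" using W' W(1) by (intro span_minimal) auto
      ultimately show "span {u *\<^sub>R x + v *\<^sub>R y} \<in> L" using W(3) by (simp add: proj_subspace_def span_in_RP3)
    qed
  qed
qed

lemma proj_line_pair:
  fixes x y :: "real^4"
  assumes ind: "\<And>u v. u *\<^sub>R x + v *\<^sub>R y = 0 \<Longrightarrow> u = 0 \<and> v = 0"
  shows "proj_line {span {u *\<^sub>R x + v *\<^sub>R y} | u v. u \<noteq> 0 \<or> v \<noteq> 0}"
proof -
  have L: "proj_line (proj_subspace (span {x, y}))"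
    unfolding proj_line_def using independent_pair_dim[OF ind] subspace_span by blast
  have "x \<noteq> 0" "y \<noteq> 0" using ind[of 1 0] ind[of 0 1] by auto
  moreover have "span {x} \<subseteq> span {x, y}" "span {y} \<subseteq> span {x, y}" by (intro span_mono; auto)+
  ultimately have "span {x} \<in> proj_subspace (span {x, y})" "span {y} \<in> proj_subspace (span {x, y})"
    by (simp_all add: proj_subspace_def span_in_RP3)
  then show ?thesis using proj_line_through[OF L _ _ ind] L by simp
qed

section \<open>Segments and patches as sets of projective points\<close>

definition seg :: "real^3 \<Rightarrow> real^3 \<Rightarrow> ppoint set" where
  "seg p q = affine_pt ` closed_segment p q"

lemma seg_commute: "seg p q = seg q p"
  by (simp add: seg_def closed_segment_commute)

lemma affine_pt_inj: "affine_pt p = affine_pt q \<longleftrightarrow> p = q"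
proof
  assume "affine_pt p = affine_pt q"
  then obtain r where "hom p = r *\<^sub>R hom q" unfolding affine_pt_def by (rule span_singleton_eqD) auto
  moreover from this have "r = 1" by (metis hom_components(4) mult.right_neutral real_scaleR_def vector_scaleR_component)
  ultimately show "p = q" by simp
qed simp

lemma seg_eq: "seg p q = {span {s *\<^sub>R hom p + t *\<^sub>R hom q} | s t. 0 \<le> s \<and> 0 \<le> t \<and> 0 < s + t}"
proof
  show "seg p q \<subseteq> {span {s *\<^sub>R hom p + t *\<^sub>R hom q} | s t. 0 \<le> s \<and> 0 \<le> t \<and> 0 < s + t}"
  proof
    fix P assume "P \<in> seg p q"
    then obtain u where u: "0 \<le> u" "u \<le> 1" "P = affine_pt ((1 - u) *\<^sub>R p + u *\<^sub>R q)"
      by (auto simp: seg_def closed_segment_def)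
    have "hom ((1 - u) *\<^sub>R p + u *\<^sub>R q) = (1 - u) *\<^sub>R hom p + u *\<^sub>R hom q"
      by (simp add: vec_eq_iff forall_4)
    then show "P \<in> {span {s *\<^sub>R hom p + t *\<^sub>R hom q} | s t. 0 \<le> s \<and> 0 \<le> t \<and> 0 < s + t}"
      using u unfolding affine_pt_def by (intro CollectI exI[of _ "1 - u"] exI[of _ u]) auto
  qed
  show "{span {s *\<^sub>R hom p + t *\<^sub>R hom q} | s t. 0 \<le> s \<and> 0 \<le> t \<and> 0 < s + t} \<subseteq> seg p q"
  proof clarify
    fix s t :: real assume st: "0 \<le> s" "0 \<le> t" "0 < s + t"
    define u where "u = t / (s + t)"
    let ?z = "(1 - u) *\<^sub>R p + u *\<^sub>R q"
    have u: "(s + t) * (1 - u) = s" "(s + t) * u = t" using st by (simp_all add: u_def field_simps)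
    have "hom ?z = (1 - u) *\<^sub>R hom p + u *\<^sub>R hom q" by (simp add: vec_eq_iff forall_4)
    then have "(s + t) *\<^sub>R hom ?z = ((s + t) * (1 - u)) *\<^sub>R hom p + ((s + t) * u) *\<^sub>R hom q"
      by (simp add: scaleR_add_right)
    then have "(s + t) *\<^sub>R hom ?z = s *\<^sub>R hom p + t *\<^sub>R hom q" unfolding u .
    then have "span {s *\<^sub>R hom p + t *\<^sub>R hom q} = affine_pt ?z"
      using st span_singleton_scale[of "s + t" "hom ?z"] by (simp add: affine_pt_def)
    moreover have "?z \<in> closed_segment p q" unfolding closed_segment_def using st
      by (intro CollectI exI[of _ u]) (simp add: u_def)
    ultimately show "span {s *\<^sub>R hom p + t *\<^sub>R hom q} \<in> seg p q" by (simp add: seg_def)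
  qed
qed

lemma patch_proj: "affine_pt ` patch k a b c d = {span {comb a b c d \<alpha> \<beta> \<gamma> \<delta>} | \<alpha> \<beta> \<gamma> \<delta>.
   0 \<le> \<alpha> \<and> 0 \<le> \<beta> \<and> 0 \<le> \<gamma> \<and> 0 \<le> \<delta> \<and> 0 < \<alpha> + \<beta> + \<gamma> + \<delta> \<and> \<alpha> * \<gamma> = k * (\<beta> * \<delta>)}" (is "_ = ?R")
proof
  show "affine_pt ` patch k a b c d \<subseteq> ?R"
  proof clarify
    fix x assume "x \<in> patch k a b c d"
    then obtain \<alpha> \<beta> \<gamma> \<delta> where h: "0 \<le> \<alpha>" "0 \<le> \<beta>" "0 \<le> \<gamma>" "0 \<le> \<delta>" "\<alpha> + \<beta> + \<gamma> + \<delta> = 1" "\<alpha> * \<gamma> = k * (\<beta> * \<delta>)"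
      "x = \<alpha> *\<^sub>R a + \<beta> *\<^sub>R b + \<gamma> *\<^sub>R c + \<delta> *\<^sub>R d" by (rule patchE)
    have "affine_pt x = span {comb a b c d \<alpha> \<beta> \<gamma> \<delta>}" using h(5,7) by (simp add: affine_pt_def comb_hom)
    then show "\<exists>\<alpha> \<beta> \<gamma> \<delta>. affine_pt x = span {comb a b c d \<alpha> \<beta> \<gamma> \<delta>} \<and>
      0 \<le> \<alpha> \<and> 0 \<le> \<beta> \<and> 0 \<le> \<gamma> \<and> 0 \<le> \<delta> \<and> 0 < \<alpha> + \<beta> + \<gamma> + \<delta> \<and> \<alpha> * \<gamma> = k * (\<beta> * \<delta>)"
      using h(1-6) by (intro exI[of _ \<alpha>] exI[of _ \<beta>] exI[of _ \<gamma>] exI[of _ \<delta>]) simp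
  qed
  show "?R \<subseteq> affine_pt ` patch k a b c d"
  proof clarify
    fix \<alpha> \<beta> \<gamma> \<delta> assume h: "0 \<le> \<alpha>" "0 \<le> \<beta>" "0 \<le> \<gamma>" "0 \<le> \<delta>" "0 < \<alpha> + \<beta> + \<gamma> + \<delta>" "\<alpha> * \<gamma> = k * (\<beta> * \<delta>)"
    define s where "s = \<alpha> + \<beta> + \<gamma> + \<delta>"
    have s: "s > 0" using h by (simp add: s_def)
    define x where "x = (\<alpha> / s) *\<^sub>R a + (\<beta> / s) *\<^sub>R b + (\<gamma> / s) *\<^sub>R c + (\<delta> / s) *\<^sub>R d"
    have one: "\<alpha> / s + \<beta> / s + \<gamma> / s + \<delta> / s = 1" using s by (simp add: s_def add_divide_distrib[symmetric])
    have "x \<in> patch k a b c d"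
      by (rule patchI[OF _ _ _ _ one _ x_def]) (use h s in auto)
    moreover have "affine_pt x = span {comb a b c d \<alpha> \<beta> \<gamma> \<delta>}"
    proof -
      have "s *\<^sub>R hom x = comb a b c d \<alpha> \<beta> \<gamma> \<delta>"
        unfolding x_def comb_hom[OF one, symmetric] comb_scale using s by simp
      then show ?thesis using span_singleton_scale[of s "hom x"] s by (simp add: affine_pt_def)
    qed
    ultimately show "span {comb a b c d \<alpha> \<beta> \<gamma> \<delta>} \<in> affine_pt ` patch k a b c d" by (metis imageI)
  qed
qed

section \<open>Hyperboloid patches bounded by a skew quadrilateral\<close>

lemma asymptotic_parametrizationD:
  assumes "asymptotic_parametrization H \<phi>"
  shows "\<phi> ` (circle \<times> circle) \<subseteq> H" "inj_on \<phi> (circle \<times> circle)"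
    "t \<in> circle \<Longrightarrow> proj_line (\<phi> ` (circle \<times> {t}))" "t \<in> circle \<Longrightarrow> proj_line (\<phi> ` ({t} \<times> circle))"
proof -
  have h: "homeomorphic_map (prod_topology (top_of_set circle) (top_of_set circle)) (subtopology RP3_topology H) \<phi>"
    using assms by (simp add: asymptotic_parametrization_def)
  show "\<phi> ` (circle \<times> circle) \<subseteq> H"
    using homeomorphic_imp_surjective_map[OF h] by auto
  show "inj_on \<phi> (circle \<times> circle)"
    using homeomorphic_imp_injective_map[OF h] by simp
qed (use assms in \<open>auto simp: asymptotic_parametrization_def\<close>)

text \<open>The sign of \<open>u * v\<close> decides on which side of the quadrilateral the intersection point of two
  lines of the different reguli lies.\<close>

lemma same_sign:
  fixes a0 b0 c0 d0 a1 b1 c1 d1 u v u' v' k :: real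
  assumes nn: "0 \<le> a0" "0 \<le> b0" "0 \<le> c0" "0 \<le> d0" "0 \<le> a1" "0 \<le> b1" "0 \<le> c1" "0 \<le> d1"
    and pos: "0 < a0 + b0" "0 < c0 + d0" and k: "0 < k" and q: "a0 * c0 = k * (b0 * d0)"
    and eq: "u * a0 = v' * a1" "u * b0 = u' * b1" "v * c0 = u' * c1" "v * d0 = v' * d1"
  shows "0 \<le> u * v"
proof (rule ccontr)
  assume "\<not> 0 \<le> u * v"
  then have uv: "u * v < 0" by simp
  have no: "\<not> (a0 > 0 \<and> d0 > 0)"
  proof
    assume p: "a0 > 0 \<and> d0 > 0"
    have "(u * a0) * (v * d0) = (v' * v') * (a1 * d1)" unfolding eq by simp
    then have "(u * a0) * (v * d0) \<ge> 0" using nn by simp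
    moreover have "(u * a0) * (v * d0) = (u * v) * (a0 * d0)" by simp
    moreover have "(u * v) * (a0 * d0) < 0" using uv p by (auto intro!: mult_neg_pos[of "u * v"])
    ultimately show False by linarith
  qed
  have no': "\<not> (b0 > 0 \<and> c0 > 0)"
  proof
    assume p: "b0 > 0 \<and> c0 > 0"
    have "(u * b0) * (v * c0) = (u' * u') * (b1 * c1)" unfolding eq by simp
    then have "(u * b0) * (v * c0) \<ge> 0" using nn by simp
    moreover have "(u * b0) * (v * c0) = (u * v) * (b0 * c0)" by simp
    moreover have "(u * v) * (b0 * c0) < 0" using uv p by (auto intro!: mult_neg_pos[of "u * v"])
    ultimately show False by linarith
  qed
  \<comment> \<open>The relation \<open>q\<close> forces one of the two excluded configurations: if
    a0 > 0 and d0 = 0, then c0 > 0 contradicts it; if a0 = 0, then d0 = 0, so b0 and c0 are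
    positive.\<close>
  show False
  proof (cases "a0 > 0")
    case True
    then have "d0 = 0" using no nn by auto
    then have "c0 > 0" "a0 * c0 = 0" using pos q by auto
    then show False using True by simp
  next
    case False
    then have "a0 = 0" "b0 > 0" using nn pos by auto
    moreover then have "d0 = 0" using q k by auto
    ultimately show False using no' pos by auto
  qed
qed

text \<open>Three points of each segment show that the symmetric form of H vanishes on every vertex
  and on every pair of adjacent vertices. Only its values m1, m2 on the diagonals remain, nonzero by
  nondegeneracy, whence k = - m2/m1. The sign of k is still open here.\<close>

lemma (in skew_quad) quadric_equation:
  assumes "nondegenerate_quadric H" and sub: "seg a b \<subseteq> H" "seg b c \<subseteq> H" "seg c d \<subseteq> H" "seg d a \<subseteq> H"
  obtains k where "k \<noteq> 0"
    "\<And>\<alpha> \<beta> \<gamma> \<delta>. span {comb a b c d \<alpha> \<beta> \<gamma> \<delta>} \<in> H \<Longrightarrow> \<alpha> * \<gamma> = k * (\<beta> * \<delta>)"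
proof -
  obtain M :: "real^4^4" where M: "transpose M = M" "det M \<noteq> 0" "H = {span {x} | x. x \<noteq> 0 \<and> x \<bullet> (M *v x) = 0}"
    using assms(1)[unfolded nondegenerate_quadric_def] by (elim exE conjE) (rule that)
  define bf where "bf x y = x \<bullet> (M *v y)" for x y
  have bl: "bf (x + x') y = bf x y + bf x' y" "bf x (y + y') = bf x y + bf x y'"
    "bf (r *\<^sub>R x) y = r * bf x y" "bf x (r *\<^sub>R y) = r * bf x y" for x x' y y' r
    by (simp_all add: bf_def inner_add_left inner_add_right matrix_vector_right_distrib
        matrix_vector_mult_scaleR)
  have sym: "bf x y = bf y x" for x y
    unfolding bf_def by (metis M(1) dot_lmul_matrix inner_commute matrix_vector_mul_assoc vector_transpose_matrix transpose_matrix_vector)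
  have null: "bf x x = 0" if "span {x} \<in> H" for x
  proof (cases "x = 0")
    case False
    have "\<exists>y. span {x} = span {y} \<and> y \<noteq> 0 \<and> y \<bullet> (M *v y) = 0" using that unfolding M(3) by simp
    then obtain y where y: "span {x} = span {y}" "y \<bullet> (M *v y) = 0" by (elim exE conjE) (rule that)
    obtain r where "x = r *\<^sub>R y" using span_singleton_eqD[OF y(1) False] .
    moreover have "bf y y = 0" using y(2) by (simp add: bf_def)
    ultimately show ?thesis using bl by simp
  qed (simp add: bf_def)
  have edge: "bf (hom p) (hom p) = 0 \<and> bf (hom q) (hom q) = 0 \<and> bf (hom p) (hom q) = 0" if "seg p q \<subseteq> H" for p q
  proof -
    have on: "span {s *\<^sub>R hom p + t *\<^sub>R hom q} \<in> H" if "0 \<le> s" "0 \<le> t" "0 < s + t" for s t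
      using \<open>seg p q \<subseteq> H\<close> that unfolding seg_eq by blast
    have "bf (hom p) (hom p) = 0" "bf (hom q) (hom q) = 0"
      using null[OF on[of 1 0]] null[OF on[of 0 1]] by simp_all
    moreover have "bf (hom p + hom q) (hom p + hom q) = 0" using null[OF on[of 1 1]] by simp
    ultimately show ?thesis using sym[of "hom q" "hom p"] by (simp add: bl)
  qed
  note e = edge[OF sub(1)] edge[OF sub(2)] edge[OF sub(3)] edge[OF sub(4)]
  define m1 m2 where "m1 = bf (hom a) (hom c)" and "m2 = bf (hom b) (hom d)"
  have q: "bf (comb a b c d \<alpha> \<beta> \<gamma> \<delta>) (comb a b c d \<alpha> \<beta> \<gamma> \<delta>) = 2 * (\<alpha> * \<gamma> * m1 + \<beta> * \<delta> * m2)" for \<alpha> \<beta> \<gamma> \<delta>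
    unfolding comb_def using e sym[of "hom b" "hom a"] sym[of "hom c" "hom a"] sym[of "hom c" "hom b"]
      sym[of "hom d" "hom b"] sym[of "hom d" "hom c"] sym[of "hom a" "hom d"]
    by (simp add: bl m1_def m2_def algebra_simps)
  have inj: "x = 0" if "\<And>y. bf y x = 0" for x
  proof -
    have "M *v x = 0" using that[of "M *v x"] by (simp add: bf_def)
    then show ?thesis using M(2) by (metis invertible_det_nz invertible_def matrix_vector_mul_assoc matrix_vector_mul_lid matrix_vector_mult_0_right)
  qed
  have full: "bf y x = A y * bf (hom a) x + B y * bf (hom b) x + C y * bf (hom c) x + E y * bf (hom d) x" for x y
    using arg_cong[OF comb_coord[of y], of "\<lambda>w. bf w x"] by (simp add: comb_def bl)
  have m1: "m1 \<noteq> 0"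
  proof
    assume "m1 = 0"
    then have "bf y (hom a) = 0" for y using full[of y "hom a"] e sym m1_def by simp
    then show False using inj[of "hom a"] by simp
  qed
  have m2: "m2 \<noteq> 0"
  proof
    assume "m2 = 0"
    then have "bf y (hom b) = 0" for y using full[of y "hom b"] e sym m2_def by simp
    then show False using inj[of "hom b"] by simp
  qed
  show thesis
  proof (rule that)
    show "- m2 / m1 \<noteq> 0" using m1 m2 by simp
    fix \<alpha> \<beta> \<gamma> \<delta> assume "span {comb a b c d \<alpha> \<beta> \<gamma> \<delta>} \<in> H"
    then have "\<alpha> * \<gamma> * m1 + \<beta> * \<delta> * m2 = 0" using null q by fastforce
    then have "\<alpha> * \<gamma> * m1 = (\<beta> * \<delta>) * (- m2)" by simp
    then show "\<alpha> * \<gamma> = - m2 / m1 * (\<beta> * \<delta>)" using m1 by (simp add: field_simps)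
  qed
qed

lemma cis_eq_iff_arc: "\<alpha> < \<theta> \<Longrightarrow> \<theta> < \<beta> \<Longrightarrow> \<beta> < \<alpha> + 2 * pi \<Longrightarrow> cis \<theta> \<noteq> cis \<alpha> \<and> cis \<theta> \<noteq> cis \<beta>"
proof -
  assume h: "\<alpha> < \<theta>" "\<theta> < \<beta>" "\<beta> < \<alpha> + 2 * pi"
  have ne: "cis x \<noteq> cis y" if "x < y" "y < x + 2 * pi" for x y
  proof
    assume "cis x = cis y"
    then have "cis (y - x) = 1" by (simp add: cis_divide[symmetric])
    then have "cos (y - x) = 1" by (metis cis.simps(1) one_complex.simps(1))
    then obtain n :: int where n: "y - x = of_int n * 2 * pi" by (auto simp: cos_one_2pi_int)
    then have eq: "of_int n * (2 * pi) = y - x" by simp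
    have "0 < of_int n * (2 * pi)" "of_int n * (2 * pi) < 1 * (2 * pi)" unfolding eq using that by auto
    then have "0 < real_of_int n" "real_of_int n < 1"
      using zero_less_mult_pos2[of "real_of_int n" "2 * pi"] mult_right_less_imp_less[of "real_of_int n" "2 * pi" 1] by auto
    then show False by simp
  qed
  show ?thesis using ne[of \<alpha> \<theta>] ne[of \<theta> \<beta>] h by fastforce
qed

text \<open>About \<open>\<phi>\<close> only its parameter lines and its injectivity are used. Each
  parameter line of the rectangle joins points of opposite edges, coupled by the quadric equation. A
  point of the rectangle lies on one line of each family, which fixes the signs of its coordinates;
  conversely the coordinate ratios of a point of the patch single out one line of each family, and
  injectivity makes the point their intersection.\<close>

lemma (in skew_quad) patch_of_parametrization:
  assumes H: "nondegenerate_quadric H" and \<phi>: "asymptotic_parametrization H \<phi>"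
    and X: "X \<subseteq> circle" "\<xi> \<in> X" "\<eta> \<in> X" "s\<^sub>0 \<in> X" "s\<^sub>0 \<noteq> \<xi>" "s\<^sub>0 \<noteq> \<eta>"
    and Y: "Y \<subseteq> circle" "\<zeta> \<in> Y" "\<omega> \<in> Y"
    and ab: "\<phi> ` (X \<times> {\<zeta>}) = seg a b" and cd: "\<phi> ` (X \<times> {\<omega>}) = seg c d"
    and bcda: "{\<phi> ` ({\<xi>} \<times> Y), \<phi> ` ({\<eta>} \<times> Y)} = {seg b c, seg d a}"
  shows "\<exists>k>0. \<phi> ` (X \<times> Y) = affine_pt ` patch k a b c d"
proof -
  note P = asymptotic_parametrizationD[OF \<phi>]
  obtain \<xi>b \<xi>d where bc: "\<phi> ` ({\<xi>b} \<times> Y) = seg b c" and da: "\<phi> ` ({\<xi>d} \<times> Y) = seg d a"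
    and \<xi>: "\<xi>b \<in> {\<xi>, \<eta>}" "\<xi>d \<in> {\<xi>, \<eta>}"
    using bcda by (auto simp: doubleton_eq_iff)
  then have \<xi>': "\<xi>b \<in> X" "\<xi>d \<in> X" "\<xi>b \<in> circle" "\<xi>d \<in> circle" using X by auto
  have onP: "seg a b \<subseteq> \<phi> ` (X \<times> Y)" "seg b c \<subseteq> \<phi> ` (X \<times> Y)" "seg c d \<subseteq> \<phi> ` (X \<times> Y)" "seg d a \<subseteq> \<phi> ` (X \<times> Y)"
    unfolding ab[symmetric] bc[symmetric] cd[symmetric] da[symmetric] using \<xi>' Y by (auto intro!: image_mono)
  have "\<phi> ` (X \<times> Y) \<subseteq> H" using P(1) X(1) Y(1) by blast
  then obtain k where k0: "k \<noteq> 0"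
    and kH: "\<And>\<alpha> \<beta> \<gamma> \<delta>. span {comb a b c d \<alpha> \<beta> \<gamma> \<delta>} \<in> H \<Longrightarrow> \<alpha> * \<gamma> = k * (\<beta> * \<delta>)"
    using quadric_equation[OF H] onP by (metis subset_trans)
  have cI: "comb a b c d \<alpha> \<beta> \<gamma> \<delta> = 0 \<Longrightarrow> \<alpha> = 0 \<and> \<beta> = 0 \<and> \<gamma> = 0 \<and> \<delta> = 0" for \<alpha> \<beta> \<gamma> \<delta>
    using coord[of \<alpha> \<beta> \<gamma> \<delta>] lin by (simp add: linear_0)
  have cinj: "comb a b c d \<alpha> \<beta> \<gamma> \<delta> = comb a b c d \<alpha>' \<beta>' \<gamma>' \<delta>' \<Longrightarrow> \<alpha> = \<alpha>' \<and> \<beta> = \<beta>' \<and> \<gamma> = \<gamma>' \<and> \<delta> = \<delta>'" for \<alpha> \<beta> \<gamma> \<delta> \<alpha>' \<beta>' \<gamma>' \<delta>'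
    by (metis coord)
  have segs: "seg a b = {span {comb a b c d s t 0 0} | s t. 0 \<le> s \<and> 0 \<le> t \<and> 0 < s + t}"
    "seg c d = {span {comb a b c d 0 0 s t} | s t. 0 \<le> s \<and> 0 \<le> t \<and> 0 < s + t}"
    "seg b c = {span {comb a b c d 0 s t 0} | s t. 0 \<le> s \<and> 0 \<le> t \<and> 0 < s + t}"
    "seg d a = {span {comb a b c d t 0 0 s} | s t. 0 \<le> s \<and> 0 \<le> t \<and> 0 < s + t}"
    unfolding seg_eq comb_def by (simp_all add: add.commute)
  \<comment> \<open>The line over s is spanned by its points on ab and cd. The sum of their
    representatives lies on the quadric too, which yields a0 c0 = k b0 d0.\<close>
  have lineS: "\<exists>a0 b0 c0 d0. 0 \<le> a0 \<and> 0 \<le> b0 \<and> 0 < a0 + b0 \<and> 0 \<le> c0 \<and> 0 \<le> d0 \<and> 0 < c0 + d0 \<and>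
      \<phi> (s, \<zeta>) = span {comb a b c d a0 b0 0 0} \<and> \<phi> (s, \<omega>) = span {comb a b c d 0 0 c0 d0} \<and> a0 * c0 = k * (b0 * d0) \<and>
      \<phi> ` ({s} \<times> circle) = {span {comb a b c d (u * a0) (u * b0) (v * c0) (v * d0)} | u v. u \<noteq> 0 \<or> v \<noteq> 0}"
    if s: "s \<in> X" for s
  proof -
    have "\<phi> (s, \<zeta>) \<in> seg a b" "\<phi> (s, \<omega>) \<in> seg c d" using s ab cd by auto
    then obtain a0 b0 c0 d0 where h: "0 \<le> a0" "0 \<le> b0" "0 < a0 + b0" "\<phi> (s, \<zeta>) = span {comb a b c d a0 b0 0 0}"
      "0 \<le> c0" "0 \<le> d0" "0 < c0 + d0" "\<phi> (s, \<omega>) = span {comb a b c d 0 0 c0 d0}" unfolding segs by blast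
    have sum: "u *\<^sub>R comb a b c d a0 b0 0 0 + v *\<^sub>R comb a b c d 0 0 c0 d0 = comb a b c d (u * a0) (u * b0) (v * c0) (v * d0)" for u v
      by (simp add: comb_scale comb_add)
    have sc: "s \<in> circle" using s X(1) by blast
    have "\<phi> ` ({s} \<times> circle) = {span {u *\<^sub>R comb a b c d a0 b0 0 0 + v *\<^sub>R comb a b c d 0 0 c0 d0} | u v. u \<noteq> 0 \<or> v \<noteq> 0}"
    proof (rule proj_line_through[OF P(4)[OF sc]])
      have "(s, \<zeta>) \<in> {s} \<times> circle" "(s, \<omega>) \<in> {s} \<times> circle" using Y by auto
      then show "span {comb a b c d a0 b0 0 0} \<in> \<phi> ` ({s} \<times> circle)" "span {comb a b c d 0 0 c0 d0} \<in> \<phi> ` ({s} \<times> circle)"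
        using h(4,8) by (metis imageI)+
      show "u = 0 \<and> v = 0" if "u *\<^sub>R comb a b c d a0 b0 0 0 + v *\<^sub>R comb a b c d 0 0 c0 d0 = 0" for u v
        using cI that h unfolding sum by (metis add.right_neutral less_irrefl mult_eq_0_iff)
    qed
    then have L: "\<phi> ` ({s} \<times> circle) = {span {comb a b c d (u * a0) (u * b0) (v * c0) (v * d0)} | u v. u \<noteq> 0 \<or> v \<noteq> 0}"
      unfolding sum .
    have "span {comb a b c d (1 * a0) (1 * b0) (1 * c0) (1 * d0)} \<in> \<phi> ` ({s} \<times> circle)" unfolding L
      by (intro CollectI exI[of _ "1::real"]) simp
    then have "span {comb a b c d (1 * a0) (1 * b0) (1 * c0) (1 * d0)} \<in> H" using P(1) sc by blast
    then have "a0 * c0 = k * (b0 * d0)" using kH by fastforce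
    then show ?thesis using h L by blast
  qed
  have lineT: "\<exists>a1 b1 c1 d1. 0 \<le> b1 \<and> 0 \<le> c1 \<and> 0 < b1 + c1 \<and> 0 \<le> d1 \<and> 0 \<le> a1 \<and> 0 < d1 + a1 \<and>
      \<phi> (\<xi>b, t) = span {comb a b c d 0 b1 c1 0} \<and> \<phi> (\<xi>d, t) = span {comb a b c d a1 0 0 d1} \<and> a1 * c1 = k * (b1 * d1) \<and>
      \<phi> ` (circle \<times> {t}) = {span {comb a b c d (v * a1) (u * b1) (u * c1) (v * d1)} | u v. u \<noteq> 0 \<or> v \<noteq> 0}"
    if t: "t \<in> Y" for t
  proof -
    have "\<phi> (\<xi>b, t) \<in> seg b c" "\<phi> (\<xi>d, t) \<in> seg d a" using t bc da by auto
    then obtain a1 b1 c1 d1 where h: "0 \<le> b1" "0 \<le> c1" "0 < b1 + c1" "\<phi> (\<xi>b, t) = span {comb a b c d 0 b1 c1 0}"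
      "0 \<le> d1" "0 \<le> a1" "0 < d1 + a1" "\<phi> (\<xi>d, t) = span {comb a b c d a1 0 0 d1}" unfolding segs by blast
    have sum: "u *\<^sub>R comb a b c d 0 b1 c1 0 + v *\<^sub>R comb a b c d a1 0 0 d1 = comb a b c d (v * a1) (u * b1) (u * c1) (v * d1)" for u v
      by (simp add: comb_scale comb_add)
    have tc: "t \<in> circle" using t Y(1) by blast
    have "\<phi> ` (circle \<times> {t}) = {span {u *\<^sub>R comb a b c d 0 b1 c1 0 + v *\<^sub>R comb a b c d a1 0 0 d1} | u v. u \<noteq> 0 \<or> v \<noteq> 0}"
    proof (rule proj_line_through[OF P(3)[OF tc]])
      have "(\<xi>b, t) \<in> circle \<times> {t}" "(\<xi>d, t) \<in> circle \<times> {t}" using \<xi>' by auto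
      then show "span {comb a b c d 0 b1 c1 0} \<in> \<phi> ` (circle \<times> {t})" "span {comb a b c d a1 0 0 d1} \<in> \<phi> ` (circle \<times> {t})"
        using h(4,8) by (metis imageI)+
      show "u = 0 \<and> v = 0" if "u *\<^sub>R comb a b c d 0 b1 c1 0 + v *\<^sub>R comb a b c d a1 0 0 d1 = 0" for u v
        using cI that h unfolding sum by (metis add.right_neutral less_irrefl mult_eq_0_iff)
    qed
    then have L: "\<phi> ` (circle \<times> {t}) = {span {comb a b c d (v * a1) (u * b1) (u * c1) (v * d1)} | u v. u \<noteq> 0 \<or> v \<noteq> 0}"
      unfolding sum .
    have "span {comb a b c d (1 * a1) (1 * b1) (1 * c1) (1 * d1)} \<in> \<phi> ` (circle \<times> {t})" unfolding L
      by (intro CollectI exI[of _ "1::real"]) simp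
    then have "span {comb a b c d (1 * a1) (1 * b1) (1 * c1) (1 * d1)} \<in> H" using P(1) tc by blast
    then have "a1 * c1 = k * (b1 * d1)" using kH by fastforce
    then show ?thesis using h L by blast
  qed
  have k: "k > 0"
  proof -
    obtain a0 b0 c0 d0 where h: "0 \<le> a0" "0 \<le> b0" "0 < a0 + b0" "0 \<le> c0" "0 \<le> d0" "0 < c0 + d0"
      "\<phi> (s\<^sub>0, \<zeta>) = span {comb a b c d a0 b0 0 0}" "\<phi> (s\<^sub>0, \<omega>) = span {comb a b c d 0 0 c0 d0}" "a0 * c0 = k * (b0 * d0)"
      using lineS[OF X(4)] by (elim exE conjE) (rule that; assumption)
    \<comment> \<open>The line over the inner parameter \<open>s\<^sub>0\<close> avoids the sides bc
      and da by injectivity. So a0 and c0 are positive, and this decides the sign of k.\<close>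
    have not: "\<phi> (s\<^sub>0, t) \<notin> seg b c" "\<phi> (s\<^sub>0, t) \<notin> seg d a" if "t \<in> Y" for t
    proof -
      have "s\<^sub>0 \<noteq> \<xi>b" "s\<^sub>0 \<noteq> \<xi>d" using X(5,6) \<xi> by auto
      moreover have "(s\<^sub>0, t) \<in> circle \<times> circle" using that X Y by auto
      moreover have "{\<xi>b} \<times> Y \<subseteq> circle \<times> circle" "{\<xi>d} \<times> Y \<subseteq> circle \<times> circle" using \<xi>' Y by auto
      ultimately show "\<phi> (s\<^sub>0, t) \<notin> seg b c" "\<phi> (s\<^sub>0, t) \<notin> seg d a"
        unfolding bc[symmetric] da[symmetric] using P(2) by (auto simp: inj_on_image_mem_iff)
    qed
    have "a0 \<noteq> 0"
    proof
      assume "a0 = 0"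
      then have "\<phi> (s\<^sub>0, \<zeta>) \<in> seg b c" unfolding segs h(7) using h(1-3) by (intro CollectI exI[of _ b0] exI[of _ 0]) auto
      then show False using not Y by blast
    qed
    moreover have "c0 \<noteq> 0"
    proof
      assume "c0 = 0"
      then have "\<phi> (s\<^sub>0, \<omega>) \<in> seg d a" unfolding segs h(8) using h(4-6) by (intro CollectI exI[of _ d0] exI[of _ 0]) auto
      then show False using not Y by blast
    qed
    ultimately have "0 < a0 * c0" using h(1,4) by (intro mult_pos_pos) auto
    then have "0 < k * (b0 * d0)" using h(9) by simp
    moreover have "0 \<le> b0 * d0" using h(2,5) by simp
    ultimately show ?thesis using mult_nonpos_nonneg[of k "b0 * d0"] by linarith
  qed
  have "\<phi> ` (X \<times> Y) = affine_pt ` patch k a b c d"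
  proof
    show "\<phi> ` (X \<times> Y) \<subseteq> affine_pt ` patch k a b c d"
    proof clarify
      fix s t assume st: "s \<in> X" "t \<in> Y"
      then have sc: "s \<in> circle" "t \<in> circle" using X Y by auto
      obtain a0 b0 c0 d0 where h: "0 \<le> a0" "0 \<le> b0" "0 < a0 + b0" "0 \<le> c0" "0 \<le> d0" "0 < c0 + d0" "a0 * c0 = k * (b0 * d0)"
        "\<phi> ` ({s} \<times> circle) = {span {comb a b c d (u * a0) (u * b0) (v * c0) (v * d0)} | u v. u \<noteq> 0 \<or> v \<noteq> 0}"
        using lineS[OF st(1)] by (elim exE conjE) (rule that; assumption)
      obtain a1 b1 c1 d1 where h': "0 \<le> b1" "0 \<le> c1" "0 \<le> d1" "0 \<le> a1"
        "\<phi> ` (circle \<times> {t}) = {span {comb a b c d (v * a1) (u * b1) (u * c1) (v * d1)} | u v. u \<noteq> 0 \<or> v \<noteq> 0}"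
        using lineT[OF st(2)] by (elim exE conjE) (rule that; assumption)
      have "\<phi> (s,t) \<in> \<phi> ` ({s} \<times> circle)" "\<phi> (s,t) \<in> \<phi> ` (circle \<times> {t})" using sc by auto
      then obtain u v u' v' where uv: "u \<noteq> 0 \<or> v \<noteq> 0" "\<phi> (s,t) = span {comb a b c d (u * a0) (u * b0) (v * c0) (v * d0)}"
        and uv': "\<phi> (s,t) = span {comb a b c d (v' * a1) (u' * b1) (u' * c1) (v' * d1)}"
        unfolding h h' by blast
      have nz: "comb a b c d (u * a0) (u * b0) (v * c0) (v * d0) \<noteq> 0"
        using cI uv(1) h by (metis add.right_neutral less_irrefl mult_eq_0_iff)
      obtain r where "r \<noteq> 0" "comb a b c d (u * a0) (u * b0) (v * c0) (v * d0) = r *\<^sub>R comb a b c d (v' * a1) (u' * b1) (u' * c1) (v' * d1)"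
        using span_singleton_eqD[OF _ nz] uv uv' by metis
      then have "u * a0 = (r * v') * a1" "u * b0 = (r * u') * b1" "v * c0 = (r * u') * c1" "v * d0 = (r * v') * d1"
        unfolding comb_scale using cinj by (metis mult.assoc)+
      then have "0 \<le> u * v"
        by (rule same_sign[OF h(1,2,4,5) h'(4,1,2,3) h(3,6) k h(7)])
      \<comment> \<open>A common sign of u and v disappears in the projective point, so both may be
        taken nonnegative.\<close>
      then have "0 \<le> u \<and> 0 \<le> v \<or> 0 \<le> - u \<and> 0 \<le> - v" by (auto simp: zero_le_mult_iff)
      then obtain e u1 v1 where e: "e \<noteq> 0" "u = e * u1" "v = e * v1" "0 \<le> u1" "0 \<le> v1"
        by (metis minus_minus mult_1 mult_minus1 neg_equal_0_iff_equal one_neq_zero)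
      have "\<phi> (s,t) = span {comb a b c d (u1 * a0) (u1 * b0) (v1 * c0) (v1 * d0)}"
        using span_singleton_scale[OF e(1), of "comb a b c d (u1 * a0) (u1 * b0) (v1 * c0) (v1 * d0)"]
        unfolding uv(2) e(2,3) comb_scale by (simp add: mult.assoc)
      moreover have "u1 * a0 * (v1 * c0) = k * (u1 * b0 * (v1 * d0))" using h(7) by (simp add: algebra_simps)
      moreover have "0 < u1 * a0 + u1 * b0 + v1 * c0 + v1 * d0"
      proof -
        have "u1 > 0 \<or> v1 > 0" using uv(1) e by auto
        moreover have "0 \<le> u1 * (a0 + b0)" "0 \<le> v1 * (c0 + d0)" using e h by auto
        moreover have "u1 > 0 \<Longrightarrow> 0 < u1 * (a0 + b0)" "v1 > 0 \<Longrightarrow> 0 < v1 * (c0 + d0)" using h by auto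
        ultimately have "0 < u1 * (a0 + b0) + v1 * (c0 + d0)" by linarith
        then show ?thesis by (simp add: distrib_left)
      qed
      ultimately show "\<phi> (s,t) \<in> affine_pt ` patch k a b c d"
        unfolding patch_proj using e h
        by (intro CollectI exI[of _ "u1 * a0"] exI[of _ "u1 * b0"] exI[of _ "v1 * c0"] exI[of _ "v1 * d0"]) simp
    qed
    show "affine_pt ` patch k a b c d \<subseteq> \<phi> ` (X \<times> Y)"
    proof
      fix p assume "p \<in> affine_pt ` patch k a b c d"
      then obtain \<alpha> \<beta> \<gamma> \<delta> where g: "0 \<le> \<alpha>" "0 \<le> \<beta>" "0 \<le> \<gamma>" "0 \<le> \<delta>" "0 < \<alpha> + \<beta> + \<gamma> + \<delta>" "\<alpha> * \<gamma> = k * (\<beta> * \<delta>)"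
        "p = span {comb a b c d \<alpha> \<beta> \<gamma> \<delta>}" unfolding patch_proj by blast
      show "p \<in> \<phi> ` (X \<times> Y)"
      \<comment> \<open>Points with two vanishing adjacent coordinates lie on the edges; for the
        others both lines below are well defined.\<close>
      proof (cases "\<alpha> + \<beta> = 0 \<or> \<gamma> + \<delta> = 0 \<or> \<beta> + \<gamma> = 0 \<or> \<alpha> + \<delta> = 0")
        case True
        then consider "\<alpha> = 0" "\<beta> = 0" | "\<gamma> = 0" "\<delta> = 0" | "\<beta> = 0" "\<gamma> = 0" | "\<alpha> = 0" "\<delta> = 0"
          using g by (auto simp: add_nonneg_eq_0_iff)
        then have "p \<in> seg c d \<or> p \<in> seg a b \<or> p \<in> seg d a \<or> p \<in> seg b c"
        proof cases
          case 1 then show ?thesis using g unfolding segs by auto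
        next
          case 2 then show ?thesis using g unfolding segs by auto
        next
          case 3
          then have "p \<in> seg d a" using g unfolding segs by (intro CollectI exI[of _ \<delta>] exI[of _ \<alpha>]) auto
          then show ?thesis by blast
        next
          case 4
          then have "p \<in> seg b c" using g unfolding segs by (intro CollectI exI[of _ \<beta>] exI[of _ \<gamma>]) auto
          then show ?thesis by blast
        qed
        then show ?thesis using onP by blast
      next
        case False
        then have pos: "0 < \<alpha> + \<beta>" "0 < \<gamma> + \<delta>" "0 < \<beta> + \<gamma>" "0 < \<alpha> + \<delta>" using g by linarith+
        have "span {comb a b c d \<alpha> \<beta> 0 0} \<in> \<phi> ` (X \<times> {\<zeta>})" unfolding ab segs using g pos by blast
        then obtain s where s: "s \<in> X" "\<phi> (s, \<zeta>) = span {comb a b c d \<alpha> \<beta> 0 0}" by auto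
        obtain a0 b0 c0 d0 where h: "0 \<le> a0" "0 \<le> b0" "0 < a0 + b0" "0 \<le> c0" "0 \<le> d0" "0 < c0 + d0"
          "\<phi> (s, \<zeta>) = span {comb a b c d a0 b0 0 0}" "a0 * c0 = k * (b0 * d0)"
          "\<phi> ` ({s} \<times> circle) = {span {comb a b c d (u * a0) (u * b0) (v * c0) (v * d0)} | u v. u \<noteq> 0 \<or> v \<noteq> 0}"
          using lineS[OF s(1)] by (elim exE conjE) (rule that; assumption)
        have "comb a b c d \<alpha> \<beta> 0 0 \<noteq> 0" using cI pos by fastforce
        then obtain r where r: "r \<noteq> 0" "comb a b c d \<alpha> \<beta> 0 0 = r *\<^sub>R comb a b c d a0 b0 0 0"
          using span_singleton_eqD s(2) h(7) by metis
        then have ra: "\<alpha> = r * a0" "\<beta> = r * b0" unfolding comb_scale using cinj by blast+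
        \<comment> \<open>Since \<alpha> : \<beta> = a0 : b0, both (\<gamma>, \<delta>) and (c0, d0)
          solve the linear equation \<alpha> x = k \<beta> y, so they are proportional.\<close>
        have e: "\<gamma> * d0 = \<delta> * c0"
        proof (cases "a0 = 0")
          case True
          then have "b0 \<noteq> 0" "\<beta> \<noteq> 0" "\<alpha> = 0" using h r ra by auto
          then have "d0 = 0" "\<delta> = 0" using True h(8) g(6) k by auto
          then show ?thesis by simp
        next
          case False
          have "a0 * (\<gamma> * d0) * r = k * (\<beta> * \<delta>) * d0" using g(6) ra by (simp add: algebra_simps)
          also have "\<dots> = \<delta> * (k * (b0 * d0)) * r" using ra by simp
          also have "\<dots> = a0 * (\<delta> * c0) * r" unfolding h(8)[symmetric] by simp
          finally show ?thesis using False r by simp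
        qed
        define v where "v = (\<gamma> + \<delta>) / (c0 + d0)"
        have v: "\<gamma> = v * c0" "\<delta> = v * d0"
          using e h(6) by (simp_all add: v_def field_simps)
        have "p = span {comb a b c d (r * a0) (r * b0) (v * c0) (v * d0)}" using g(7) ra v by simp
        then have "p \<in> \<phi> ` ({s} \<times> circle)" unfolding h(9) using r by blast
        then obtain t' where t': "t' \<in> circle" "p = \<phi> (s, t')" by auto
        have "span {comb a b c d 0 \<beta> \<gamma> 0} \<in> \<phi> ` ({\<xi>b} \<times> Y)" unfolding bc segs using g pos by blast
        then obtain t where t: "t \<in> Y" "\<phi> (\<xi>b, t) = span {comb a b c d 0 \<beta> \<gamma> 0}" by auto
        obtain a1 b1 c1 d1 where h': "0 \<le> b1" "0 \<le> c1" "0 < b1 + c1" "0 \<le> d1" "0 \<le> a1" "0 < d1 + a1"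
          "\<phi> (\<xi>b, t) = span {comb a b c d 0 b1 c1 0}" "a1 * c1 = k * (b1 * d1)"
          "\<phi> ` (circle \<times> {t}) = {span {comb a b c d (v * a1) (u * b1) (u * c1) (v * d1)} | u v. u \<noteq> 0 \<or> v \<noteq> 0}"
          using lineT[OF t(1)] by (elim exE conjE) (rule that; assumption)
        have "comb a b c d 0 \<beta> \<gamma> 0 \<noteq> 0" using cI pos by fastforce
        then obtain r' where r': "r' \<noteq> 0" "comb a b c d 0 \<beta> \<gamma> 0 = r' *\<^sub>R comb a b c d 0 b1 c1 0"
          using span_singleton_eqD t(2) h'(7) by metis
        then have ra': "\<beta> = r' * b1" "\<gamma> = r' * c1" unfolding comb_scale using cinj by blast+
        have e': "\<alpha> * d1 = \<delta> * a1"
        proof (cases "c1 = 0")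
          case True
          then have "b1 \<noteq> 0" "\<beta> \<noteq> 0" "\<gamma> = 0" using h' r' ra' by auto
          then have "d1 = 0" "\<delta> = 0" using True h'(8) g(6) k by auto
          then show ?thesis by simp
        next
          case False
          have "c1 * (\<alpha> * d1) * r' = k * (\<beta> * \<delta>) * d1" using g(6) ra' by (simp add: algebra_simps)
          also have "\<dots> = \<delta> * (k * (b1 * d1)) * r'" using ra' by simp
          also have "\<dots> = c1 * (\<delta> * a1) * r'" unfolding h'(8)[symmetric] by simp
          finally show ?thesis using False r' by simp
        qed
        define v' where "v' = (\<alpha> + \<delta>) / (d1 + a1)"
        have v': "\<alpha> = v' * a1" "\<delta> = v' * d1"
          using e' h'(6) by (simp_all add: v'_def field_simps)
        have "p = span {comb a b c d (v' * a1) (r' * b1) (r' * c1) (v' * d1)}" using g(7) ra' v' by simp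
        then have "p \<in> \<phi> ` (circle \<times> {t})" unfolding h'(9) using r' by blast
        then obtain s' where s': "s' \<in> circle" "p = \<phi> (s', t)" by auto
        \<comment> \<open>So far p is on the line over s and on the line over t, with remaining
          parameters t' and s' somewhere on the circle. Injectivity puts them into the arcs.\<close>
        have "(s, t') = (s', t)"
        proof (rule inj_onD[OF P(2)])
          show "\<phi> (s, t') = \<phi> (s', t)" using t'(2) s'(2) by simp
          show "(s, t') \<in> circle \<times> circle" using t'(1) s(1) X(1) by blast
          show "(s', t) \<in> circle \<times> circle" using s'(1) t(1) Y(1) by blast
        qed
        then show ?thesis using s(1) t(1) t' by auto
      qed
    qed
  qed
  then show ?thesis using k by blast
qed

lemma doubleton_eqI: "x \<in> {a, b} \<Longrightarrow> y \<in> {a, b} \<Longrightarrow> x \<noteq> y \<Longrightarrow> {x, y} = {a, b}"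
  by auto

lemma patch_rotate': "k > 0 \<Longrightarrow> patch k b c d a = patch (1 / k) a b c d"
  using patch_rotate[of "1 / k" b c d a] by simp

text \<open>The boundary is given only as a set of four segments. After a rotation of the
  quadrilateral the side over cis \<gamma> is its first edge, and incidences identify the other
  sides; every rotation by one vertex inverts k.\<close>

lemma patch_of_hyperboloid_patch:
  assumes sk: "skew a b c d" and P: "hyperboloid_patch_with_boundary P {seg a b, seg b c, seg c d, seg d a}"
  shows "\<exists>k>0. P = affine_pt ` patch k a b c d"
proof -
  obtain H \<phi> \<alpha> \<beta> \<gamma> \<delta> where H: "hyperboloid H" and \<phi>: "asymptotic_parametrization H \<phi>"
    and ar: "\<alpha> < \<beta>" "\<beta> < \<alpha> + 2 * pi" "\<gamma> < \<delta>" "\<delta> < \<gamma> + 2 * pi"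
    and PP: "P = \<phi> ` (cis ` {\<alpha>..\<beta>} \<times> cis ` {\<gamma>..\<delta>})"
    and B: "{seg a b, seg b c, seg c d, seg d a} = {\<phi> ` (cis ` {\<alpha>..\<beta>} \<times> {cis \<gamma>}), \<phi> ` (cis ` {\<alpha>..\<beta>} \<times> {cis \<delta>}),
             \<phi> ` ({cis \<alpha>} \<times> cis ` {\<gamma>..\<delta>}), \<phi> ` ({cis \<beta>} \<times> cis ` {\<gamma>..\<delta>})}"
    using P unfolding hyperboloid_patch_with_boundary_def by (elim exE conjE) (rule that; assumption)
  define X Y where "X = cis ` {\<alpha>..\<beta>}" and "Y = cis ` {\<gamma>..\<delta>}"
  have XY: "X \<subseteq> circle" "Y \<subseteq> circle" "cis \<alpha> \<in> X" "cis \<beta> \<in> X" "cis \<gamma> \<in> Y" "cis \<delta> \<in> Y"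
    using ar by (auto simp: X_def Y_def)
  have mid: "cis ((\<alpha> + \<beta>) / 2) \<in> X" using ar by (auto simp: X_def)
  have mid': "cis ((\<alpha> + \<beta>) / 2) \<noteq> cis \<alpha>" "cis ((\<alpha> + \<beta>) / 2) \<noteq> cis \<beta>"
    using cis_eq_iff_arc[of \<alpha> "(\<alpha> + \<beta>) / 2" \<beta>] ar by auto
  \<comment> \<open>The upper bound is the mean of \<beta> and \<alpha> + 2 pi, which makes \<beta>
    an inner point of an arc shorter than a full turn; likewise for \<delta>.\<close>
  have ne: "cis \<alpha> \<noteq> cis \<beta>" "cis \<gamma> \<noteq> cis \<delta>"
    using cis_eq_iff_arc[of \<alpha> \<beta> "(\<beta> + (\<alpha> + 2 * pi)) / 2"] cis_eq_iff_arc[of \<gamma> \<delta> "(\<delta> + (\<gamma> + 2 * pi)) / 2"] ar by auto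
  have inj: "inj_on \<phi> (circle \<times> circle)" using asymptotic_parametrizationD(2)[OF \<phi>] .
  have Heq: "nondegenerate_quadric H" using H by (simp add: hyperboloid_def)
  let ?X1 = "\<phi> ` (X \<times> {cis \<gamma>})" and ?X2 = "\<phi> ` (X \<times> {cis \<delta>})" and ?Y1 = "\<phi> ` ({cis \<alpha>} \<times> Y)" and ?Y2 = "\<phi> ` ({cis \<beta>} \<times> Y)"
  have img_Int: "\<phi> ` M \<inter> \<phi> ` N = \<phi> ` (M \<inter> N)" if "M \<subseteq> circle \<times> circle" "N \<subseteq> circle \<times> circle" for M N
    using inj_on_image_Int[OF inj that] by simp
  have sq: "X \<times> {cis \<gamma>} \<subseteq> circle \<times> circle" "X \<times> {cis \<delta>} \<subseteq> circle \<times> circle"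
    "{cis \<alpha>} \<times> Y \<subseteq> circle \<times> circle" "{cis \<beta>} \<times> Y \<subseteq> circle \<times> circle" using XY by auto
  have dX: "?X1 \<inter> ?X2 = {}" using ne(2) by (subst img_Int[OF sq(1,2)]) auto
  have dY: "?Y1 \<inter> ?Y2 = {}" using ne(1) by (subst img_Int[OF sq(3,4)]) auto
  have pt: "?X1 \<inter> ?Y1 \<subseteq> {\<phi> (cis \<alpha>, cis \<gamma>)}" "?X1 \<inter> ?Y2 \<subseteq> {\<phi> (cis \<beta>, cis \<gamma>)}"
    "?X2 \<inter> ?Y1 \<subseteq> {\<phi> (cis \<alpha>, cis \<delta>)}" "?X2 \<inter> ?Y2 \<subseteq> {\<phi> (cis \<beta>, cis \<delta>)}"
    unfolding img_Int[OF sq(1,3)] img_Int[OF sq(1,4)] img_Int[OF sq(2,3)] img_Int[OF sq(2,4)] by auto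
  have main: "\<exists>k>0. P = affine_pt ` patch k p q r s"
    if sk: "skew p q r s" and B: "{seg p q, seg q r, seg r s, seg s p} = {?X1, ?X2, ?Y1, ?Y2}" and X1: "?X1 = seg p q" for p q r s
  proof -
    obtain A0 B0 C0 E0 where "skew_quad p q r s A0 B0 C0 E0" using skew_coordinates[OF sk] .
    then interpret q: skew_quad p q r s A0 B0 C0 E0 .
    have ends: "affine_pt x \<in> seg x y" "affine_pt y \<in> seg x y" for x y by (auto simp: seg_def)
    have pq: "p \<noteq> q" "r \<noteq> s"
    proof -
      show "p \<noteq> q" using q.coord(1)[of 1 "-1" 0 0] q.lin(1) by (auto simp: comb_def linear_0)
      show "r \<noteq> s" using q.coord(3)[of 0 0 1 "-1"] q.lin(3) by (auto simp: comb_def linear_0)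
    qed
    have two: "\<not> (seg x y \<subseteq> {z})" if "x \<noteq> y" for x y z
    proof
      assume sub: "seg x y \<subseteq> {z}"
      have "affine_pt x \<in> {z}" "affine_pt y \<in> {z}" by (rule subsetD[OF sub ends(1)], rule subsetD[OF sub ends(2)])
      then show False using that affine_pt_inj by blast
    qed
    \<comment> \<open>The sides over cis \<gamma> and cis \<delta> are disjoint, so the second
      contains neither p nor q and can only be rs.\<close>
    have "?X2 \<in> {seg p q, seg q r, seg r s, seg s p}" unfolding B by blast
    moreover
    have "affine_pt p \<in> ?X1" "affine_pt q \<in> ?X1" unfolding X1 by (rule ends)+
    then have "affine_pt p \<notin> ?X2" "affine_pt q \<notin> ?X2" using dX by auto
    then have "?X2 \<noteq> seg p q" "?X2 \<noteq> seg q r" "?X2 \<noteq> seg s p"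
      using ends(1)[of p q] ends(1)[of q r] ends(2)[of p s] by metis+
    ultimately have X2: "?X2 = seg r s" by blast
    \<comment> \<open>Sides of different families meet in at most one point, whereas a segment
      contains two; so a side of the second family is neither pq nor rs.\<close>
    have mem: "Z \<in> {seg q r, seg s p}" if Z: "Z \<in> {?Y1, ?Y2}" for Z
    proof -
      have "Z \<in> {seg p q, seg q r, seg r s, seg s p}" unfolding B using Z by blast
      moreover have "Z \<noteq> seg p q" using Z pt(1,2) X1 two[OF pq(1)] by (metis Int_absorb insertE singletonD)
      moreover have "Z \<noteq> seg r s" using Z pt(3,4) X2 two[OF pq(2)] by (metis Int_absorb insertE singletonD)
      ultimately show ?thesis by blast
    qed
    have neY: "?Y1 \<noteq> ?Y2" using dY XY(5) by blast
    have Y12: "{?Y1, ?Y2} = {seg q r, seg s p}" by (rule doubleton_eqI[OF mem mem neY]) simp_all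
    show ?thesis
      unfolding PP X_def[symmetric] Y_def[symmetric]
      by (rule q.patch_of_parametrization[OF Heq \<phi> XY(1,3,4) mid mid' XY(2,5,6) X1 X2 Y12])
  qed
  have B': "{seg a b, seg b c, seg c d, seg d a} = {?X1, ?X2, ?Y1, ?Y2}"
    using B by (simp add: X_def Y_def)
  have "?X1 \<in> {seg a b, seg b c, seg c d, seg d a}" unfolding B' by simp
  then consider "?X1 = seg a b" | "?X1 = seg b c" | "?X1 = seg c d" | "?X1 = seg d a" by blast
  then show ?thesis
  proof cases
    case 1 then show ?thesis using main[OF sk B'] by blast
  next
    case 2
    have "{seg b c, seg c d, seg d a, seg a b} = {?X1, ?X2, ?Y1, ?Y2}" using B' by (simp add: insert_commute)
    then obtain k where "k > 0" "P = affine_pt ` patch k b c d a" using main[OF skew_rotate[OF sk] _ 2] by blast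
    then show ?thesis by (intro exI[of _ "1 / k"]) (simp add: patch_rotate'[of k b c d a])
  next
    case 3
    have "{seg c d, seg d a, seg a b, seg b c} = {?X1, ?X2, ?Y1, ?Y2}" using B' by (simp add: insert_commute)
    then obtain k where "k > 0" "P = affine_pt ` patch k c d a b" using main[OF skew_rotate[OF skew_rotate[OF sk]] _ 3] by blast
    then show ?thesis using patch_rotate'[of k c d a b] patch_rotate'[of "1 / k" b c d a]
      by (intro exI[of _ k]) simp
  next
    case 4
    have "{seg d a, seg a b, seg b c, seg c d} = {?X1, ?X2, ?Y1, ?Y2}" using B' by (simp add: insert_commute)
    then obtain k where "k > 0" "P = affine_pt ` patch k d a b c"
      using main[OF skew_rotate[OF skew_rotate[OF skew_rotate[OF sk]]] _ 4] by blast
    then show ?thesis using patch_rotate[of k a b c d] by (intro exI[of _ "1 / k"]) simp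
  qed
qed

section \<open>A global asymptotic parametrization of the quadric through a skew quadrilateral\<close>

text \<open>Homogeneous coordinates for the circle as a projective line.\<close>

definition half_cos :: "complex \<Rightarrow> real" where "half_cos z = cos (Arg2pi z / 2)"
definition half_sin :: "complex \<Rightarrow> real" where "half_sin z = sin (Arg2pi z / 2)"

text \<open>An angle is determined up to multiples of 2 pi, its half up to multiples of pi; so the
  pair of cosine and sine is determined up to the common sign e. Only the projective point depends
  continuously on the point of the circle.\<close>

lemma half_angle_cis:
  obtains e :: real where "e \<noteq> 0" "half_cos (cis \<theta>) = e * cos (\<theta> / 2)" "half_sin (cis \<theta>) = e * sin (\<theta> / 2)"
proof -
  have "cis (Arg2pi (cis \<theta>)) = cis \<theta>"
    using Arg2pi_eq[of "cis \<theta>"] by (simp add: cis_conv_exp)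
  then have "cis (Arg2pi (cis \<theta>) - \<theta>) = 1" by (simp add: cis_divide[symmetric])
  then have "cos (Arg2pi (cis \<theta>) - \<theta>) = 1" by (metis cis.simps(1) one_complex.simps(1))
  then obtain n :: int where n: "Arg2pi (cis \<theta>) - \<theta> = of_int n * 2 * pi" by (auto simp: cos_one_2pi_int)
  then have h: "Arg2pi (cis \<theta>) / 2 = \<theta> / 2 + of_int n * pi" by (simp add: field_simps)
  have s: "sin (of_int n * pi) = 0" using sin_zero_iff_int2 by blast
  then have "cos (of_int n * pi) \<noteq> 0" using sin_zero_abs_cos_one[of "of_int n * pi"] by auto
  then show thesis using that[of "cos (of_int n * pi)"] unfolding half_cos_def half_sin_def h
    by (simp add: cos_add sin_add s)
qed

text \<open>Equality of the two products says that the sine of the difference of the half angles is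
  0, and this difference lies strictly between - pi and pi.\<close>

lemma half_angle_inj:
  assumes "z \<in> circle" "w \<in> circle" "half_cos z * half_sin w = half_sin z * half_cos w"
  shows "z = w"
proof -
  have "sin (Arg2pi w / 2 - Arg2pi z / 2) = 0"
    using assms(3) by (simp add: sin_diff half_cos_def half_sin_def mult.commute)
  moreover have "- pi < Arg2pi w / 2 - Arg2pi z / 2" "Arg2pi w / 2 - Arg2pi z / 2 < pi"
    using Arg2pi_ge_0[of z] Arg2pi_lt_2pi[of z] Arg2pi_ge_0[of w] Arg2pi_lt_2pi[of w] by linarith+
  ultimately have "Arg2pi w / 2 - Arg2pi z / 2 = 0" using sin_eq_0_pi by blast
  then have "Arg2pi z = Arg2pi w" by simp
  then show ?thesis using assms(1,2) Arg2pi_eq[of z] Arg2pi_eq[of w] by simp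
qed

lemma half_angle_nonzero: "half_cos z \<noteq> 0 \<or> half_sin z \<noteq> 0"
  unfolding half_cos_def half_sin_def using sin_zero_abs_cos_one[of "Arg2pi z / 2"] by auto

lemma half_angle_surj:
  assumes "s \<noteq> 0 \<or> t \<noteq> 0"
  obtains z r where "z \<in> circle" "r \<noteq> 0" "s = r * half_cos z" "t = r * half_sin z"
proof -
  define l where "l = sqrt (s\<^sup>2 + t\<^sup>2)"
  have l: "l \<noteq> 0" using assms by (simp add: l_def sum_power2_eq_zero_iff)
  have "(s / l)\<^sup>2 + (t / l)\<^sup>2 = (s\<^sup>2 + t\<^sup>2) / l\<^sup>2" by (simp add: power_divide add_divide_distrib)
  also have "\<dots> = 1" using l by (simp add: l_def sum_power2_eq_zero_iff)
  finally obtain \<psi> where \<psi>: "s / l = cos \<psi>" "t / l = sin \<psi>" using sincos_total_2pi by metis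
  obtain e where e: "e \<noteq> 0" "half_cos (cis (2 * \<psi>)) = e * cos (2 * \<psi> / 2)" "half_sin (cis (2 * \<psi>)) = e * sin (2 * \<psi> / 2)"
    using half_angle_cis by blast
  show thesis
  proof (rule that[of "cis (2 * \<psi>)" "l / e"])
    show "s = l / e * half_cos (cis (2 * \<psi>))" "t = l / e * half_sin (cis (2 * \<psi>))"
      using e \<psi> l by (simp_all add: field_simps)
  qed (use e l in auto)
qed

text \<open>The Segre embedding of a product of two projective lines, in the coordinates of a, b, c,
  d and with the factor k at a as in \<open>patch_param\<close>.\<close>

definition torus_vec :: "real \<Rightarrow> real^3 \<Rightarrow> real^3 \<Rightarrow> real^3 \<Rightarrow> real^3 \<Rightarrow> real \<Rightarrow> real \<Rightarrow> real \<Rightarrow> real \<Rightarrow> real^4" where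
  "torus_vec k a b c d s0 s1 t0 t1 = comb a b c d (k * (s0 * t0)) (s1 * t0) (s1 * t1) (s0 * t1)"

definition torus_map :: "real \<Rightarrow> real^3 \<Rightarrow> real^3 \<Rightarrow> real^3 \<Rightarrow> real^3 \<Rightarrow> complex \<times> complex \<Rightarrow> ppoint" where
  "torus_map k a b c d = (\<lambda>(z, w). span {torus_vec k a b c d (half_cos z) (half_sin z) (half_cos w) (half_sin w)})"

lemma torus_vec_scale:
  "torus_vec k a b c d (r * s0) (r * s1) (r' * t0) (r' * t1) = (r * r') *\<^sub>R torus_vec k a b c d s0 s1 t0 t1"
  by (simp add: torus_vec_def comb_scale algebra_simps)

lemma torus_map_cis: "torus_map k a b c d (cis \<theta>, cis \<psi>)
   = span {torus_vec k a b c d (cos (\<theta> / 2)) (sin (\<theta> / 2)) (cos (\<psi> / 2)) (sin (\<psi> / 2))}"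
proof -
  obtain e where e: "e \<noteq> 0" "half_cos (cis \<theta>) = e * cos (\<theta> / 2)" "half_sin (cis \<theta>) = e * sin (\<theta> / 2)"
    using half_angle_cis by blast
  obtain e' where e': "e' \<noteq> 0" "half_cos (cis \<psi>) = e' * cos (\<psi> / 2)" "half_sin (cis \<psi>) = e' * sin (\<psi> / 2)"
    using half_angle_cis by blast
  show ?thesis unfolding torus_map_def prod.case e(2,3) e'(2,3) torus_vec_scale
    using e(1) e'(1) by (simp add: span_singleton_scale)
qed

lemma torus_map_direction:
  assumes "s0 \<noteq> 0 \<or> s1 \<noteq> 0" "t0 \<noteq> 0 \<or> t1 \<noteq> 0"
  obtains z w where "z \<in> circle" "w \<in> circle" "torus_map k a b c d (z, w) = span {torus_vec k a b c d s0 s1 t0 t1}"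
proof -
  obtain z r where z: "z \<in> circle" "r \<noteq> 0" "s0 = r * half_cos z" "s1 = r * half_sin z" using half_angle_surj[OF assms(1)] .
  obtain w r' where w: "w \<in> circle" "r' \<noteq> 0" "t0 = r' * half_cos w" "t1 = r' * half_sin w" using half_angle_surj[OF assms(2)] .
  show thesis
    by (rule that[OF z(1) w(1)]) (use z w in \<open>simp add: torus_map_def torus_vec_scale span_singleton_scale\<close>)
qed

context skew_quad
begin

definition quadric :: "real \<Rightarrow> ppoint set" where
  "quadric k = {span {x} | x. x \<noteq> 0 \<and> A x * C x = k * (B x * E x)}"

lemma comb_eq_0: "comb a b c d \<alpha> \<beta> \<gamma> \<delta> = 0 \<Longrightarrow> \<alpha> = 0 \<and> \<beta> = 0 \<and> \<gamma> = 0 \<and> \<delta> = 0"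
  using coord[of \<alpha> \<beta> \<gamma> \<delta>] lin by (simp add: linear_0)

lemma comb_eqD: "comb a b c d \<alpha> \<beta> \<gamma> \<delta> = comb a b c d \<alpha>' \<beta>' \<gamma>' \<delta>' \<Longrightarrow> \<alpha> = \<alpha>' \<and> \<beta> = \<beta>' \<and> \<gamma> = \<gamma>' \<and> \<delta> = \<delta>'"
  by (metis coord)

lemma quadric_nondegenerate:
  assumes k: "k > 0" shows "nondegenerate_quadric (quadric k)"
proof -
  define vec where "vec F = (\<Sum>i\<in>Basis. F i *\<^sub>R i)" for F :: "real^4 \<Rightarrow> real"
  have vec: "x \<bullet> vec F = F x" if "linear F" for F x
  proof -
    have "F x = F (\<Sum>i\<in>Basis. (x \<bullet> i) *\<^sub>R i)" by (simp add: euclidean_representation)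
    also have "\<dots> = (\<Sum>i\<in>Basis. (x \<bullet> i) * F i)" using that by (simp add: linear_sum linear_scale)
    finally show ?thesis by (simp add: vec_def inner_sum_right mult.commute)
  qed
  \<comment> \<open>The operator of the polar form, normalized by x \<bullet> f x = 2 (A x C x - k B
    x E x); \<open>vec F\<close> represents the linear form F as an inner product.\<close>
  define f where "f y = C y *\<^sub>R vec A + A y *\<^sub>R vec C - k *\<^sub>R (E y *\<^sub>R vec B + B y *\<^sub>R vec E)" for y
  have lf: "linear f"
    by (rule linearI) (simp_all add: f_def lin linear_add linear_scale algebra_simps)
  have bf: "x \<bullet> f y = A x * C y + C x * A y - k * (B x * E y + E x * B y)" for x y
    by (simp add: f_def inner_add_right inner_diff_right vec lin algebra_simps)
  define M where "M = matrix f"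
  have M: "M *v y = f y" for y using fun_cong[OF matrix_vector_mul(2)[OF lf]] by (simp add: M_def)
  have "transpose M = M"
  proof -
    have "axis i 1 \<bullet> f (axis j 1) = axis j 1 \<bullet> f (axis i (1::real))" for i j :: 4
      unfolding bf by (simp add: mult.commute)
    then show ?thesis unfolding M_def matrix_def transpose_def by (simp add: inner_axis' vec_eq_iff)
  qed
  moreover have "det M \<noteq> 0"
  proof -
    have "y = 0" if "f y = 0" for y
    proof -
      have z: "A x * C y + C x * A y - k * (B x * E y + E x * B y) = 0" for x
        unfolding bf[symmetric] that by simp
      have cs: "A (comb a b c d 1 0 0 0) = 1" "B (comb a b c d 1 0 0 0) = 0" "C (comb a b c d 1 0 0 0) = 0" "E (comb a b c d 1 0 0 0) = 0"
        by (simp_all only: coord)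
      have "C y = 0" using z[of "comb a b c d 1 0 0 0"] by (simp only: coord) simp
      moreover have "A y = 0" using z[of "comb a b c d 0 0 1 0"] by (simp only: coord) simp
      moreover have "E y = 0" using z[of "comb a b c d 0 1 0 0"] k by (simp only: coord) simp
      moreover have "B y = 0" using z[of "comb a b c d 0 0 0 1"] k by (simp only: coord) simp
      ultimately show ?thesis using comb_coord[of y] by (simp add: comb_def)
    qed
    then have "inj f" using lf by (simp add: linear_injective_0)
    then show ?thesis using det_nz_iff_inj[OF lf] by (simp add: M_def)
  qed
  moreover have "quadric k = {span {x} | x. x \<noteq> 0 \<and> x \<bullet> (M *v x) = 0}"
  proof -
    have "x \<bullet> (M *v x) = 0 \<longleftrightarrow> A x * C x = k * (B x * E x)" for x
    proof -
      have "x \<bullet> (M *v x) = 2 * (A x * C x - k * (B x * E x))" unfolding M bf by (simp add: algebra_simps)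
      then show ?thesis by simp
    qed
    then show ?thesis by (simp add: quadric_def)
  qed
  ultimately show ?thesis unfolding nondegenerate_quadric_def by blast
qed

context
  fixes k :: real assumes k: "k > 0"
begin

abbreviation "\<Phi> \<equiv> torus_map k a b c d"
abbreviation "vt \<equiv> torus_vec k a b c d"

lemma vt_nonzero: "s0 \<noteq> 0 \<or> s1 \<noteq> 0 \<Longrightarrow> t0 \<noteq> 0 \<or> t1 \<noteq> 0 \<Longrightarrow> vt s0 s1 t0 t1 \<noteq> 0"
  using comb_eq_0[of "k * (s0 * t0)" "s1 * t0" "s1 * t1" "s0 * t1"] k unfolding torus_vec_def by fastforce

lemma torus_map_range: "\<Phi> ` (circle \<times> circle) = quadric k"
proof
  show "\<Phi> ` (circle \<times> circle) \<subseteq> quadric k"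
  proof clarify
    fix z w :: complex
    let ?x = "vt (half_cos z) (half_sin z) (half_cos w) (half_sin w)"
    have "?x \<noteq> 0" by (intro vt_nonzero half_angle_nonzero)
    moreover have "A ?x * C ?x = k * (B ?x * E ?x)" unfolding torus_vec_def coord by simp
    ultimately show "\<Phi> (z, w) \<in> quadric k" unfolding quadric_def torus_map_def prod.case by blast
  qed
  show "quadric k \<subseteq> \<Phi> ` (circle \<times> circle)"
  proof
    fix p assume "p \<in> quadric k"
    then obtain x where x: "x \<noteq> 0" "A x * C x = k * (B x * E x)" "p = span {x}" by (auto simp: quadric_def)
    obtain s0 s1 t0 t1 where st: "s0 \<noteq> 0 \<or> s1 \<noteq> 0" "t0 \<noteq> 0 \<or> t1 \<noteq> 0" "span {x} = span {vt s0 s1 t0 t1}"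
    proof (cases "A x = 0 \<and> B x = 0")
      case True
      then have cx: "x = comb a b c d 0 0 (C x) (E x)" using comb_coord[of x] by simp
      then have "E x \<noteq> 0 \<or> C x \<noteq> 0" using x(1) by (auto simp: comb_def)
      moreover have "x = vt (E x) (C x) 0 1" using cx by (simp add: torus_vec_def)
      ultimately show ?thesis using that[of "E x" "C x" 0 1] by simp
    next
      case False
      \<comment> \<open>The equation of the quadric says E : A = C : k B. This ratio is the second
        parameter, and t0 = 1/k cancels the factor k in \<open>torus_vec\<close>.\<close>
      define t where "t = (if A x \<noteq> 0 then E x / A x else C x / (k * B x))"
      have t: "C x = k * B x * t" "E x = A x * t"
        using False x(2) k by (auto simp: t_def field_simps)
      have "x = vt (A x) (k * B x) (1 / k) t"
        using comb_coord[of x] k t by (simp add: torus_vec_def)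
      then show ?thesis using that[of "A x" "k * B x" "1 / k" t] False k by simp
    qed
    obtain z w where "z \<in> circle" "w \<in> circle" "\<Phi> (z, w) = span {vt s0 s1 t0 t1}"
      using torus_map_direction[OF st(1,2)] .
    then show "p \<in> \<Phi> ` (circle \<times> circle)" using st(3) x(3) by (intro image_eqI[of _ _ "(z,w)"]) auto
  qed
qed

lemma torus_map_inj: "inj_on \<Phi> (circle \<times> circle)"
proof (rule inj_onI, clarify)
  fix z w z' w' assume c: "z \<in> circle" "w \<in> circle" "z' \<in> circle" "w' \<in> circle" and eq: "\<Phi> (z, w) = \<Phi> (z', w')"
  have nz: "vt (half_cos z) (half_sin z) (half_cos w) (half_sin w) \<noteq> 0" by (intro vt_nonzero half_angle_nonzero)
  define s0 s1 t0 t1 where st: "s0 = half_cos z" "s1 = half_sin z" "t0 = half_cos w" "t1 = half_sin w"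
  define p0 p1 q0 q1 where pq: "p0 = half_cos z'" "p1 = half_sin z'" "q0 = half_cos w'" "q1 = half_sin w'"
  obtain r where "vt s0 s1 t0 t1 = r *\<^sub>R vt p0 p1 q0 q1"
    using span_singleton_eqD[OF _ nz] eq unfolding torus_map_def prod.case st pq by metis
  then have "k * (s0 * t0) = r * (k * (p0 * q0)) \<and> s1 * t0 = r * (p1 * q0) \<and> s1 * t1 = r * (p1 * q1) \<and> s0 * t1 = r * (p0 * q1)"
    unfolding torus_vec_def comb_scale by (rule comb_eqD)
  then have e: "s0 * t0 = r * (p0 * q0)" "s1 * t0 = r * (p1 * q0)" "s1 * t1 = r * (p1 * q1)" "s0 * t1 = r * (p0 * q1)"
    using k by auto
  have nz: "s0 \<noteq> 0 \<or> s1 \<noteq> 0" "t0 \<noteq> 0 \<or> t1 \<noteq> 0" unfolding st by (rule half_angle_nonzero)+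
  have "t0 * (s0 * p1 - s1 * p0) = 0" "t1 * (s0 * p1 - s1 * p0) = 0"
  proof -
    have "(s0 * t0) * p1 = (s1 * t0) * p0" "(s0 * t1) * p1 = (s1 * t1) * p0" unfolding e by simp_all
    then show "t0 * (s0 * p1 - s1 * p0) = 0" "t1 * (s0 * p1 - s1 * p0) = 0" by (simp_all add: algebra_simps)
  qed
  then have "s0 * p1 = s1 * p0" using nz by auto
  then have zz: "z = z'" using half_angle_inj[OF c(1,3)] by (simp add: st pq)
  have "s0 * (t0 * q1 - t1 * q0) = 0" "s1 * (t0 * q1 - t1 * q0) = 0"
  proof -
    have "(s0 * t0) * q1 = (s0 * t1) * q0" "(s1 * t0) * q1 = (s1 * t1) * q0" unfolding e by simp_all
    then show "s0 * (t0 * q1 - t1 * q0) = 0" "s1 * (t0 * q1 - t1 * q0) = 0" by (simp_all add: algebra_simps)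
  qed
  then have "t0 * q1 = t1 * q0" using nz by auto
  then have "w = w'" using half_angle_inj[OF c(2,4)] by (simp add: st pq)
  then show "z = z' \<and> w = w'" using zz by simp
qed

text \<open>\<open>half_cos\<close> jumps at 1, so continuity is checked on angles: the points of
  the torus not mapped into a given open set are the image of a compact set K of pairs of angles,
  hence a closed set.\<close>

lemma torus_map_continuous:
  "continuous_map (prod_topology (top_of_set circle) (top_of_set circle)) (subtopology RP3_topology (quadric k)) \<Phi>"
proof -
  have top: "prod_topology (top_of_set circle) (top_of_set circle) = top_of_set (circle \<times> circle)"
    by (simp add: prod_topology_subtopology_eu)
  have sub: "\<Phi> ` (circle \<times> circle) \<subseteq> RP3"
    unfolding torus_map_range by (auto simp: quadric_def span_in_RP3)
  have "openin (top_of_set (circle \<times> circle)) {x \<in> circle \<times> circle. \<Phi> x \<in> U}" if U: "openin RP3_topology U" for U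
  proof -
    define O' where "O' = {x. x \<noteq> 0 \<and> span {x} \<in> U}"
    have O': "open O'" using U by (simp add: openin_RP3_topology O'_def)
    define F where "F = (\<lambda>(\<theta>,\<psi>). vt (cos (\<theta>/2)) (sin (\<theta>/2)) (cos (\<psi>/2)) (sin (\<psi>/2)))"
    have F: "continuous_on UNIV F" unfolding F_def torus_vec_def comb_def case_prod_beta
      by (intro continuous_intros) auto
    have F0: "F p \<noteq> 0" for p
    proof (cases p)
      case (Pair \<theta> \<psi>)
      have "cos x \<noteq> 0 \<or> sin x \<noteq> 0" for x :: real using sin_zero_abs_cos_one[of x] by auto
      then show ?thesis unfolding F_def Pair prod.case by (intro vt_nonzero)
    qed
    define K where "K = {0..2*pi} \<times> {0..2*pi} \<inter> F -` (- O')"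
    have "closed (F -` (- O'))" using F O' by (simp add: continuous_on_closed_vimage closed_Compl)
    then have "compact K" unfolding K_def by (intro compact_Int_closed compact_Times) auto
    moreover have "continuous_on K (\<lambda>(\<theta>,\<psi>). (cis \<theta>, cis \<psi>))" unfolding case_prod_beta
      by (intro continuous_intros)
    ultimately have "compact ((\<lambda>(\<theta>,\<psi>). (cis \<theta>, cis \<psi>)) ` K)" by (metis compact_continuous_image)
    then have cl: "closed ((\<lambda>(\<theta>,\<psi>). (cis \<theta>, cis \<psi>)) ` K)" by (rule compact_imp_closed)
    have inU: "\<Phi> (cis \<theta>, cis \<psi>) \<in> U \<longleftrightarrow> F (\<theta>,\<psi>) \<in> O'" for \<theta> \<psi>
      using F0[of "(\<theta>,\<psi>)"] unfolding O'_def torus_map_cis F_def by simp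
    have "{x \<in> circle \<times> circle. \<Phi> x \<in> U} = (circle \<times> circle) \<inter> - ((\<lambda>(\<theta>,\<psi>). (cis \<theta>, cis \<psi>)) ` K)"
    proof (intro set_eqI iffI)
      fix x assume "x \<in> {x \<in> circle \<times> circle. \<Phi> x \<in> U}"
      then show "x \<in> (circle \<times> circle) \<inter> - ((\<lambda>(\<theta>,\<psi>). (cis \<theta>, cis \<psi>)) ` K)"
        using inU by (auto simp: K_def)
    next
      fix x assume x: "x \<in> (circle \<times> circle) \<inter> - ((\<lambda>(\<theta>,\<psi>). (cis \<theta>, cis \<psi>)) ` K)"
      obtain z w where zw: "x = (z, w)" "z \<in> circle" "w \<in> circle" using x by (cases x) auto
      have ar: "cis (Arg2pi y) = y \<and> Arg2pi y \<in> {0..2*pi}" if "y \<in> circle" for y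
        using that Arg2pi_eq[of y] Arg2pi_ge_0[of y] Arg2pi_lt_2pi[of y] by (simp add: cis_conv_exp)
      have "(Arg2pi z, Arg2pi w) \<notin> K"
      proof
        assume "(Arg2pi z, Arg2pi w) \<in> K"
        then have "(\<lambda>(\<theta>,\<psi>). (cis \<theta>, cis \<psi>)) (Arg2pi z, Arg2pi w) \<in> (\<lambda>(\<theta>,\<psi>). (cis \<theta>, cis \<psi>)) ` K" by (rule imageI)
        then show False using x zw ar by simp
      qed
      then have "F (Arg2pi z, Arg2pi w) \<in> O'" using ar zw by (auto simp: K_def)
      then show "x \<in> {x \<in> circle \<times> circle. \<Phi> x \<in> U}" using inU[of "Arg2pi z" "Arg2pi w"] ar zw by simp
    qed
    then show ?thesis using cl by (simp add: openin_open_Int open_Compl)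
  qed
  then have "continuous_map (top_of_set (circle \<times> circle)) RP3_topology \<Phi>"
    unfolding continuous_map_def topspace_RP3 using sub by auto
  then show ?thesis unfolding top by (simp add: continuous_map_in_subtopology torus_map_range Pi_iff image_subset_iff[symmetric] image_subset_iff_funcset[symmetric])
qed

lemma torus_map_lines:
  assumes "t \<in> circle"
  shows "proj_line (\<Phi> ` (circle \<times> {t}))" "proj_line (\<Phi> ` ({t} \<times> circle))"
proof -
  have st: "half_cos t \<noteq> 0 \<or> half_sin t \<noteq> 0" by (rule half_angle_nonzero)
  define x y where "x = vt 1 0 (half_cos t) (half_sin t)" and "y = vt 0 1 (half_cos t) (half_sin t)"
  have xy: "u *\<^sub>R x + v *\<^sub>R y = vt u v (half_cos t) (half_sin t)" for u v
    by (simp add: x_def y_def torus_vec_def comb_scale comb_add algebra_simps)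
  have "\<Phi> ` (circle \<times> {t}) = {span {u *\<^sub>R x + v *\<^sub>R y} | u v. u \<noteq> 0 \<or> v \<noteq> 0}"
  proof
    show "\<Phi> ` (circle \<times> {t}) \<subseteq> {span {u *\<^sub>R x + v *\<^sub>R y} | u v. u \<noteq> 0 \<or> v \<noteq> 0}"
      unfolding xy torus_map_def using half_angle_nonzero by auto
    show "{span {u *\<^sub>R x + v *\<^sub>R y} | u v. u \<noteq> 0 \<or> v \<noteq> 0} \<subseteq> \<Phi> ` (circle \<times> {t})"
    proof clarify
      fix u v :: real assume "u \<noteq> 0 \<or> v \<noteq> 0"
      then obtain z r where z: "z \<in> circle" "r \<noteq> 0" "u = r * half_cos z" "v = r * half_sin z" by (rule half_angle_surj)
      have "span {u *\<^sub>R x + v *\<^sub>R y} = \<Phi> (z, t)"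
        using torus_vec_scale[of k a b c d r "half_cos z" "half_sin z" 1 "half_cos t" "half_sin t"] span_singleton_scale[OF z(2)]
        unfolding xy z(3,4) torus_map_def by simp
      then show "span {u *\<^sub>R x + v *\<^sub>R y} \<in> \<Phi> ` (circle \<times> {t})" using z(1) by simp
    qed
  qed
  moreover have "u = 0 \<and> v = 0" if "u *\<^sub>R x + v *\<^sub>R y = 0" for u v
    using that vt_nonzero[OF _ st] unfolding xy by blast
  ultimately show "proj_line (\<Phi> ` (circle \<times> {t}))" using proj_line_pair[of x y] by simp
next
  have st: "half_cos t \<noteq> 0 \<or> half_sin t \<noteq> 0" by (rule half_angle_nonzero)
  define x y where "x = vt (half_cos t) (half_sin t) 1 0" and "y = vt (half_cos t) (half_sin t) 0 1"
  have xy: "u *\<^sub>R x + v *\<^sub>R y = vt (half_cos t) (half_sin t) u v" for u v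
    by (simp add: x_def y_def torus_vec_def comb_scale comb_add algebra_simps)
  have "\<Phi> ` ({t} \<times> circle) = {span {u *\<^sub>R x + v *\<^sub>R y} | u v. u \<noteq> 0 \<or> v \<noteq> 0}"
  proof
    show "\<Phi> ` ({t} \<times> circle) \<subseteq> {span {u *\<^sub>R x + v *\<^sub>R y} | u v. u \<noteq> 0 \<or> v \<noteq> 0}"
      unfolding xy torus_map_def using half_angle_nonzero by auto
    show "{span {u *\<^sub>R x + v *\<^sub>R y} | u v. u \<noteq> 0 \<or> v \<noteq> 0} \<subseteq> \<Phi> ` ({t} \<times> circle)"
    proof clarify
      fix u v :: real assume "u \<noteq> 0 \<or> v \<noteq> 0"
      then obtain z r where z: "z \<in> circle" "r \<noteq> 0" "u = r * half_cos z" "v = r * half_sin z" by (rule half_angle_surj)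
      have "span {u *\<^sub>R x + v *\<^sub>R y} = \<Phi> (t, z)"
        using torus_vec_scale[of k a b c d 1 "half_cos t" "half_sin t" r "half_cos z" "half_sin z"] span_singleton_scale[OF z(2)]
        unfolding xy z(3,4) torus_map_def by simp
      then show "span {u *\<^sub>R x + v *\<^sub>R y} \<in> \<Phi> ` ({t} \<times> circle)" using z(1) by simp
    qed
  qed
  moreover have "u = 0 \<and> v = 0" if "u *\<^sub>R x + v *\<^sub>R y = 0" for u v
    using that vt_nonzero[OF st] unfolding xy by blast
  ultimately show "proj_line (\<Phi> ` ({t} \<times> circle))" using proj_line_pair[of x y] by simp
qed

text \<open>A continuous bijection from the compact torus onto a Hausdorff space is a
  homeomorphism.\<close>

lemma torus_map_asymptotic: "asymptotic_parametrization (quadric k) \<Phi>"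
  unfolding asymptotic_parametrization_def
proof (intro conjI ballI)
  show "homeomorphic_map (prod_topology (top_of_set circle) (top_of_set circle)) (subtopology RP3_topology (quadric k)) \<Phi>"
  proof (rule continuous_imp_homeomorphic_map)
    show "compact_space (prod_topology (top_of_set circle) (top_of_set (circle :: complex set)))"
      unfolding compact_space_prod_topology by (simp add: compact_space_subtopology)
    show "Hausdorff_space (subtopology RP3_topology (quadric k))"
      by (rule Hausdorff_space_subtopology[OF Hausdorff_RP3])
    have "quadric k \<subseteq> RP3" by (auto simp: quadric_def span_in_RP3)
    then show "\<Phi> ` topspace (prod_topology (top_of_set circle) (top_of_set circle)) = topspace (subtopology RP3_topology (quadric k))"
      by (auto simp: torus_map_range topspace_RP3)
    show "inj_on \<Phi> (topspace (prod_topology (top_of_set circle) (top_of_set circle)))"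
      using torus_map_inj by simp
  qed (rule torus_map_continuous)
qed (use torus_map_lines in auto)

lemma quadric_hyperboloid: "hyperboloid (quadric k)"
proof -
  have ruled: "\<exists>L L'. L \<noteq> L' \<and> proj_line L \<and> proj_line L' \<and> p \<in> L \<and> p \<in> L' \<and> L \<subseteq> quadric k \<and> L' \<subseteq> quadric k"
    if "p \<in> quadric k" for p
  proof -
    obtain z w where zw: "z \<in> circle" "w \<in> circle" "p = \<Phi> (z, w)" using \<open>p \<in> quadric k\<close> torus_map_range by blast
    let ?L = "\<Phi> ` (circle \<times> {w})" and ?L' = "\<Phi> ` ({z} \<times> circle)"
    have "\<Phi> (- z, w) \<in> ?L" using zw by auto
    moreover have "\<Phi> (- z, w) \<notin> ?L'"
    proof
      assume "\<Phi> (- z, w) \<in> ?L'"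
      then obtain v where v: "v \<in> circle" "\<Phi> (- z, w) = \<Phi> (z, v)" by auto
      have "(- z, w) = (z, v)" by (rule inj_onD[OF torus_map_inj v(2)]) (use zw v in auto)
      then show False using zw(1) by auto
    qed
    ultimately have "?L \<noteq> ?L'" by blast
    moreover have "?L \<subseteq> quadric k" "?L' \<subseteq> quadric k" unfolding torus_map_range[symmetric] using zw by (auto intro!: image_mono)
    moreover have "p \<in> ?L" "p \<in> ?L'" using zw by auto
    moreover note torus_map_lines(1)[OF zw(2)] torus_map_lines(2)[OF zw(1)]
    ultimately show ?thesis by (intro exI[of _ ?L] exI[of _ ?L'] conjI)
  qed
  have ne: "quadric k \<noteq> {}" unfolding torus_map_range[symmetric] by (auto intro!: exI[of _ 1])
  show ?thesis unfolding hyperboloid_def doubly_ruled_def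
    by (intro conjI ballI ruled ne quadric_nondegenerate[OF k])
qed

end

end

text \<open>On the arc from 0 to pi the half angle runs through a quarter circle, where (cos, sin)
  is a positive multiple of some (1 - u, u). This matches half circles of the torus with the unit
  interval of the rational parametrization.\<close>

lemma quarter_circle:
  "\<theta> \<in> {0..pi} \<Longrightarrow> \<exists>u\<in>{0..1}. \<exists>r>0. cos (\<theta> / 2) = r * (1 - u) \<and> sin (\<theta> / 2) = r * u"
  "u \<in> {0..1} \<Longrightarrow> \<exists>\<theta>\<in>{0..pi}. \<exists>r>0. cos (\<theta> / 2) = r * (1 - u) \<and> sin (\<theta> / 2) = r * u"
proof -
  assume \<theta>: "\<theta> \<in> {0..pi}"
  have nn: "cos (\<theta> / 2) \<ge> 0" "sin (\<theta> / 2) \<ge> 0" using \<theta> by (auto intro!: cos_ge_zero sin_ge_zero)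
  define r where "r = cos (\<theta> / 2) + sin (\<theta> / 2)"
  have "r \<noteq> 0"
  proof
    assume "r = 0"
    then have "cos (\<theta> / 2) = 0" "sin (\<theta> / 2) = 0" using nn by (auto simp: r_def)
    then show False using sin_zero_abs_cos_one[of "\<theta> / 2"] by auto
  qed
  then have r: "r > 0" using nn by (simp add: r_def)
  show "\<exists>u\<in>{0..1}. \<exists>r>0. cos (\<theta> / 2) = r * (1 - u) \<and> sin (\<theta> / 2) = r * u"
    by (rule bexI[of _ "sin (\<theta> / 2) / r"], rule exI[of _ r]) (use r nn in \<open>auto simp: r_def field_simps\<close>)
next
  assume u: "u \<in> {0..1::real}"
  define l where "l = sqrt ((1 - u)\<^sup>2 + u\<^sup>2)"
  have "(1 - u)\<^sup>2 + u\<^sup>2 > 0" using sum_power2_gt_zero_iff[of "1 - u" u] by auto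
  then have l: "l > 0" "l\<^sup>2 = (1 - u)\<^sup>2 + u\<^sup>2" by (simp_all add: l_def)
  have "((1 - u) / l)\<^sup>2 + (u / l)\<^sup>2 = 1" using l by (simp add: power_divide add_divide_distrib[symmetric])
  then obtain t where t: "0 \<le> t" "t \<le> pi/2" "(1 - u) / l = cos t" "u / l = sin t"
    using sincos_total_pi_half[of "(1 - u) / l" "u / l"] u l by auto
  show "\<exists>\<theta>\<in>{0..pi}. \<exists>r>0. cos (\<theta> / 2) = r * (1 - u) \<and> sin (\<theta> / 2) = r * u"
    by (rule bexI[of _ "2 * t"], rule exI[of _ "1 / l"]) (use t l in auto)
qed

lemma seg_weighted:
  assumes "m > 0" "n > 0"
  shows "seg p q = {span {(m * (1 - u)) *\<^sub>R hom p + (n * u) *\<^sub>R hom q} | u. u \<in> {0..1}}"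
proof
  show "seg p q \<subseteq> {span {(m * (1 - u)) *\<^sub>R hom p + (n * u) *\<^sub>R hom q} | u. u \<in> {0..1}}"
    unfolding seg_eq
  proof clarify
    fix s t :: real assume st: "0 \<le> s" "0 \<le> t" "0 < s + t"
    define l where "l = s / m + t / n"
    have "0 \<le> s / m" "0 \<le> t / n" "s / m \<noteq> 0 \<or> t / n \<noteq> 0" using st assms by auto
    then have l: "l > 0" unfolding l_def by linarith
    define u where "u = t / n / l"
    have "1 - u = (l - t / n) / l" using l by (simp add: u_def diff_divide_distrib)
    then have u1: "1 - u = s / m / l" by (simp add: l_def)
    have "0 \<le> 1 - u" unfolding u1 using st assms l by simp
    moreover have "0 \<le> u" unfolding u_def using st assms l by simp
    ultimately have "u \<in> {0..1}" by simp
    moreover have "s = l * (m * (1 - u))" "t = l * (n * u)" unfolding u1 using l assms by (simp_all add: u_def)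
    then have "s *\<^sub>R hom p + t *\<^sub>R hom q = l *\<^sub>R ((m * (1 - u)) *\<^sub>R hom p + (n * u) *\<^sub>R hom q)"
      by (simp add: scaleR_add_right)
    then have "span {s *\<^sub>R hom p + t *\<^sub>R hom q} = span {(m * (1 - u)) *\<^sub>R hom p + (n * u) *\<^sub>R hom q}"
      using l by (simp add: span_singleton_scale)
    ultimately show "\<exists>u. span {s *\<^sub>R hom p + t *\<^sub>R hom q} = span {(m * (1 - u)) *\<^sub>R hom p + (n * u) *\<^sub>R hom q} \<and> u \<in> {0..1}"
      by blast
  qed
  show "{span {(m * (1 - u)) *\<^sub>R hom p + (n * u) *\<^sub>R hom q} | u. u \<in> {0..1}} \<subseteq> seg p q"
    unfolding seg_eq
  proof clarify
    fix u :: real assume u: "u \<in> {0..1}"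
    have "0 \<le> m * (1 - u)" "0 \<le> n * u" using u assms by auto
    moreover have "m * (1 - u) \<noteq> 0 \<or> n * u \<noteq> 0" using u assms by auto
    ultimately have "0 < m * (1 - u) + n * u" by linarith
    then show "\<exists>s t. span {(m * (1 - u)) *\<^sub>R hom p + (n * u) *\<^sub>R hom q} = span {s *\<^sub>R hom p + t *\<^sub>R hom q} \<and> 0 \<le> s \<and> 0 \<le> t \<and> 0 < s + t"
      using \<open>0 \<le> m * (1 - u)\<close> \<open>0 \<le> n * u\<close> by blast
  qed
qed

text \<open>Dictionary from sets of angles to sets of parameters. It covers a half circle and its
  two ends, so that the patch and its four boundary segments are instances of one formula.\<close>

definition square_side :: "real set \<Rightarrow> real set" where
  "square_side R = (if R = {0..pi} then {0..1} else if R = {0} then {0} else {1})"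

lemma square_side: "square_side {0..pi} = {0..1}" "square_side {0} = {0}" "square_side {pi} = {1}"
proof -
  have "0 \<in> {0..pi}" "pi \<in> {0..pi}" "pi \<noteq> 0" using pi_gt_zero by auto
  then have "{0} \<noteq> {0..pi}" "{pi} \<noteq> {0..pi}" "{pi} \<noteq> {0::real}" by (metis singletonD, metis singletonD, simp)
  then show "square_side {0..pi} = {0..1}" "square_side {0} = {0}" "square_side {pi} = {1}"
    by (simp_all add: square_side_def)
qed

lemma square_side_angle:
  assumes "R = {0..pi} \<or> R = {0} \<or> R = {pi}"
  shows "\<theta> \<in> R \<Longrightarrow> \<exists>u\<in>square_side R. \<exists>r>0. cos (\<theta> / 2) = r * (1 - u) \<and> sin (\<theta> / 2) = r * u"
    "u \<in> square_side R \<Longrightarrow> \<exists>\<theta>\<in>R. \<exists>r>0. cos (\<theta> / 2) = r * (1 - u) \<and> sin (\<theta> / 2) = r * u"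
  using assms quarter_circle by (auto simp: square_side intro: exI[of _ 1])

lemma torus_map_square:
  assumes R: "R = {0..pi} \<or> R = {0} \<or> R = {pi}" "R' = {0..pi} \<or> R' = {0} \<or> R' = {pi}"
  shows "torus_map k a b c d ` (cis ` R \<times> cis ` R')
    = {span {torus_vec k a b c d (1 - u) u (1 - v) v} | u v. u \<in> square_side R \<and> v \<in> square_side R'}"
proof -
  have eq: "torus_map k a b c d (cis \<theta>, cis \<psi>) = span {torus_vec k a b c d (1 - u) u (1 - v) v}"
    if "r > 0" "cos (\<theta> / 2) = r * (1 - u)" "sin (\<theta> / 2) = r * u"
      "r' > 0" "cos (\<psi> / 2) = r' * (1 - v)" "sin (\<psi> / 2) = r' * v" for \<theta> \<psi> r r' u v
    unfolding torus_map_cis that torus_vec_scale using that(1,4) by (simp add: span_singleton_scale)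
  show ?thesis
  proof
    show "torus_map k a b c d ` (cis ` R \<times> cis ` R')
      \<subseteq> {span {torus_vec k a b c d (1 - u) u (1 - v) v} | u v. u \<in> square_side R \<and> v \<in> square_side R'}"
    proof clarify
      fix \<theta> \<psi> assume "\<theta> \<in> R" "\<psi> \<in> R'"
      then obtain u r v r' where "u \<in> square_side R" "r > 0" "cos (\<theta> / 2) = r * (1 - u)" "sin (\<theta> / 2) = r * u"
        "v \<in> square_side R'" "r' > 0" "cos (\<psi> / 2) = r' * (1 - v)" "sin (\<psi> / 2) = r' * v"
        using square_side_angle(1)[OF R(1)] square_side_angle(1)[OF R(2)] by meson
      then show "\<exists>u v. torus_map k a b c d (cis \<theta>, cis \<psi>) = span {torus_vec k a b c d (1 - u) u (1 - v) v} \<and> u \<in> square_side R \<and> v \<in> square_side R'"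
        using eq by metis
    qed
    show "{span {torus_vec k a b c d (1 - u) u (1 - v) v} | u v. u \<in> square_side R \<and> v \<in> square_side R'}
      \<subseteq> torus_map k a b c d ` (cis ` R \<times> cis ` R')"
    proof clarify
      fix u v assume "u \<in> square_side R" "v \<in> square_side R'"
      then obtain \<theta> r \<psi> r' where h: "\<theta> \<in> R" "r > 0" "cos (\<theta> / 2) = r * (1 - u)" "sin (\<theta> / 2) = r * u"
        "\<psi> \<in> R'" "r' > 0" "cos (\<psi> / 2) = r' * (1 - v)" "sin (\<psi> / 2) = r' * v"
        using square_side_angle(2)[OF R(1)] square_side_angle(2)[OF R(2)] by meson
      have "span {torus_vec k a b c d (1 - u) u (1 - v) v} = torus_map k a b c d (cis \<theta>, cis \<psi>)"
        using eq h by metis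
      then show "span {torus_vec k a b c d (1 - u) u (1 - v) v} \<in> torus_map k a b c d ` (cis ` R \<times> cis ` R')"
        using h(1,5) by (metis SigmaI imageI)
    qed
  qed
qed

text \<open>In the global parametrization the patch is the image of a product of two half circles
  from 0 to pi, and its edges lie over the angles 0 and pi.\<close>

lemma patch_hyperboloid_patch:
  assumes sk: "skew a b c d" and k: "k > 0"
  shows "hyperboloid_patch_with_boundary (affine_pt ` patch k a b c d) {seg a b, seg b c, seg c d, seg d a}"
proof -
  obtain A B C E where "skew_quad a b c d A B C E" using skew_coordinates[OF sk] .
  then interpret skew_quad a b c d A B C E .
  let ?\<Phi> = "torus_map k a b c d" and ?v = "torus_vec k a b c d"
  have ab: "?\<Phi> ` (cis ` {0..pi} \<times> cis ` {0}) = seg a b"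
  proof -
    have "?\<Phi> ` (cis ` {0..pi} \<times> cis ` {0}) = {span {?v (1 - u) u (1 - v) v} | u v. u \<in> square_side {0..pi} \<and> v \<in> square_side {0}}"
      by (rule torus_map_square) auto
    also have "\<dots> = seg a b" unfolding seg_weighted[OF k zero_less_one, of a b] square_side by (auto simp: torus_vec_def comb_def add.commute)
    finally show ?thesis .
  qed
  have cd: "?\<Phi> ` (cis ` {0..pi} \<times> cis ` {pi}) = seg c d"
  proof -
    have "?\<Phi> ` (cis ` {0..pi} \<times> cis ` {pi}) = {span {?v (1 - u) u (1 - v) v} | u v. u \<in> square_side {0..pi} \<and> v \<in> square_side {pi}}"
      by (rule torus_map_square) auto
    also have "\<dots> = seg c d" unfolding seg_commute[of c d] seg_weighted[OF zero_less_one zero_less_one, of d c] square_side by (auto simp: torus_vec_def comb_def add.commute)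
    finally show ?thesis .
  qed
  have da: "?\<Phi> ` (cis ` {0} \<times> cis ` {0..pi}) = seg d a"
  proof -
    have "?\<Phi> ` (cis ` {0} \<times> cis ` {0..pi}) = {span {?v (1 - u) u (1 - v) v} | u v. u \<in> square_side {0} \<and> v \<in> square_side {0..pi}}"
      by (rule torus_map_square) auto
    also have "\<dots> = seg d a" unfolding seg_commute[of d a] seg_weighted[OF k zero_less_one, of a d] square_side by (auto simp: torus_vec_def comb_def add.commute)
    finally show ?thesis .
  qed
  have bc: "?\<Phi> ` (cis ` {pi} \<times> cis ` {0..pi}) = seg b c"
  proof -
    have "?\<Phi> ` (cis ` {pi} \<times> cis ` {0..pi}) = {span {?v (1 - u) u (1 - v) v} | u v. u \<in> square_side {pi} \<and> v \<in> square_side {0..pi}}"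
      by (rule torus_map_square) auto
    also have "\<dots> = seg b c" unfolding seg_weighted[OF zero_less_one zero_less_one, of b c] square_side by (auto simp: torus_vec_def comb_def add.commute)
    finally show ?thesis .
  qed
  have P: "affine_pt ` patch k a b c d = ?\<Phi> ` (cis ` {0..pi} \<times> cis ` {0..pi})"
  proof -
    have "affine_pt (patch_param a b c d k (u, v)) = span {?v (1 - u) u (1 - v) v}" if uv: "u \<in> {0..1}" "v \<in> {0..1}" for u v
    proof -
      define W where "W = patch_weight k u v"
      have W: "W > 0" using patch_weight_pos[OF k uv] by (simp add: W_def)
      have "hom ((1 / W) *\<^sub>R x) = (1 / W) *\<^sub>R y" if "y $ 1 = x $ 1" "y $ 2 = x $ 2" "y $ 3 = x $ 3" "y $ 4 = W" for x y
        using that W by (simp add: vec_eq_iff forall_4)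
      then have "hom (patch_param a b c d k (u, v)) = (1 / W) *\<^sub>R ?v (1 - u) u (1 - v) v"
        unfolding patch_param_def prod.case W_def[symmetric]
        by (auto simp: torus_vec_def comb_def W_def patch_weight_def)
      then show ?thesis unfolding affine_pt_def using W span_singleton_scale[of "1 / W"] by simp
    qed
    then have "affine_pt ` (patch_param a b c d k ` unit_square) = (\<lambda>(u, v). span {?v (1 - u) u (1 - v) v}) ` unit_square"
      unfolding image_image by (intro image_cong refl) auto
    moreover have "(\<lambda>(u, v). F u v) ` (M \<times> N) = {F u v | u v. u \<in> M \<and> v \<in> N}" for F :: "real \<Rightarrow> real \<Rightarrow> ppoint" and M N
      by auto
    ultimately have "affine_pt ` (patch_param a b c d k ` unit_square) = {span {?v (1 - u) u (1 - v) v} | u v. u \<in> {0..1} \<and> v \<in> {0..1}}"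
      by simp
    moreover have "?\<Phi> ` (cis ` {0..pi} \<times> cis ` {0..pi})
        = {span {?v (1 - u) u (1 - v) v} | u v. u \<in> square_side {0..pi} \<and> v \<in> square_side {0..pi}}"
      by (rule torus_map_square) auto
    ultimately show ?thesis unfolding patch_param_image[OF k] square_side by simp
  qed
  show ?thesis
    unfolding hyperboloid_patch_with_boundary_def
  proof (intro exI conjI)
    show "hyperboloid (quadric k)" by (rule quadric_hyperboloid[OF k])
    show "asymptotic_parametrization (quadric k) ?\<Phi>" by (rule torus_map_asymptotic[OF k])
    show "affine_pt ` patch k a b c d = ?\<Phi> ` (cis ` {0..pi} \<times> cis ` {0..pi})" by (rule P)
    have cisimg: "cis ` {0} = {cis 0}" "cis ` {pi} = {cis pi}" by simp_all
    show "{seg a b, seg b c, seg c d, seg d a} = {?\<Phi> ` (cis ` {0..pi} \<times> {cis 0}), ?\<Phi> ` (cis ` {0..pi} \<times> {cis pi}),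
             ?\<Phi> ` ({cis 0} \<times> cis ` {0..pi}), ?\<Phi> ` ({cis pi} \<times> cis ` {0..pi})}"
      unfolding ab[unfolded cisimg] cd[unfolded cisimg] da[unfolded cisimg] bc[unfolded cisimg] by auto
  qed (use pi_gt_zero in auto)
qed

section \<open>Skew quadrilaterals of a generic A-net\<close>

lemma proj_line_proj_subspaceD:
  assumes "proj_line (proj_subspace U)" "subspace U" shows "dim U \<ge> 2"
proof -
  obtain W where W: "subspace W" "dim W = 2" "proj_subspace U = proj_subspace W"
    using assms(1)[unfolded proj_line_def] by (elim exE conjE) (rule that)
  have "W \<subseteq> U"
  proof
    fix w assume w: "w \<in> W"
    show "w \<in> U"
    proof (cases "w = 0")
      case False
      have "span {w} \<subseteq> W" using w W(1) by (intro span_minimal) auto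
      then have "span {w} \<in> proj_subspace U" unfolding W(3) using False by (simp add: proj_subspace_def span_in_RP3)
      then show ?thesis using span_base[of w "{w}"] by (auto simp: proj_subspace_def)
    qed (use assms(2) subspace_0 in simp)
  qed
  then show ?thesis using dim_subset[of W U] W(2) by simp
qed

lemma plane_combination:
  fixes p q r s :: "'v::euclidean_space"
  assumes W: "subspace W" "dim W = 3" "p \<in> W" "q \<in> W" "r \<in> W" "s \<in> W"
    and ind: "\<And>\<alpha> \<beta> \<gamma>. \<alpha> *\<^sub>R p + \<beta> *\<^sub>R q + \<gamma> *\<^sub>R r = 0 \<Longrightarrow> \<alpha> = 0 \<and> \<beta> = 0 \<and> \<gamma> = 0"
  obtains x y z where "s = x *\<^sub>R p + y *\<^sub>R q + z *\<^sub>R r"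
proof -
  have r0: "r \<noteq> 0" using ind[of 0 0 1] by auto
  have q: "q \<notin> span {r}"
  proof
    assume "q \<in> span {r}"
    then obtain k where "q = k *\<^sub>R r" by (auto simp: span_singleton)
    then show False using ind[of 0 1 "- k"] by simp
  qed
  have p: "p \<notin> span {q, r}"
  proof
    assume "p \<in> span {q, r}"
    then obtain u v where "p = u *\<^sub>R q + v *\<^sub>R r" unfolding span_pair by blast
    then show False using ind[of 1 "- u" "- v"] by simp
  qed
  have "independent {q, r}" using q r0 span_base[of q "{r}"] by (auto simp: independent_insert)
  then have indep: "independent {p, q, r}" using p span_base[of p "{q,r}"] by (auto simp: independent_insert)
  have "p \<noteq> q" "p \<noteq> r" "q \<noteq> r" using p q span_base[of p "{q,r}"] span_base[of q "{r}"] by auto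
  then have "card {p, q, r} = 3" by simp
  then have "dim {p, q, r} = 3" using dim_eq_card_independent[OF indep] by simp
  then have "span {p, q, r} = W"
    using W by (intro subspace_dim_equal subspace_span span_minimal) (auto simp: dim_span)
  then have "s \<in> span (insert p {q, r})" using W(6) by simp
  then obtain x where "s - x *\<^sub>R p \<in> span {q, r}" unfolding span_breakdown_eq by blast
  then obtain y z where "s - x *\<^sub>R p = y *\<^sub>R q + z *\<^sub>R r" unfolding span_pair by blast
  then have "s = x *\<^sub>R p + y *\<^sub>R q + z *\<^sub>R r" by (simp add: algebra_simps)
  then show thesis by (rule that)
qed

lemma (in adjacent_quads) twist_adjacent: "twist a b c' d' = sgn z * sgn z' * twist a b c d"
  unfolding twist_def det_adjacent by (simp add: sgn_mult)

lemma (in skew_quad) twist_nonzero: "twist a b c d \<noteq> 0"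
  unfolding twist_def using det_nonzero by (simp add: sgn_zero_iff)

lemma twist_relabel: "twist b a d c = twist a b c d" "twist d c b a = twist a b c d"
  unfolding twist_def by (rule arg_cong[where f = sgn], rule det_relabel)+

text \<open>The two edges at v single out its neighbours; only the direction of travel remains
  free.\<close>

lemma face_cycle_unique:
  assumes "face_cycle D Q v b c d" "face_cycle D Q v b' c' d'"
  shows "b' = b \<and> c' = c \<and> d' = d \<or> b' = d \<and> c' = c \<and> d' = b"
proof -
  have E: "{{v, b}, {b, c}, {c, d}, {d, v}} = {{v, b'}, {b', c'}, {c', d'}, {d', v}}"
    and V: "{v, b, c, d} = {v, b', c', d'}" and di: "distinct [v, b, c, d]" "distinct [v, b', c', d']"
    using assms unfolding face_cycle_def by simp_all
  have "{v, b'} \<in> {{v, b}, {b, c}, {c, d}, {d, v}}" "{d', v} \<in> {{v, b}, {b, c}, {c, d}, {d, v}}"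
    unfolding E by simp_all
  then have "b' \<in> {b, d}" "d' \<in> {b, d}" using di by (auto simp: doubleton_eq_iff)
  moreover have "c' \<in> {v, b, c, d}" unfolding V by simp
  ultimately show ?thesis using di by auto
qed

locale affine_net = quad_cells D for D :: "('a::topological_space) cell_decomposition" +
  fixes f :: "'a \<Rightarrow> real^3"
  assumes generic: "generic_affine_A_net D f" and no_cusps: "cusps_excluded D f"
begin

lemma edge_line_eq:
  assumes "e \<inter> V = {v, w}"
  shows "edge_line D (affine_pt \<circ> f) e = proj_subspace (span {hom (f v), hom (f w)})"
proof -
  have "\<Union>((affine_pt \<circ> f) ` (e \<inter> V)) = span {hom (f v)} \<union> span {hom (f w)}"
    unfolding assms by (simp add: affine_pt_def)
  moreover have "span (span {x} \<union> span {y}) = span {x, y}" for x y :: "real^4"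
    unfolding span_eq using span_mono[of "{x}" "{x,y}"] span_mono[of "{y}" "{x,y}"]
      span_base[of x "span {x} \<union> span {y}"] span_base[of y "span {x} \<union> span {y}"] span_base[of x "{x}"] span_base[of y "{y}"]
    by auto
  ultimately show ?thesis unfolding edge_line_def by simp
qed

lemma edge_images_distinct:
  assumes "e \<in> edges D" "e \<inter> V = {v, w}" shows "f v \<noteq> f w"
proof
  assume eq: "f v = f w"
  have "proj_line (edge_line D (affine_pt \<circ> f) e)"
    using generic assms(1) by (simp add: generic_affine_A_net_def generic_A_net_def)
  then have "dim (span {hom (f v), hom (f w)}) \<ge> 2"
    unfolding edge_line_eq[OF assms(2)] using proj_line_proj_subspaceD subspace_span by blast
  moreover have "dim {hom (f w)} \<le> card {hom (f w)}" by (intro dim_le_card') simp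
  ultimately show False unfolding eq by (simp add: dim_span)
qed

lemma hom_combination_zero:
  assumes "p \<noteq> q" "\<alpha> *\<^sub>R hom p + \<beta> *\<^sub>R hom q = 0" shows "\<alpha> = 0 \<and> \<beta> = 0"
proof -
  have b: "\<beta> = - \<alpha>" using arg_cong[OF assms(2), of "\<lambda>x. x $ 4"] by simp
  have "\<alpha> *\<^sub>R (hom p - hom q) = 0" using assms(2) b by (simp add: scaleR_diff_right)
  then show ?thesis using b assms(1) by auto
qed

text \<open>A nontrivial linear relation between the four vertices would produce a common point of
  the lines of two opposite edges, which are disjoint by genericity.\<close>

lemma face_skew:
  assumes "face_cycle D Q a b c d" shows "skew (f a) (f b) (f c) (f d)"
proof -
  obtain e1 where e1: "e1 \<in> edges_of D Q" "e1 \<inter> V = {a, b}" using face_cycle_edge[OF assms] .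
  obtain e2 where e2: "e2 \<in> edges_of D Q" "e2 \<inter> V = {c, d}"
    using face_cycle_edge[OF face_cycle_rotate[OF face_cycle_rotate[OF assms]]] .
  have di: "distinct [a, b, c, d]" using assms by (simp add: face_cycle_def)
  then have dis: "e1 \<inter> e2 \<inter> V = {}" "e1 \<noteq> e2" using e1 e2 by auto
  have ed: "e1 \<in> edges D" "e2 \<in> edges D" using e1 e2 face_edges by auto
  have lines: "edge_line D (affine_pt \<circ> f) e1 \<inter> edge_line D (affine_pt \<circ> f) e2 = {}"
    using generic ed dis unfolding generic_affine_A_net_def generic_A_net_def by metis
  have ne: "f a \<noteq> f b" "f c \<noteq> f d" using edge_images_distinct ed e1 e2 by blast+
  show ?thesis
    unfolding skew_def
  proof (intro allI impI)
    fix \<alpha> \<beta> \<gamma> \<delta> assume z: "comb (f a) (f b) (f c) (f d) \<alpha> \<beta> \<gamma> \<delta> = 0"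
    define x where "x = \<alpha> *\<^sub>R hom (f a) + \<beta> *\<^sub>R hom (f b)"
    have x': "x = (- \<gamma>) *\<^sub>R hom (f c) + (- \<delta>) *\<^sub>R hom (f d)"
      using z by (simp add: x_def comb_def add_eq_0_iff2 add.assoc)
    have "x = 0"
    proof (rule ccontr)
      assume "x \<noteq> 0"
      have "x \<in> span {hom (f a), hom (f b)}" "x \<in> span {hom (f c), hom (f d)}"
        unfolding span_pair using x_def x' by blast+
      then have "span {x} \<subseteq> span {hom (f a), hom (f b)}" "span {x} \<subseteq> span {hom (f c), hom (f d)}"
        by (simp_all add: span_minimal subspace_span)
      then have "span {x} \<in> edge_line D (affine_pt \<circ> f) e1 \<inter> edge_line D (affine_pt \<circ> f) e2"
        unfolding edge_line_eq[OF e1(2)] edge_line_eq[OF e2(2)] using \<open>x \<noteq> 0\<close>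
        by (simp add: proj_subspace_def span_in_RP3)
      then show False using lines by blast
    qed
    then show "\<alpha> = 0 \<and> \<beta> = 0 \<and> \<gamma> = 0 \<and> \<delta> = 0"
      using hom_combination_zero[OF ne(1), of \<alpha> \<beta>] hom_combination_zero[OF ne(2), of "- \<gamma>" "- \<delta>"] x_def x' by simp
  qed
qed

lemma face_cycle_vertices:
  assumes "face_cycle D Q a b c d"
  shows "Q \<in> faces D" "a \<in> V" "b \<in> V" "c \<in> V" "d \<in> V" "a \<in> Q" "b \<in> Q" "c \<in> Q" "d \<in> Q" "Q \<inter> V = {a, b, c, d}" "distinct [a, b, c, d]"
  using assms by (auto simp: face_cycle_def)

lemma face_cycle_star:
  assumes "face_cycle D Q a b c d" shows "b \<in> vertex_star D a" "d \<in> vertex_star D a"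
proof -
  have adj: "b \<in> vertex_star D a" if cy: "face_cycle D Q a b c d" for b c d
  proof -
    obtain e where "e \<in> edges_of D Q" "e \<inter> V = {a, b}" using face_cycle_edge[OF cy] .
    then show ?thesis using face_cycle_vertices(11)[OF cy] face_edges
      unfolding vertex_star_def adjacent_def by auto
  qed
  show "b \<in> vertex_star D a" "d \<in> vertex_star D a"
    using adj[OF assms] adj[OF face_cycle_reflect[OF assms]] by auto
qed

text \<open>By skewness the homogeneous vectors of f v, f w and f d are independent, so they span
  the plane of the star of v, which contains f d' too.\<close>

lemma coplanar_star:
  assumes Q: "face_cycle D Q v w c d" and Q': "face_cycle D Q' v w c' d'"
  obtains x y z where "f d' = x *\<^sub>R f v + y *\<^sub>R f w + z *\<^sub>R f d" "x + y + z = 1"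
proof -
  have "v \<in> V" using face_cycle_vertices(2)[OF Q] .
  then obtain P where P: "proj_plane P" "(affine_pt \<circ> f) ` vertex_star D v \<subseteq> P"
    using generic by (auto simp: generic_affine_A_net_def generic_A_net_def discrete_A_net_def)
  obtain W where W: "subspace W" "dim W = 3" "P = proj_subspace W"
    using P(1)[unfolded proj_plane_def] by (elim exE conjE) (rule that)
  have inW: "hom (f u) \<in> W" if "u \<in> vertex_star D v" for u
  proof -
    have "span {hom (f u)} \<subseteq> W" using P(2) that unfolding W(3) by (auto simp: proj_subspace_def affine_pt_def)
    then show ?thesis using span_base[of "hom (f u)" "{hom (f u)}"] by auto
  qed
  have ind: "\<alpha> = 0 \<and> \<beta> = 0 \<and> \<gamma> = 0" if "\<alpha> *\<^sub>R hom (f v) + \<beta> *\<^sub>R hom (f w) + \<gamma> *\<^sub>R hom (f d) = 0" for \<alpha> \<beta> \<gamma>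
    using face_skew[OF Q, unfolded skew_def, rule_format, of \<alpha> \<beta> 0 \<gamma>] that by (simp add: comb_def)
  have "v \<in> vertex_star D v" by (simp add: vertex_star_def)
  then obtain x y z where h: "hom (f d') = x *\<^sub>R hom (f v) + y *\<^sub>R hom (f w) + z *\<^sub>R hom (f d)"
    using plane_combination[OF W(1,2) inW inW inW inW ind] face_cycle_star[OF Q] face_cycle_star[OF Q'] by metis
  have "x + y + z = 1" using arg_cong[OF h, of "\<lambda>u. u $ 4"] by simp
  moreover have "f d' = x *\<^sub>R f v + y *\<^sub>R f w + z *\<^sub>R f d"
    using h by (simp add: vec_eq_iff forall_3 forall_4)
  ultimately show thesis using that by blast
qed

lemma adjacent_coordinates:
  assumes Q: "face_cycle D Q v w c d" and Q': "face_cycle D Q' v w c' d'"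
  obtains A B C E x y z x' y' z' where
    "\<And>k k'. k > 0 \<Longrightarrow> k' > 0 \<Longrightarrow> adjacent_quads (f v) (f w) (f c) (f d) A B C E (f c') (f d') x y z x' y' z' k k'"
proof -
  obtain A B C E where sq: "skew_quad (f v) (f w) (f c) (f d) A B C E" using skew_coordinates[OF face_skew[OF Q]] .
  obtain x y z where d: "f d' = x *\<^sub>R f v + y *\<^sub>R f w + z *\<^sub>R f d" "x + y + z = 1"
    using coplanar_star[OF Q Q'] .
  have R: "face_cycle D Q w v d c" "face_cycle D Q' w v d' c'"
    using face_cycle_reflect[OF face_cycle_rotate[OF Q]] face_cycle_reflect[OF face_cycle_rotate[OF Q']] by auto
  obtain y' x' z' where c: "f c' = y' *\<^sub>R f w + x' *\<^sub>R f v + z' *\<^sub>R f c" "y' + x' + z' = 1"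
    using coplanar_star[OF R] .
  show thesis
  proof (rule that)
    fix k k' :: real assume "k > 0" "k' > 0"
    then show "adjacent_quads (f v) (f w) (f c) (f d) A B C E (f c') (f d') x y z x' y' z' k k'"
      using c d face_skew[OF Q'] by (intro adjacent_quads.intro[OF sq] adjacent_quads_axioms.intro) (simp_all add: algebra_simps)
  qed
qed

text \<open>Equal twist gives z z' > 0, and the exclusion of cusps forbids that both are positive.
  With both negative, equality of the curvatures becomes k z = k' z'.\<close>

lemma twist_eqI:
  assumes "Q \<noteq> Q'" and Q: "face_cycle D Q v w c d" and Q': "face_cycle D Q' v w c' d'"
    and k: "k > 0" "k' > 0"
    and tw: "twist (f v) (f w) (f c') (f d') = twist (f v) (f w) (f c) (f d)"
    and cu: "k * curv (f v) (f w) (f c) (f d) = k' * curv (f v) (f w) (f c') (f d')"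
    and p: "p \<in> closed_segment (f v) (f w)"
  shows "C1_joint (patch k (f v) (f w) (f c) (f d)) (patch k' (f v) (f w) (f c') (f d')) (f w - f v) p"
proof -
  obtain A B C E x y z x' y' z' where adj: "\<And>k k'. k > 0 \<Longrightarrow> k' > 0 \<Longrightarrow>
      adjacent_quads (f v) (f w) (f c) (f d) A B C E (f c') (f d') x y z x' y' z' k k'"
    by (rule adjacent_coordinates[OF Q Q']) (rule that)
  interpret adjacent_quads "f v" "f w" "f c" "f d" A B C E "f c'" "f d'" x y z x' y' z' k k' by (rule adj[OF k])
  have "\<not> (same_side (f v) (f w) (f d) (f d') \<and> same_side (f v) (f w) (f c) (f c'))"
    using no_cusps assms(1) Q Q' unfolding cusps_excluded_def by blast
  then have "\<not> (z > 0 \<and> z' > 0)" using same_side_if same_side_if' by blast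
  moreover have "sgn z * sgn z' = 1"
  proof -
    have "(sgn z * sgn z' - 1) * twist (f v) (f w) (f c) (f d) = 0" using tw unfolding twist_adjacent by (simp add: algebra_simps)
    then show ?thesis using twist_nonzero by simp
  qed
  then have "z * z' > 0" by (metis sgn_mult sgn_1_pos)
  ultimately have z: "z < 0" "z' < 0" by (auto simp: zero_less_mult_iff)
  have "curv (f v) (f w) (f c') (f d') = z' / z * curv (f v) (f w) (f c) (f d)"
    using curv_adjacent(1) z by (simp add: divide_nonpos_nonpos)
  then have "(k - k' * (z' / z)) * curv (f v) (f w) (f c) (f d) = 0" using cu by (simp add: algebra_simps)
  moreover have "curv (f v) (f w) (f c) (f d) > 0" using curv_pos[OF face_skew[OF Q]] .
  ultimately have "k = k' * (z' / z)" by simp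
  then have "k * z = k' * z'" using z by simp
  then show ?thesis using C1_joint_if z p by blast
qed

lemma C1_joint_invariants:
  assumes Q: "face_cycle D Q v w c d" and Q': "face_cycle D Q' v w c' d'"
    and k: "k > 0" "k' > 0"
    and joint: "\<And>p. p \<in> closed_segment (f v) (f w) \<Longrightarrow>
      C1_joint (patch k (f v) (f w) (f c) (f d)) (patch k' (f v) (f w) (f c') (f d')) (f w - f v) p"
  shows "twist (f v) (f w) (f c') (f d') = twist (f v) (f w) (f c) (f d)"
    "k * curv (f v) (f w) (f c) (f d) = k' * curv (f v) (f w) (f c') (f d')"
proof -
  obtain A B C E x y z x' y' z' where adj: "\<And>k k'. k > 0 \<Longrightarrow> k' > 0 \<Longrightarrow>
      adjacent_quads (f v) (f w) (f c) (f d) A B C E (f c') (f d') x y z x' y' z' k k'"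
    by (rule adjacent_coordinates[OF Q Q']) (rule that)
  interpret adjacent_quads "f v" "f w" "f c" "f d" A B C E "f c'" "f d'" x y z x' y' z' k k' by (rule adj[OF k])
  have z: "z < 0" "z' < 0" "k * z = k' * z'" using C1_joint_imp[OF joint] by auto
  show "twist (f v) (f w) (f c') (f d') = twist (f v) (f w) (f c) (f d)"
    unfolding twist_adjacent using z by simp
  have "k = k' * (z' / z)" using z by (simp add: field_simps)
  moreover have "curv (f v) (f w) (f c') (f d') = z' / z * curv (f v) (f w) (f c) (f d)"
    using curv_adjacent(1) z by (simp add: divide_nonpos_nonpos)
  ultimately show "k * curv (f v) (f w) (f c) (f d) = k' * curv (f v) (f w) (f c') (f d')" by simp
qed

text \<open>The constants of the two faces differ by the factor |z'/z| at v and by its inverse at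
  w.\<close>

lemma curv_product:
  assumes Q: "face_cycle D Q v w c d" and Q': "face_cycle D Q' v w c' d'"
  shows "curv (f v) (f w) (f c) (f d) * curv (f w) (f v) (f d) (f c)
    = curv (f v) (f w) (f c') (f d') * curv (f w) (f v) (f d') (f c')"
proof -
  obtain A B C E x y z x' y' z' where adj: "\<And>k k'. k > 0 \<Longrightarrow> k' > 0 \<Longrightarrow>
      adjacent_quads (f v) (f w) (f c) (f d) A B C E (f c') (f d') x y z x' y' z' k k'"
    by (rule adjacent_coordinates[OF Q Q']) (rule that)
  interpret adjacent_quads "f v" "f w" "f c" "f d" A B C E "f c'" "f d'" x y z x' y' z' 1 1 by (rule adj) auto
  have "\<bar>z' / z\<bar> * \<bar>z / z'\<bar> = 1" using z_nonzero by (simp add: abs_divide)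
  moreover have "(p * X) * (q * Y) = (p * q) * (X * Y)" for p q X Y :: real by simp
  ultimately show ?thesis unfolding curv_adjacent by (simp only: mult_1)
qed

section \<open>Patches of a face, seen from a vertex\<close>

text \<open>One of the two directions of travel is picked. Patches and curvature constants are
  invariant under reflection, so the pick does not matter.\<close>

definition cycle_at :: "'a set \<Rightarrow> 'a \<Rightarrow> 'a \<times> 'a \<times> 'a" where
  "cycle_at Q v = (SOME (b, c, d). face_cycle D Q v b c d)"

definition patch_at :: "'a set \<Rightarrow> 'a \<Rightarrow> real \<Rightarrow> ppoint set" where
  "patch_at Q v k = (case cycle_at Q v of (b, c, d) \<Rightarrow> affine_pt ` patch k (f v) (f b) (f c) (f d))"

definition curv_at :: "'a set \<Rightarrow> 'a \<Rightarrow> real" where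
  "curv_at Q v = (case cycle_at Q v of (b, c, d) \<Rightarrow> curv (f v) (f b) (f c) (f d))"

lemma cycle_at:
  assumes "face_cycle D Q v b c d"
  shows "cycle_at Q v = (b, c, d) \<or> cycle_at Q v = (d, c, b)"
proof -
  have "case cycle_at Q v of (b, c, d) \<Rightarrow> face_cycle D Q v b c d"
    unfolding cycle_at_def by (rule someI[of _ "(b, c, d)"]) (simp add: assms)
  then show ?thesis using face_cycle_unique[OF assms] by (cases "cycle_at Q v") auto
qed

lemma patch_at_eq: "face_cycle D Q v b c d \<Longrightarrow> patch_at Q v k = affine_pt ` patch k (f v) (f b) (f c) (f d)"
  and curv_at_eq: "face_cycle D Q v b c d \<Longrightarrow> curv_at Q v = curv (f v) (f b) (f c) (f d)"
  using cycle_at[of Q v b c d] patch_reflect curv_reflect unfolding patch_at_def curv_at_def by fastforce+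

lemma cycle_from:
  assumes "Q \<in> faces D" "v \<in> Q \<inter> V"
  obtains b c d where "face_cycle D Q v b c d"
proof -
  obtain a b c d where *: "face_cycle D Q a b c d" using face_cycle_exists[OF assms(1)] .
  then have "v \<in> {a, b, c, d}" using assms(2) by (simp add: face_cycle_def)
  then show thesis using that * face_cycle_rotate by blast
qed

lemma curv_at_pos: "Q \<in> faces D \<Longrightarrow> v \<in> Q \<inter> V \<Longrightarrow> curv_at Q v > 0"
  using cycle_from curv_at_eq curv_pos face_skew by metis

lemma patch_at_inject:
  assumes "Q \<in> faces D" "v \<in> Q \<inter> V" "k > 0" "patch_at Q v k = patch_at Q v k'"
  shows "k = k'"
proof -
  obtain b c d where c: "face_cycle D Q v b c d" using cycle_from[OF assms(1,2)] .
  obtain A B C E where "skew_quad (f v) (f b) (f c) (f d) A B C E" using skew_coordinates[OF face_skew[OF c]] .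
  then interpret skew_quad "f v" "f b" "f c" "f d" A B C E .
  have "inj affine_pt" using affine_pt_inj by (auto simp: inj_def)
  then have "patch k (f v) (f b) (f c) (f d) = patch k' (f v) (f b) (f c) (f d)"
    using assms(4) unfolding patch_at_eq[OF c] by (simp add: inj_image_eq_iff)
  then show ?thesis using patch_inject[OF assms(3)] by blast
qed

lemma boundary_segments:
  assumes "face_cycle D Q a b c d"
  shows "(\<lambda>e. affine_pt ` edge_segment D f e) ` edges_of D Q
     = {seg (f a) (f b), seg (f b) (f c), seg (f c) (f d), seg (f d) (f a)}"
proof -
  have "(\<lambda>e. affine_pt ` edge_segment D f e) ` edges_of D Q
     = (\<lambda>s. affine_pt ` (convex hull (f ` s))) ` ((\<lambda>e. e \<inter> V) ` edges_of D Q)"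
    by (simp add: image_image edge_segment_def)
  also have "(\<lambda>e. e \<inter> V) ` edges_of D Q = {{a, b}, {b, c}, {c, d}, {d, a}}"
    using assms by (simp add: face_cycle_def)
  finally show ?thesis by (simp add: seg_def segment_convex_hull)
qed

lemma face_patches_eq:
  assumes "Q \<in> faces D" "v \<in> Q \<inter> V"
  shows "face_patches D f Q = {patch_at Q v k | k. k > 0}"
proof -
  obtain b c d where c: "face_cycle D Q v b c d" using cycle_from[OF assms] .
  show ?thesis
    unfolding face_patches_def boundary_segments[OF c] patch_at_eq[OF c]
    using patch_of_hyperboloid_patch[OF face_skew[OF c]] patch_hyperboloid_patch[OF face_skew[OF c]] by blast
qed

text \<open>The slope of the transition from v to w within Q; the value 1 covers diagonals and v =
  w.\<close>

definition \<epsilon> :: "'a set \<Rightarrow> 'a \<Rightarrow> 'a \<Rightarrow> real" where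
  "\<epsilon> Q v w = (if {v, w} \<in> (\<lambda>e. e \<inter> V) ` edges_of D Q then - 1 else 1)"

text \<open>A quadrilateral is bipartite: with sign 1 on one pair of opposite vertices and -1 on the
  other, the product of two signs is -1 exactly along edges. So \<open>\<epsilon>\<close> is a
  coboundary, hence multiplicative.\<close>

lemma \<epsilon>_parity:
  assumes "Q \<in> faces D"
  obtains \<sigma> where "\<And>v w. v \<in> Q \<inter> V \<Longrightarrow> w \<in> Q \<inter> V \<Longrightarrow> \<epsilon> Q v w = \<sigma> v * \<sigma> w" "\<And>v. \<sigma> v * \<sigma> v = 1"
proof -
  obtain a b c d where c: "face_cycle D Q a b c d" using face_cycle_exists[OF assms] .
  define \<sigma> where "\<sigma> v = (if v = a \<or> v = c then 1 else - 1 :: real)" for v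
  have E: "(\<lambda>e. e \<inter> V) ` edges_of D Q = {{a, b}, {b, c}, {c, d}, {d, a}}" using c by (simp add: face_cycle_def)
  have di: "distinct [a, b, c, d]" using face_cycle_vertices(11)[OF c] .
  show thesis
  proof (rule that)
    fix v w assume "v \<in> Q \<inter> V" "w \<in> Q \<inter> V"
    then have "v \<in> {a, b, c, d}" "w \<in> {a, b, c, d}" using face_cycle_vertices(10)[OF c] by auto
    then show "\<epsilon> Q v w = \<sigma> v * \<sigma> w" unfolding \<epsilon>_def E \<sigma>_def using di by (auto simp: doubleton_eq_iff)
  qed (simp add: \<sigma>_def)
qed

lemma \<epsilon>_trans:
  assumes "Q \<in> faces D" "u \<in> Q \<inter> V" "v \<in> Q \<inter> V" "w \<in> Q \<inter> V"
  shows "\<epsilon> Q v w * \<epsilon> Q u v = \<epsilon> Q u w"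
proof -
  obtain \<sigma> where s: "\<And>v w. v \<in> Q \<inter> V \<Longrightarrow> w \<in> Q \<inter> V \<Longrightarrow> \<epsilon> Q v w = \<sigma> v * \<sigma> w" "\<And>v. \<sigma> v * \<sigma> v = 1"
    using \<epsilon>_parity[OF assms(1)] by blast
  have "\<epsilon> Q v w * \<epsilon> Q u v = (\<sigma> v * \<sigma> v) * (\<sigma> u * \<sigma> w)" using s(1) assms by (simp add: mult_ac)
  then show ?thesis using s assms by simp
qed

lemma \<epsilon>_refl: "Q \<in> faces D \<Longrightarrow> v \<in> Q \<inter> V \<Longrightarrow> \<epsilon> Q v v = 1"
  using \<epsilon>_parity by metis

text \<open>Passing to a neighbour is one rotation and inverts k; passing to the opposite vertex is
  two rotations and restores it. With k = exp \<kappa> this is a sign in the exponent.\<close>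

lemma patch_at_change:
  assumes "Q \<in> faces D" "v \<in> Q \<inter> V" "w \<in> Q \<inter> V"
  shows "patch_at Q w (exp (\<epsilon> Q v w * \<kappa>)) = patch_at Q v (exp \<kappa>)"
proof -
  obtain b c d where c: "face_cycle D Q v b c d" using cycle_from[OF assms(1,2)] .
  note c1 = face_cycle_rotate[OF c] and c2 = face_cycle_rotate[OF face_cycle_rotate[OF c]]
    and c3 = face_cycle_rotate[OF face_cycle_rotate[OF face_cycle_rotate[OF c]]]
  have E: "(\<lambda>e. e \<inter> V) ` edges_of D Q = {{v, b}, {b, c}, {c, d}, {d, v}}" using c by (simp add: face_cycle_def)
  have di: "distinct [v, b, c, d]" using face_cycle_vertices(11)[OF c] .
  have w: "w \<in> {v, b, c, d}" using assms(3) face_cycle_vertices(10)[OF c] by simp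
  have ex: "1 / exp x = exp (- x)" for x :: real by (simp add: exp_minus divide_inverse)
  have r1: "patch (exp (- x)) q r s p = patch (exp x) p q r s" for x p q r s
    using patch_rotate[where k="exp x" and a=p and b=q and c=r and d=s] by (simp add: ex)
  have r1': "patch (exp x) q r s p = patch (exp (- x)) p q r s" for x p q r s
    using r1[of "- x" q r s p] by simp
  show ?thesis
  proof (cases "w = v")
    case True
    then show ?thesis using \<epsilon>_refl assms by simp
  next
    case False
    then consider "w = b" | "w = c" | "w = d" using w by blast
    then show ?thesis
    proof cases
      case 1
      have "\<epsilon> Q v w = - 1" unfolding \<epsilon>_def E using 1 by simp
      then show ?thesis unfolding patch_at_eq[OF c] unfolding 1 patch_at_eq[OF c1] by (simp add: r1)
    next
      case 2
      have "\<epsilon> Q v w = 1" unfolding \<epsilon>_def E using 2 di by (auto simp: doubleton_eq_iff)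
      then show ?thesis unfolding patch_at_eq[OF c] unfolding 2 patch_at_eq[OF c2]
        using r1'[of \<kappa> "f b" "f c" "f d" "f v"] r1[of \<kappa> "f v" "f b" "f c" "f d"] r1'[of \<kappa> "f c" "f d" "f v" "f b"]
        by (simp add: r1 r1[of _ "f v"])
    next
      case 3
      have "\<epsilon> Q v w = - 1" unfolding \<epsilon>_def E using 3 by (simp add: insert_commute)
      then show ?thesis unfolding patch_at_eq[OF c] unfolding 3 patch_at_eq[OF c3]
        using r1[of "- \<kappa>" "f v" "f b" "f c" "f d"] by simp
    qed
  qed
qed

section \<open>Nets and strips\<close>

lemma shared_edge_cycles:
  assumes "Q \<in> faces D" "Q' \<in> faces D" "e \<in> edges_of D Q" "e \<in> edges_of D Q'" "e \<inter> V = {v, w}"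
  obtains c d c' d' where "face_cycle D Q v w c d" "face_cycle D Q' v w c' d'"
  using face_cycle_of_edge[OF assms(1,3,5)] face_cycle_of_edge[OF assms(2,4,5)] by metis

lemma edge_segment_eq: "e \<inter> V = {v, w} \<Longrightarrow> edge_segment D f e = closed_segment (f v) (f w)"
  by (simp add: edge_segment_def segment_convex_hull)

lemma vimage_patch_at: "face_cycle D Q v b c d \<Longrightarrow> affine_pt -` patch_at Q v k = patch k (f v) (f b) (f c) (f d)"
  unfolding patch_at_eq using affine_pt_inj by (auto simp: image_iff)

lemma net_patch:
  assumes "N \<in> hyperbolic_nets D f" "Q \<in> faces D" "v \<in> Q \<inter> V"
  obtains k where "k > 0" "N Q = patch_at Q v k"
proof -
  have "N Q \<in> face_patches D f Q" using assms unfolding hyperbolic_nets_def by (auto simp: PiE_iff)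
  then show thesis using that unfolding face_patches_eq[OF assms(2,3)] by blast
qed

lemma net_invariants:
  assumes N: "N \<in> hyperbolic_nets D f" and Q: "Q \<in> faces D" "Q' \<in> faces D" "Q \<noteq> Q'"
    and e: "e \<in> edges_of D Q" "e \<in> edges_of D Q'" "e \<inter> V = {v, w}" "v \<noteq> w"
    and k: "k > 0" "k' > 0" "N Q = patch_at Q v k" "N Q' = patch_at Q' v k'"
    and c: "face_cycle D Q v w c d" "face_cycle D Q' v w c' d'"
  shows "twist (f v) (f w) (f c') (f d') = twist (f v) (f w) (f c) (f d)"
    "k * curv_at Q v = k' * curv_at Q' v"
proof -
  have "C1_joint (patch k (f v) (f w) (f c) (f d)) (patch k' (f v) (f w) (f c') (f d')) (f w - f v) p"
    if "p \<in> closed_segment (f v) (f w)" for p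
  proof -
    have "C1_joint (affine_pt -` N Q) (affine_pt -` N Q') (f w - f v) p"
      using conjunct2[OF N[unfolded hyperbolic_nets_def mem_Collect_eq], rule_format, of Q Q' e v w p]
        Q e that edge_segment_eq[OF e(3)] by simp
    then show ?thesis unfolding k vimage_patch_at[OF c(1)] vimage_patch_at[OF c(2)] .
  qed
  from C1_joint_invariants[OF c k(1,2) this]
  show "twist (f v) (f w) (f c') (f d') = twist (f v) (f w) (f c) (f d)"
    "k * curv_at Q v = k' * curv_at Q' v" unfolding curv_at_eq[OF c(1)] curv_at_eq[OF c(2)] by auto
qed

text \<open>Agreement passes across an edge: at an end v of it, \<open>k * curv_at\<close> has the
  same value for both faces, so the patch of one face fixes that of the other. Edge-connectedness of
  the set of faces does the rest.\<close>

lemma net_unique: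
  assumes con: "connected S" and N: "N \<in> hyperbolic_nets D f" "N' \<in> hyperbolic_nets D f"
    and Q0: "Q\<^sub>0 \<in> faces D" "N Q\<^sub>0 = N' Q\<^sub>0"
  shows "N = N'"
proof -
  have "{Q \<in> faces D. N Q = N' Q} = faces D"
  proof (rule faces_edge_connected[OF con])
    fix Q Q' e assume h: "Q \<in> {Q \<in> faces D. N Q = N' Q}" "Q' \<in> faces D" "Q \<noteq> Q'" "e \<in> edges_of D Q" "e \<in> edges_of D Q'"
    have Q: "Q \<in> faces D" "N Q = N' Q" using h(1) by auto
    obtain v w where vw: "v \<noteq> w" "e \<inter> V = {v, w}" using edge_ends face_edges[OF h(4)] by metis
    have v: "v \<in> Q \<inter> V" "v \<in> Q' \<inter> V" using vw face_edges[OF h(4)] face_edges[OF h(5)] by auto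
    obtain c d c' d' where c: "face_cycle D Q v w c d" "face_cycle D Q' v w c' d'"
      using shared_edge_cycles[OF Q(1) h(2,4,5) vw(2)] .
    obtain k where k: "k > 0" "N Q = patch_at Q v k" using net_patch[OF N(1) Q(1) v(1)] .
    obtain k' where k': "k' > 0" "N Q' = patch_at Q' v k'" using net_patch[OF N(1) h(2) v(2)] .
    obtain k'' where k'': "k'' > 0" "N' Q' = patch_at Q' v k''" using net_patch[OF N(2) h(2) v(2)] .
    have "k * curv_at Q v = k' * curv_at Q' v"
      by (rule net_invariants(2)[OF N(1) Q(1) h(2,3,4,5) vw(2,1) k(1) k'(1) k(2) k'(2) c])
    moreover have "k * curv_at Q v = k'' * curv_at Q' v"
      using k(2) Q(2) by (intro net_invariants(2)[OF N(2) Q(1) h(2,3,4,5) vw(2,1) k(1) k''(1) _ k''(2) c]) simp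
    ultimately have "k' = k''" using curv_at_pos[OF h(2) v(2)] by simp
    then show "Q' \<in> {Q \<in> faces D. N Q = N' Q}" using k' k'' h(2) by simp
  qed (use Q0 in auto)
  then have "N Q = N' Q" if "Q \<in> faces D" for Q using that by blast
  moreover have "N \<in> (\<Pi>\<^sub>E Q\<in>faces D. face_patches D f Q)" "N' \<in> (\<Pi>\<^sub>E Q\<in>faces D. face_patches D f Q)"
    using N by (auto simp: hyperbolic_nets_def)
  ultimately show ?thesis by (rule PiE_ext[rotated 2])
qed

lemma twist_pair_unique:
  assumes "face_cycle D Q a b c d" "face_cycle D Q a' b' c' d'" "{a, b} = {a', b'}"
  shows "twist (f a') (f b') (f c') (f d') = twist (f a) (f b) (f c) (f d)"
proof -
  have di: "distinct [a, b, c, d]" "distinct [a', b', c', d']" using assms face_cycle_vertices(11) by blast+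
  consider "a' = a" "b' = b" | "a' = b" "b' = a" using assms(3) by (auto simp: doubleton_eq_iff)
  then show ?thesis
  proof cases
    case 1
    then show ?thesis using face_cycle_unique[OF assms(1), of b' c' d'] assms(2) di by auto
  next
    case 2
    have "face_cycle D Q b a d c" using face_cycle_reflect[OF face_cycle_rotate[OF assms(1)]] .
    then have "c' = d \<and> d' = c" using face_cycle_unique[of D Q b a d c b' c' d'] assms(2) 2 di by auto
    then show ?thesis using 2 twist_relabel(1) by simp
  qed
qed

text \<open>In two adjacent faces the pairs of opposite edges that contain the common edge have the
  same twist, and the twist is symmetric in the two edges of a pair; so it is carried along the
  strip.\<close>

lemma net_imp_equi_twisted:
  assumes N: "N \<in> hyperbolic_nets D f" and st: "strip D Qs es"
  shows "equi_twisted D f Qs es"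
proof -
  have opp: "opposite_edges D (Qs ! i) (es ! i) (es ! Suc i)" if "i < length Qs" for i using st that by (simp add: strip_def)
  have ex: "\<exists>a b c d. face_cycle D (Qs ! i) a b c d \<and> es ! i \<inter> V = {a, b} \<and> es ! Suc i \<inter> V = {d, c}" if "i < length Qs" for i
    using opp[OF that] unfolding opposite_edges_def by blast
  define tw where "tw i s \<longleftrightarrow> (\<forall>a b c d. face_cycle D (Qs ! i) a b c d \<and> es ! i \<inter> V = {a, b} \<and> es ! Suc i \<inter> V = {d, c}
      \<longrightarrow> twist (f a) (f b) (f c) (f d) = s)" for i s
  have twI: "tw i (twist (f a) (f b) (f c) (f d))" if h: "face_cycle D (Qs ! i) a b c d" "es ! i \<inter> V = {a, b}" for i a b c d
    unfolding tw_def using twist_pair_unique[OF h(1)] h(2) by metis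
  have step: "tw (Suc i) s" if h: "tw i s" "Suc i < length Qs" for i s
  proof -
    obtain a b c d where 1: "face_cycle D (Qs ! i) a b c d" "es ! i \<inter> V = {a, b}" "es ! Suc i \<inter> V = {d, c}"
      using ex[OF Suc_lessD[OF h(2)]] by (elim exE conjE) (rule that)
    obtain a' b' c' d' where 2: "face_cycle D (Qs ! Suc i) a' b' c' d'" "es ! Suc i \<inter> V = {a', b'}"
      using ex[OF h(2)] by (elim exE conjE) (rule that)
    have Q: "Qs ! i \<in> faces D" "Qs ! Suc i \<in> faces D" using 1 2 face_cycle_vertices(1) by blast+
    have e: "es ! Suc i \<in> edges_of D (Qs ! i)" "es ! Suc i \<in> edges_of D (Qs ! Suc i)"
      using opp[OF Suc_lessD[OF h(2)]] opp[OF h(2)] by (auto simp: opposite_edges_def)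
    have int: "Qs ! i \<inter> Qs ! Suc i = es ! Suc i" using st h(2) by (simp add: strip_def)
    \<comment> \<open>A face has four vertices and an edge has two, so the intersection condition on
      consecutive faces keeps a strip from staying in one face.\<close>
    have ne: "Qs ! i \<noteq> Qs ! Suc i"
    proof
      assume "Qs ! i = Qs ! Suc i"
      then have "Qs ! i = es ! Suc i" using int by simp
      then have "{a, b, c, d} = {d, c}" using face_cycle_vertices(10)[OF 1(1)] 1(3) by simp
      then show False using face_cycle_vertices(11)[OF 1(1)] by (auto simp: set_eq_iff)
    qed
    have dc: "face_cycle D (Qs ! i) d c b a"
      using face_cycle_reflect[OF face_cycle_rotate[OF face_cycle_rotate[OF face_cycle_rotate[OF 1(1)]]]] .
    have "d \<noteq> c" using face_cycle_vertices(11)[OF 1(1)] by auto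
    obtain c'' d'' where 3: "face_cycle D (Qs ! Suc i) d c c'' d''" using face_cycle_of_edge[OF Q(2) e(2) 1(3)] .
    have d: "d \<in> Qs ! i \<inter> V" "d \<in> Qs ! Suc i \<inter> V" using face_cycle_vertices[OF 1(1)] face_cycle_vertices[OF 3] by auto
    obtain k where k: "k > 0" "N (Qs ! i) = patch_at (Qs ! i) d k" using net_patch[OF N Q(1) d(1)] .
    obtain k' where k': "k' > 0" "N (Qs ! Suc i) = patch_at (Qs ! Suc i) d k'" using net_patch[OF N Q(2) d(2)] .
    have "twist (f d) (f c) (f c'') (f d'') = twist (f d) (f c) (f b) (f a)"
      by (rule net_invariants(1)[OF N Q ne e 1(3) \<open>d \<noteq> c\<close> k(1) k'(1) k(2) k'(2) dc 3])
    also have "\<dots> = twist (f a) (f b) (f c) (f d)" by (rule twist_relabel)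
    also have "\<dots> = s" using h(1) 1 unfolding tw_def by blast
    finally show ?thesis using twI[of "Suc i" d c c'' d''] 3 1(3) by simp
  qed
  have "0 < length Qs" using st by (simp add: strip_def)
  then obtain a b c d where "face_cycle D (Qs ! 0) a b c d" "es ! 0 \<inter> V = {a, b}" using ex[of 0] by blast
  then have t0: "tw 0 (twist (f a) (f b) (f c) (f d))" by (rule twI)
  have "i < length Qs \<Longrightarrow> tw i (twist (f a) (f b) (f c) (f d))" for i
    by (induction i) (use t0 step in auto)
  then show ?thesis unfolding equi_twisted_def tw_def by blast
qed

text \<open>Two faces with a common edge form a strip of length two, closed off by the edges
  opposite to the common one.\<close>

lemma equi_twisted_imp_twist_eq:
  assumes st: "\<And>Qs es. strip D Qs es \<Longrightarrow> equi_twisted D f Qs es"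
    and Q: "Q \<in> faces D" "Q' \<in> faces D" "Q \<noteq> Q'" and e: "e \<in> edges_of D Q" "e \<in> edges_of D Q'" "e \<inter> V = {v, w}"
    and c: "face_cycle D Q v w c d" "face_cycle D Q' v w c' d'"
  shows "twist (f v) (f w) (f c') (f d') = twist (f v) (f w) (f c) (f d)"
proof -
  have r: "face_cycle D Q d c w v"
    using face_cycle_reflect[OF face_cycle_rotate[OF face_cycle_rotate[OF face_cycle_rotate[OF c(1)]]]] .
  obtain e1 where e1: "e1 \<in> edges_of D Q" "e1 \<inter> V = {d, c}" using face_cycle_edge[OF r] .
  have r': "face_cycle D Q' d' c' w v"
    using face_cycle_reflect[OF face_cycle_rotate[OF face_cycle_rotate[OF face_cycle_rotate[OF c(2)]]]] .
  obtain e2 where e2: "e2 \<in> edges_of D Q'" "e2 \<inter> V = {d', c'}" using face_cycle_edge[OF r'] .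
  have o1: "opposite_edges D Q e1 e" unfolding opposite_edges_def using r e1 e Q by blast
  have o2: "opposite_edges D Q' e e2" unfolding opposite_edges_def using c(2) e2 e Q by blast
  have "strip D [Q, Q'] [e1, e, e2]"
    using o1 o2 Int_faces_edge[OF Q e(1,2)] unfolding strip_def by (auto simp: less_Suc_eq nth_Cons split: nat.splits)
  from st[OF this] obtain s where s: "\<forall>i<length [Q, Q']. \<forall>a b c d.
        face_cycle D ([Q, Q'] ! i) a b c d \<and> [e1, e, e2] ! i \<inter> V = {a, b} \<and> [e1, e, e2] ! Suc i \<inter> V = {d, c}
        \<longrightarrow> twist (f a) (f b) (f c) (f d) = s" unfolding equi_twisted_def by blast
  have "twist (f d) (f c) (f w) (f v) = s" using s[rule_format, of 0 d c w v] r e1 e by simp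
  moreover have "twist (f v) (f w) (f c') (f d') = s" using s[rule_format, of 1 v w c' d'] c e2 e by simp
  ultimately show ?thesis using twist_relabel(2)[of "f d" "f c" "f w" "f v"] by simp
qed

section \<open>Nets from solutions of the local system of Gaussian curvatures\<close>

text \<open>\<open>r\<close> stands for the logarithm of \<open>k * curv_at Q v\<close>. Subtracting
  the constant leaves ln k as seen from v in Q, the sign turns it into ln k as seen from w, and the
  constant of w is added. The choice of Q is immaterial by \<open>transport_eq\<close>.\<close>

definition transport :: "'a \<Rightarrow> 'a \<Rightarrow> real \<Rightarrow> real" where
  "transport v w r = (let Q = SOME Q. Q \<in> faces D \<and> v \<in> Q \<and> w \<in> Q
     in \<epsilon> Q v w * (r - ln (curv_at Q v)) + ln (curv_at Q w))"

text \<open>Distinct faces that contain v \<noteq> w share the edge between them, so the slope is -1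
  in both. The formula then involves only the sum of the two logarithmic constants, which is the
  same for both faces by \<open>curv_product\<close>.\<close>

lemma transport_eq:
  assumes Q: "Q \<in> faces D" "v \<in> Q \<inter> V" "w \<in> Q \<inter> V"
  shows "transport v w r = \<epsilon> Q v w * (r - ln (curv_at Q v)) + ln (curv_at Q w)"
proof -
  define R where "R = (SOME Q. Q \<in> faces D \<and> v \<in> Q \<and> w \<in> Q)"
  have R: "R \<in> faces D" "v \<in> R \<inter> V" "w \<in> R \<inter> V"
    using someI[of "\<lambda>Q. Q \<in> faces D \<and> v \<in> Q \<and> w \<in> Q" Q] Q unfolding R_def by auto
  have t: "transport v w r = \<epsilon> R v w * (r - ln (curv_at R v)) + ln (curv_at R w)"
    by (simp add: transport_def R_def Let_def)
  show ?thesis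
  proof (cases "v = w \<or> R = Q")
    case True
    then show ?thesis unfolding t using \<epsilon>_refl Q R by auto
  next
    case False
    obtain e where e: "e \<in> edges_of D Q" "e \<in> edges_of D R" "e \<inter> V = {v, w}"
      using common_vertices[OF Q(1) R(1)] False Q R by (metis IntD1 IntD2 IntI)
    have eps: "\<epsilon> Q v w = - 1" "\<epsilon> R v w = - 1" unfolding \<epsilon>_def using e by (auto intro: rev_image_eqI)
    obtain c d c' d' where c: "face_cycle D Q v w c d" "face_cycle D R v w c' d'"
      using shared_edge_cycles[OF Q(1) R(1) e] .
    have cw: "face_cycle D Q w v d c" "face_cycle D R w v d' c'"
      using face_cycle_reflect[OF face_cycle_rotate[OF c(1)]] face_cycle_reflect[OF face_cycle_rotate[OF c(2)]] by auto
    have "curv_at Q v * curv_at Q w = curv_at R v * curv_at R w"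
      unfolding curv_at_eq[OF c(1)] curv_at_eq[OF c(2)] curv_at_eq[OF cw(1)] curv_at_eq[OF cw(2)]
      by (rule curv_product[OF c])
    then have "ln (curv_at Q v) + ln (curv_at Q w) = ln (curv_at R v) + ln (curv_at R w)"
      using curv_at_pos Q R by (metis ln_mult_pos)
    then show ?thesis unfolding t eps by simp
  qed
qed

text \<open>A point of three star neighbourhoods lies on a face that contains the three centres, and
  there the cocycle condition is \<open>\<epsilon>_trans\<close>.\<close>

lemma cocycle: "cech_cocycle S V star_nbhd transport"
proof
  show "openin (top_of_set S) (star_nbhd v)" for v by (rule star_nbhd_open)
  show "\<exists>v\<in>V. x \<in> star_nbhd v" if "x \<in> S" for x using star_nbhds_cover[OF that] .
  show "transport v v r = r" if v: "v \<in> V" for v r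
  proof -
    obtain Q where "Q \<in> faces D" "v \<in> Q" using star_nbhd_face[OF centre_in_star[OF v]] centre_in_star[OF v] by metis
    then show ?thesis using transport_eq[of Q v v r] \<epsilon>_refl[of Q v] v by simp
  qed
  show "transport v w (transport u v r) = transport u w r"
    if h: "u \<in> V" "v \<in> V" "w \<in> V" "x \<in> star_nbhd u" "x \<in> star_nbhd v" "x \<in> star_nbhd w" for u v w x r
  proof -
    obtain Q where Q: "Q \<in> faces D" "\<And>w. x \<in> star_nbhd w \<Longrightarrow> w \<in> Q" using star_nbhd_face[OF h(4)] by blast
    then have m: "u \<in> Q \<inter> V" "v \<in> Q \<inter> V" "w \<in> Q \<inter> V" using h by auto
    show ?thesis
      unfolding transport_eq[OF Q(1) m(1,2)] transport_eq[OF Q(1) m(2,3)] transport_eq[OF Q(1) m(1,3)]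
        \<epsilon>_trans[OF Q(1) m, symmetric] by simp
  qed
qed

definition solution :: "('a \<Rightarrow> real) \<Rightarrow> bool" where
  "solution s \<longleftrightarrow> (\<forall>Q\<in>faces D. \<forall>v\<in>Q \<inter> V. \<forall>w\<in>Q \<inter> V.
     s w - ln (curv_at Q w) = \<epsilon> Q v w * (s v - ln (curv_at Q v)))"

lemma solution_exists:
  assumes "simply_connected S" "v\<^sub>0 \<in> V"
  obtains s where "solution s" "s v\<^sub>0 = r\<^sub>0"
proof -
  interpret cech_cocycle S V star_nbhd transport by (rule cocycle)
  obtain s where s: "s v\<^sub>0 = r\<^sub>0"
    "\<And>v w. v \<in> V \<Longrightarrow> w \<in> V \<Longrightarrow> star_nbhd v \<inter> star_nbhd w \<noteq> {} \<Longrightarrow> s w = transport v w (s v)"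
    using global_section[OF assms(1) star_nbhd_path_connected _ assms(2), of r\<^sub>0] centre_in_star by (metis empty_iff)
  have "solution s"
    unfolding solution_def
  proof (intro ballI)
    fix Q v w assume h: "Q \<in> faces D" "v \<in> Q \<inter> V" "w \<in> Q \<inter> V"
    then have "s w = transport v w (s v)" by (intro s(2) star_nbhds_meet[of _ Q]) simp_all
    then show "s w - ln (curv_at Q w) = \<epsilon> Q v w * (s v - ln (curv_at Q v))" using transport_eq[OF h] by simp
  qed
  then show thesis using that s(1) by blast
qed

text \<open>The conditions are affine in s, so a combination with weights 1 - t and t is again a
  solution. This supplies the parameter of the family of nets.\<close>

lemma solution_affine:
  assumes "solution s" "solution s'" shows "solution (\<lambda>v. (1 - t) * s v + t * s' v)"
  unfolding solution_def
proof (intro ballI)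
  fix Q v w assume h: "Q \<in> faces D" "v \<in> Q \<inter> V" "w \<in> Q \<inter> V"
  let ?L = "\<lambda>v. ln (curv_at Q v)"
  have "s w - ?L w = \<epsilon> Q v w * (s v - ?L v)" "s' w - ?L w = \<epsilon> Q v w * (s' v - ?L v)"
    using assms h unfolding solution_def by blast+
  then have "(1 - t) * (s w - ?L w) + t * (s' w - ?L w)
      = (1 - t) * (\<epsilon> Q v w * (s v - ?L v)) + t * (\<epsilon> Q v w * (s' v - ?L v))" by simp
  then show "(1 - t) * s w + t * s' w - ?L w = \<epsilon> Q v w * ((1 - t) * s v + t * s' v - ?L v)"
    by (simp add: algebra_simps)
qed

text \<open>Every vertex of a face gives the same patch, by \<open>patch_at_change\<close> and the
  equation of a solution, so an arbitrary one may be picked.\<close>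

definition solution_net :: "('a \<Rightarrow> real) \<Rightarrow> 'a set \<Rightarrow> ppoint set" where
  "solution_net s = (\<lambda>Q\<in>faces D. let v = SOME v. v \<in> Q \<inter> V in patch_at Q v (exp (s v - ln (curv_at Q v))))"

lemma solution_net_eq:
  assumes s: "solution s" and h: "Q \<in> faces D" "v \<in> Q \<inter> V"
  shows "solution_net s Q = patch_at Q v (exp (s v - ln (curv_at Q v)))"
proof -
  define u where "u = (SOME v. v \<in> Q \<inter> V)"
  have u: "u \<in> Q \<inter> V" unfolding u_def by (rule someI[of "\<lambda>v. v \<in> Q \<inter> V" v, OF h(2)])
  have "solution_net s Q = patch_at Q u (exp (s u - ln (curv_at Q u)))"
    using h(1) by (simp add: solution_net_def u_def Let_def)
  also have "\<dots> = patch_at Q v (exp (\<epsilon> Q u v * (s u - ln (curv_at Q u))))"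
    by (rule patch_at_change[OF h(1) u h(2), symmetric])
  also have "\<epsilon> Q u v * (s u - ln (curv_at Q u)) = s v - ln (curv_at Q v)"
    using s[unfolded solution_def, rule_format, OF h(1) u h(2)] by simp
  finally show ?thesis .
qed

lemma solution_net_hyperbolic:
  assumes s: "solution s" and st: "\<And>Qs es. strip D Qs es \<Longrightarrow> equi_twisted D f Qs es"
  shows "solution_net s \<in> hyperbolic_nets D f"
proof -
  have ext: "solution_net s \<in> (\<Pi>\<^sub>E Q\<in>faces D. face_patches D f Q)"
  proof (rule PiE_I)
    fix Q assume Q: "Q \<in> faces D"
    obtain a b c d where cy: "face_cycle D Q a b c d" using face_cycle_exists[OF Q] .
    then have a: "a \<in> Q \<inter> V" using face_cycle_vertices(2,6)[OF cy] by simp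
    have "exp (s a - ln (curv_at Q a)) > 0" by simp
    then show "solution_net s Q \<in> face_patches D f Q"
      unfolding solution_net_eq[OF s Q a] face_patches_eq[OF Q a] by blast
  qed (simp add: solution_net_def)
  have "C1_joint (affine_pt -` solution_net s Q) (affine_pt -` solution_net s Q') (f w - f v) p"
    if Q: "Q \<in> faces D" "Q' \<in> faces D" "Q \<noteq> Q'" and e: "e \<in> edges_of D Q" "e \<in> edges_of D Q'" "e \<inter> V = {v, w}"
      and p: "p \<in> edge_segment D f e" for Q Q' e v w p
  proof -
    obtain c d c' d' where c: "face_cycle D Q v w c d" "face_cycle D Q' v w c' d'"
      using shared_edge_cycles[OF Q(1,2) e] .
    have v: "v \<in> Q \<inter> V" "v \<in> Q' \<inter> V" using face_cycle_vertices[OF c(1)] face_cycle_vertices[OF c(2)] by auto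
    define k k' where "k = exp (s v - ln (curv_at Q v))" and "k' = exp (s v - ln (curv_at Q' v))"
    have "k * curv_at Q v = exp (s v)" "k' * curv_at Q' v = exp (s v)"
      using curv_at_pos[OF Q(1) v(1)] curv_at_pos[OF Q(2) v(2)] by (simp_all add: k_def k'_def exp_diff)
    then have cu: "k * curv (f v) (f w) (f c) (f d) = k' * curv (f v) (f w) (f c') (f d')"
      unfolding curv_at_eq[OF c(1)] curv_at_eq[OF c(2)] by simp
    have k: "k > 0" "k' > 0" by (simp_all add: k_def k'_def)
    have p': "p \<in> closed_segment (f v) (f w)" using p edge_segment_eq[OF e(3)] by simp
    have "C1_joint (patch k (f v) (f w) (f c) (f d)) (patch k' (f v) (f w) (f c') (f d')) (f w - f v) p"
      by (rule twist_eqI[OF Q(3) c k equi_twisted_imp_twist_eq[OF st Q e c] cu p'])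
    then show ?thesis
      unfolding solution_net_eq[OF s Q(1) v(1)] solution_net_eq[OF s Q(2) v(2)] k_def[symmetric] k'_def[symmetric]
        vimage_patch_at[OF c(1)] vimage_patch_at[OF c(2)] .
  qed
  then show ?thesis using ext unfolding hyperbolic_nets_def by blast
qed

lemma net_exists:
  assumes sc: "simply_connected S" and st: "\<And>Qs es. strip D Qs es \<Longrightarrow> equi_twisted D f Qs es"
    and Q: "Q \<in> faces D" and P: "P \<in> face_patches D f Q"
  obtains N where "N \<in> hyperbolic_nets D f" "N Q = P"
proof -
  obtain a b c d where cy: "face_cycle D Q a b c d" using face_cycle_exists[OF Q] .
  then have a: "a \<in> Q \<inter> V" using face_cycle_vertices(2,6)[OF cy] by simp
  obtain k where k: "k > 0" "P = patch_at Q a k" using P unfolding face_patches_eq[OF Q a] by blast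
  \<comment> \<open>With this value at a, the solution assigns exp (ln k) = k to the face Q.\<close>
  obtain s where s: "solution s" "s a = ln k + ln (curv_at Q a)" using solution_exists[OF sc, of a] a by blast
  have "solution_net s Q = P" unfolding solution_net_eq[OF s(1) Q a] k(2) s(2) using k(1) by simp
  then show thesis using that solution_net_hyperbolic[OF s(1) st] by blast
qed

text \<open>The rational bilinear parametrization is jointly continuous in k > 0 and the point of
  the square, since its denominator stays positive.\<close>

lemma continuous_patch_at:
  assumes Q: "Q \<in> faces D" "v \<in> Q \<inter> V" and K: "continuous_on UNIV K" "\<And>t. K t > 0"
  shows "continuous_patch_family (\<lambda>t. patch_at Q v (K t))"
proof -
  obtain b c d where c: "face_cycle D Q v b c d" using cycle_from[OF Q] .
  define g where "g = (\<lambda>(t, u). patch_param (f v) (f b) (f c) (f d) (K t) u)"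
  have pos: "patch_weight (K (fst p)) (fst (snd p)) (snd (snd p)) \<noteq> 0" if "p \<in> UNIV \<times> unit_square" for p
    using that patch_weight_pos[OF K(2), of "fst (snd p)" "snd (snd p)"] by (auto simp: less_imp_neq[THEN not_sym] mem_Times_iff)
  have cK: "continuous_on (UNIV \<times> unit_square) (\<lambda>p. K (fst p))"
    by (rule continuous_on_compose2[OF K(1)]) (auto intro: continuous_intros)
  have "continuous_on (UNIV \<times> unit_square) g"
    unfolding g_def patch_param_def case_prod_beta
  proof (intro continuous_on_scaleR continuous_on_divide ballI)
    show "continuous_on (UNIV \<times> unit_square) (\<lambda>x. patch_weight (K (fst x)) (fst (snd x)) (snd (snd x)))"
      unfolding patch_weight_def by (intro continuous_intros cK)
    show "continuous_on (UNIV \<times> unit_square) (\<lambda>x.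
       (K (fst x) * (1 - fst (snd x)) * (1 - snd (snd x))) *\<^sub>R f v + (fst (snd x) * (1 - snd (snd x))) *\<^sub>R f b +
       (fst (snd x) * snd (snd x)) *\<^sub>R f c + ((1 - fst (snd x)) * snd (snd x)) *\<^sub>R f d)"
      by (intro continuous_intros cK)
  qed (use pos in \<open>auto intro: continuous_intros\<close>)
  moreover have "patch_at Q v (K t) = affine_pt ` (\<lambda>x. g (t, x)) ` unit_square" for t
    unfolding patch_at_eq[OF c] g_def by (simp add: patch_param_image[OF K(2)])
  ultimately show ?thesis unfolding continuous_patch_family_def by blast
qed

text \<open>The line through two solutions that give ln k = 0 and ln k = 1 on the face
  \<open>Q0\<close> gives ln k = t there. Its affine dependence on t at every vertex yields
  continuity on all faces, and uniqueness of nets makes the parameter bijective.\<close>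

lemma net_family:
  assumes sc: "simply_connected S" and st: "\<And>Qs es. strip D Qs es \<Longrightarrow> equi_twisted D f Qs es"
  shows "\<exists>\<Phi>::real \<Rightarrow> 'a set \<Rightarrow> ppoint set.
         bij_betw \<Phi> UNIV (hyperbolic_nets D f) \<and>
         (\<forall>Q\<in>faces D. bij_betw (\<lambda>t. \<Phi> t Q) UNIV (face_patches D f Q) \<and>
            continuous_patch_family (\<lambda>t. \<Phi> t Q))"
proof -
  have con: "connected S"
    using simply_connected_imp_path_connected_topological[OF sc] by (rule path_connected_imp_connected)
  have "S \<noteq> {}" using quad by (simp add: quad_graph_def topological_surface_def)
  then obtain Q0 where Q0: "Q0 \<in> faces D" using Union_faces by blast
  obtain a b c d where cy: "face_cycle D Q0 a b c d" using face_cycle_exists[OF Q0] .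
  then have a: "a \<in> Q0 \<inter> V" using face_cycle_vertices(2,6)[OF cy] by simp
  then have aV: "a \<in> V" by blast
  obtain s0 where s0: "solution s0" "s0 a = ln (curv_at Q0 a)" using solution_exists[OF sc aV] .
  obtain s1 where s1: "solution s1" "s1 a = 1 + ln (curv_at Q0 a)" using solution_exists[OF sc aV] .
  define s where "s t = (\<lambda>v. (1 - t) * s0 v + t * s1 v)" for t
  have s: "solution (s t)" for t unfolding s_def by (rule solution_affine[OF s0(1) s1(1)])
  have sa: "s t a - ln (curv_at Q0 a) = t" for t by (simp add: s_def s0 s1 algebra_simps)
  define \<Phi> where "\<Phi> t = solution_net (s t)" for t
  have \<Phi>: "\<Phi> t \<in> hyperbolic_nets D f" for t unfolding \<Phi>_def by (rule solution_net_hyperbolic[OF s st])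
  have \<Phi>0: "\<Phi> t Q0 = patch_at Q0 a (exp t)" for t unfolding \<Phi>_def solution_net_eq[OF s Q0 a] sa ..
  have inj: "t = t'" if "\<Phi> t = \<Phi> t'" for t t'
  proof -
    have "patch_at Q0 a (exp t) = patch_at Q0 a (exp t')" using that \<Phi>0 by metis
    then have "exp t = exp t'" by (rule patch_at_inject[OF Q0 a exp_gt_zero])
    then show ?thesis by simp
  qed
  have surj: "\<exists>t. N = \<Phi> t" if N: "N \<in> hyperbolic_nets D f" for N
  proof -
    obtain k where k: "k > 0" "N Q0 = patch_at Q0 a k" using net_patch[OF N Q0 a] .
    then have "N Q0 = \<Phi> (ln k) Q0" by (simp add: \<Phi>0)
    then show ?thesis using net_unique[OF con N \<Phi> Q0] by blast
  qed
  have b1: "bij_betw \<Phi> UNIV (hyperbolic_nets D f)"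
    unfolding bij_betw_def inj_on_def using inj surj \<Phi> by blast
  have "bij_betw (\<lambda>t. \<Phi> t Q) UNIV (face_patches D f Q) \<and> continuous_patch_family (\<lambda>t. \<Phi> t Q)"
    if Q: "Q \<in> faces D" for Q
  proof
    have "\<Phi> t Q \<in> face_patches D f Q" for t using \<Phi>[of t] Q by (auto simp: hyperbolic_nets_def PiE_iff)
    moreover have "\<exists>t. P = \<Phi> t Q" if "P \<in> face_patches D f Q" for P
      using net_exists[OF sc st Q that] surj by metis
    moreover have "t = t'" if "\<Phi> t Q = \<Phi> t' Q" for t t'
      using net_unique[OF con \<Phi> \<Phi> Q that] inj by blast
    ultimately show "bij_betw (\<lambda>t. \<Phi> t Q) UNIV (face_patches D f Q)"
      unfolding bij_betw_def inj_on_def by blast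
    obtain v b c d where cy: "face_cycle D Q v b c d" using face_cycle_exists[OF Q] .
    then have v: "v \<in> Q \<inter> V" using face_cycle_vertices(2,6)[OF cy] by simp
    show "continuous_patch_family (\<lambda>t. \<Phi> t Q)"
      unfolding \<Phi>_def solution_net_eq[OF s Q v]
      by (rule continuous_patch_at[OF Q v]) (auto simp: s_def intro!: continuous_intros)
  qed
  then show ?thesis using b1 by blast
qed

end

theorem theorem21:
  fixes D :: "('a::topological_space) cell_decomposition" and f :: "'a \<Rightarrow> real^3"
  assumes "simply_connected_quad_graph D"
    and "generic_affine_A_net D f"
    and "cusps_excluded D f"
  shows "(hyperbolic_nets D f \<noteq> {} \<longleftrightarrow> (\<forall>Qs es. strip D Qs es \<longrightarrow> equi_twisted D f Qs es)) \<and>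
    ((\<forall>Qs es. strip D Qs es \<longrightarrow> equi_twisted D f Qs es) \<longrightarrow>
      (\<forall>Q\<in>faces D. \<forall>P\<in>face_patches D f Q. \<exists>!N. N \<in> hyperbolic_nets D f \<and> N Q = P) \<and>
      (\<exists>\<Phi>::real \<Rightarrow> 'a set \<Rightarrow> ppoint set.
         bij_betw \<Phi> UNIV (hyperbolic_nets D f) \<and>
         (\<forall>Q\<in>faces D. bij_betw (\<lambda>t. \<Phi> t Q) UNIV (face_patches D f Q) \<and>
            continuous_patch_family (\<lambda>t. \<Phi> t Q))))"
proof -
  interpret affine_net D f
    using assms by unfold_locales (simp_all add: simply_connected_quad_graph_def)
  have sc: "simply_connected (surface D)" using assms(1) by (simp add: simply_connected_quad_graph_def)
  have con: "connected (surface D)"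
    using simply_connected_imp_path_connected_topological[OF sc] by (rule path_connected_imp_connected)
  have family: "\<exists>\<Phi>::real \<Rightarrow> 'a set \<Rightarrow> ppoint set.
         bij_betw \<Phi> UNIV (hyperbolic_nets D f) \<and>
         (\<forall>Q\<in>faces D. bij_betw (\<lambda>t. \<Phi> t Q) UNIV (face_patches D f Q) \<and>
            continuous_patch_family (\<lambda>t. \<Phi> t Q))"
    if "\<forall>Qs es. strip D Qs es \<longrightarrow> equi_twisted D f Qs es"
    by (rule net_family[OF sc]) (use that in blast)
  have "hyperbolic_nets D f \<noteq> {}" if "\<forall>Qs es. strip D Qs es \<longrightarrow> equi_twisted D f Qs es"
    using family[OF that] by (metis UNIV_I bij_betwE empty_iff)
  moreover have "equi_twisted D f Qs es" if "hyperbolic_nets D f \<noteq> {}" "strip D Qs es" for Qs es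
    using that net_imp_equi_twisted by blast
  moreover have "\<exists>!N. N \<in> hyperbolic_nets D f \<and> N Q = P"
    if st: "\<forall>Qs es. strip D Qs es \<longrightarrow> equi_twisted D f Qs es" and Q: "Q \<in> faces D" "P \<in> face_patches D f Q" for Q P
  proof -
    obtain N where N: "N \<in> hyperbolic_nets D f" "N Q = P"
      using net_exists[OF sc _ Q] st by blast
    then show ?thesis using net_unique[OF con _ _ Q(1)] by metis
  qed
  ultimately show ?thesis using family by blast
qed

end
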